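(* Let $Q$ be a smooth manifold and let $R_d\colon TQ\to Q\times Q$ be a discretization map on $Q$. Then $$R_d^{T^*}=\Phi^{-1}\circ\widehat{R_d}\circ\alpha_Q\colon TT^*Q\to T^*Q\times T^*Q$$ is a discretization map on $T^*Q$.
   Context: Discretization map: let $M$ be a smooth manifold and $U\subset TM$ an open neighborhood of the zero section. A smooth map $R_d\colon U\to M\times M$, $R_d(x,v)=(R^1(x,v),R^2(x,v))$, is a discretization map on $M$ if (1) $R_d(x,0)=(x,x)$ for all $x\in M$; and (2) for every $x\in M$, $T_{0_x}R^2_x-T_{0_x}R^1_x\colon T_{0_x}T_xM\simeq T_xM\to T_xM$ is the identity map of $T_xM$, where $R^a_x$ is the restriction of $R^a$ to (the part in $U$ of) $T_xM$, $a=1,2$. Every discretization map is a local diffeomorphism on some neighborhood of the zero section. Maps involved: - $\alpha_Q\colon TT^*Q\to T^*TQ$ is the canonical (Tulczyjew) diffeomorphism, given in local coordinates $(q,p,\dot q,\dot p)$ of $TT^*Q$ and $(q,v,p_q,p_v)$ of $T^*TQ$ by $\alpha_Q(q,p,\dot q,\dot p)=(q,\dot q,\dot p,p)$. - For a (local) diffeomorphism $F\colon M_1\to M_2$, $\widehat F\colon T^*M_1\to T^*M_2$ is $\widehat F(\alpha_x)=\alpha_x\circ (T_xF)^{-1}\in T^*_{F(x)}M_2$ for $\alpha_x\in T_x^*M_1$. Thus $\widehat{R_d}\colon T^*TQ\to T^*(Q\times Q)$, $\widehat{R_d}(q,v,p_q,p_v)=\bigl(R_d(q,v),(p_q,p_v)(D_{(q,v)}R_d)^{-1}\bigr)$.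 - $\Phi\colon T^*Q\times T^*Q\to T^*(Q\times Q)$ is the diffeomorphism $\Phi(q_0,p_0;q_1,p_1)=(q_0,q_1,-p_0,p_1)$. Convention on domains: all maps are understood near zero sections, i.e. if $U\subset TQ$ is an open neighborhood of the zero section on which $R_d$ is defined and is a local diffeomorphism, then $\widehat{R_d}$ is defined on $T^*U\subset T^*TQ$ and $R_d^{T^*}$ on $\alpha_Q^{-1}(T^*U)$, an open neighborhood of the zero section of $\tau_{T^*Q}\colon TT^*Q\to T^*Q$. *)

theory Defs
  imports "HOL-Analysis.Analysis"
begin

section \<open>Smooth maps between vector spaces\<close>

text \<open>
  The model spaces below are inner product spaces that are required to be finite-dimensional
  in \<open>smooth_manifold\<close>. The class \<open>euclidean_space\<close> is not used because it excludes
  dimension 0. In finite dimension, being \<open>C\<^sup>k\<^sup>+\<^sup>1\<close> on an open set is the same as being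
  differentiable with all directional derivatives \<open>C\<^sup>k\<close>.
\<close>

primrec Ck_on :: "nat \<Rightarrow> 'e::real_normed_vector set \<Rightarrow> ('e \<Rightarrow> 'f::real_normed_vector) \<Rightarrow> bool" where
  "Ck_on 0 S f = continuous_on S f"
| "Ck_on (Suc k) S f =
     ((\<forall>x\<in>S. f differentiable (at x)) \<and> (\<forall>v. Ck_on k S (\<lambda>x. frechet_derivative f (at x) v)))"

definition smooth_on :: "'e::real_normed_vector set \<Rightarrow> ('e \<Rightarrow> 'f::real_normed_vector) \<Rightarrow> bool" where
  "smooth_on S f \<longleftrightarrow> open S \<and> (\<forall>k. Ck_on k S f)"


section \<open>Smooth manifolds\<close>

text \<open>
  A manifold is represented by a smooth atlas, not necessarily a maximal one. A chart is a pair
  of a domain and a map whose values outside the domain are irrelevant. The underlying set and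
  the topology are determined by the atlas: a set is open iff its image in every chart is open.
\<close>

type_synonym ('a, 'e) chart = "'a set \<times> ('a \<Rightarrow> 'e)"
type_synonym ('a, 'e) atlas = "('a, 'e) chart set"

definition chart_inv :: "('a, 'e) chart \<Rightarrow> 'e \<Rightarrow> 'a" where
  "chart_inv c = inv_into (fst c) (snd c)"

definition carrier :: "('a, 'e) atlas \<Rightarrow> 'a set" where
  "carrier M = (\<Union>c\<in>M. fst c)"

definition charts_at :: "('a, 'e) atlas \<Rightarrow> 'a \<Rightarrow> ('a, 'e) chart set" where
  "charts_at M x = {c\<in>M. x \<in> fst c}"

definition smooth_atlas :: "('a, 'e::real_inner) atlas \<Rightarrow> bool" where
  "smooth_atlas M \<longleftrightarrow>
     (\<forall>c\<in>M. inj_on (snd c) (fst c) \<and> open (snd c ` fst c)) \<and>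
     (\<forall>c\<in>M. \<forall>d\<in>M. smooth_on (snd c ` (fst c \<inter> fst d)) (snd d \<circ> chart_inv c))"

definition mtop :: "('a, 'e::real_inner) atlas \<Rightarrow> 'a topology" where
  "mtop M = topology (\<lambda>S. S \<subseteq> carrier M \<and> (\<forall>c\<in>M. open (snd c ` (S \<inter> fst c))))"

lemma openin_mtop:
  assumes "smooth_atlas M"
  shows "openin (mtop M) S \<longleftrightarrow> S \<subseteq> carrier M \<and> (\<forall>c\<in>M. open (snd c ` (S \<inter> fst c)))"
proof -
  have *: "snd c ` (S \<inter> T \<inter> fst c) = snd c ` (S \<inter> fst c) \<inter> snd c ` (T \<inter> fst c)"
    if "c \<in> M" for c S T
  proof -
    have "inj_on (snd c) (fst c)" using assms that by (auto simp: smooth_atlas_def)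
    then show ?thesis by (auto simp: inj_on_def)
  qed
  have "istopology (\<lambda>S. S \<subseteq> carrier M \<and> (\<forall>c\<in>M. open (snd c ` (S \<inter> fst c))))"
    unfolding istopology_def
  proof (intro conjI allI impI ballI)
    fix S T c
    assume "S \<subseteq> carrier M \<and> (\<forall>c\<in>M. open (snd c ` (S \<inter> fst c)))"
      and "T \<subseteq> carrier M \<and> (\<forall>c\<in>M. open (snd c ` (T \<inter> fst c)))" and "c \<in> M"
    then show "open (snd c ` (S \<inter> T \<inter> fst c))" by (simp add: * open_Int)
  next
    fix \<K> c
    assume "\<forall>S\<in>\<K>. S \<subseteq> carrier M \<and> (\<forall>c\<in>M. open (snd c ` (S \<inter> fst c)))" and "c \<in> M"
    then have "open (\<Union>S\<in>\<K>. snd c ` (S \<inter> fst c))" by (intro open_UN) blast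
    moreover have "snd c ` (\<Union>\<K> \<inter> fst c) = (\<Union>S\<in>\<K>. snd c ` (S \<inter> fst c))" by blast
    ultimately show "open (snd c ` (\<Union>\<K> \<inter> fst c))" by simp
  qed blast+
  then show ?thesis by (simp add: mtop_def topology_inverse')
qed

definition second_countable :: "'a topology \<Rightarrow> bool" where
  "second_countable X \<longleftrightarrow>
     (\<exists>\<B>. countable \<B> \<and> (\<forall>B\<in>\<B>. openin X B) \<and>
          (\<forall>S x. openin X S \<and> x \<in> S \<longrightarrow> (\<exists>B\<in>\<B>. x \<in> B \<and> B \<subseteq> S)))"

definition smooth_manifold :: "('a, 'e::real_inner) atlas \<Rightarrow> bool" where
  "smooth_manifold M \<longleftrightarrow>
     (\<exists>B. finite B \<and> span B = (UNIV :: 'e set)) \<and>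
     smooth_atlas M \<and> Hausdorff_space (mtop M) \<and> second_countable (mtop M)"

definition smooth_map_on ::
  "('a, 'e::real_inner) atlas \<Rightarrow> ('b, 'f::real_inner) atlas \<Rightarrow> 'a set \<Rightarrow> ('a \<Rightarrow> 'b) \<Rightarrow> bool" where
  "smooth_map_on M N U F \<longleftrightarrow>
     openin (mtop M) U \<and> F ` U \<subseteq> carrier N \<and>
     (\<forall>x\<in>U. \<exists>c\<in>M. \<exists>d\<in>N. \<exists>V. openin (mtop M) V \<and> x \<in> V \<and> V \<subseteq> U \<inter> fst c \<and> F ` V \<subseteq> fst d \<and>
        smooth_on (snd c ` V) (snd d \<circ> F \<circ> chart_inv c))"

definition local_diffeo_on ::
  "('a, 'e::real_inner) atlas \<Rightarrow> ('b, 'f::real_inner) atlas \<Rightarrow> 'a set \<Rightarrow> ('a \<Rightarrow> 'b) \<Rightarrow> bool" where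
  "local_diffeo_on M N U F \<longleftrightarrow>
     (\<forall>x\<in>U. \<exists>V. openin (mtop M) V \<and> x \<in> V \<and> V \<subseteq> U \<and> openin (mtop N) (F ` V) \<and> inj_on F V \<and>
        smooth_map_on M N V F \<and> smooth_map_on N M (F ` V) (inv_into V F))"

definition prod_chart :: "('a, 'e) chart \<Rightarrow> ('b, 'f) chart \<Rightarrow> ('a \<times> 'b, 'e \<times> 'f) chart" where
  "prod_chart c d = (fst c \<times> fst d, map_prod (snd c) (snd d))"

definition prod_mfd :: "('a, 'e) atlas \<Rightarrow> ('b, 'f) atlas \<Rightarrow> ('a \<times> 'b, 'e \<times> 'f) atlas" where
  "prod_mfd M N = {prod_chart c d | c d. c \<in> M \<and> d \<in> N}"


section \<open>Tangent bundle\<close>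

text \<open>
  A tangent vector at \<open>x\<close> is a family of components, one for each chart around \<open>x\<close>, that
  transforms by the derivatives of the transition maps. Components in charts not containing
  \<open>x\<close> are set to 0, so that equality of families is equality of tangent vectors.
\<close>

type_synonym ('a, 'e) tvec = "('a, 'e) chart \<Rightarrow> 'e"

definition tangent_space :: "('a, 'e::real_inner) atlas \<Rightarrow> 'a \<Rightarrow> ('a, 'e) tvec set" where
  "tangent_space M x = {v.
     (\<forall>c. c \<notin> charts_at M x \<longrightarrow> v c = 0) \<and>
     (\<forall>c\<in>charts_at M x. \<forall>d\<in>charts_at M x.
        v d = frechet_derivative (snd d \<circ> chart_inv c) (at (snd c x)) (v c))}"

definition tzero :: "('a, 'e::real_inner) tvec" where
  "tzero = (\<lambda>c. 0)"

definition tangent_chart ::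
  "('a, 'e::real_inner) atlas \<Rightarrow> ('a, 'e) chart \<Rightarrow> ('a \<times> ('a, 'e) tvec, 'e \<times> 'e) chart" where
  "tangent_chart M c = (Sigma (fst c) (tangent_space M), \<lambda>(x, v). (snd c x, v c))"

definition tangent_bundle ::
  "('a, 'e::real_inner) atlas \<Rightarrow> ('a \<times> ('a, 'e) tvec, 'e \<times> 'e) atlas" where
  "tangent_bundle M = tangent_chart M ` M"

text \<open>
  The tangent map \<open>T\<^sub>xF\<close>. The result does not depend on the chart chosen around \<open>x\<close>, and only
  the values of \<open>F\<close> near \<open>x\<close> matter.
\<close>

definition tangent_map ::
  "('a, 'e::real_inner) atlas \<Rightarrow> ('b, 'f::real_inner) atlas \<Rightarrow> ('a \<Rightarrow> 'b) \<Rightarrow> 'a \<Rightarrow>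
   ('a, 'e) tvec \<Rightarrow> ('b, 'f) tvec" where
  "tangent_map M N F x v =
     (let c = (SOME c. c \<in> charts_at M x) in
      (\<lambda>d. if d \<in> charts_at N (F x)
           then frechet_derivative (snd d \<circ> F \<circ> chart_inv c) (at (snd c x)) (v c) else 0))"

text \<open>
  \<open>T\<^sub>xM\<close> as a manifold, with the linear charts given by taking components. In these charts the
  canonical isomorphism \<open>T\<^sub>xM \<simeq> T\<^sub>0(T\<^sub>xM)\<close> sends \<open>v\<close> to the vector whose components
  are those of \<open>v\<close> itself.
\<close>

definition fibre_mfd :: "('a, 'e::real_inner) atlas \<Rightarrow> 'a \<Rightarrow> (('a, 'e) tvec, 'e) atlas" where
  "fibre_mfd M x = (\<lambda>c. (tangent_space M x, \<lambda>v. v c)) ` charts_at M x"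

definition fibre_iso ::
  "('a, 'e::real_inner) atlas \<Rightarrow> 'a \<Rightarrow> ('a, 'e) tvec \<Rightarrow> (('a, 'e) tvec, 'e) tvec" where
  "fibre_iso M x v = (\<lambda>k. if k \<in> fibre_mfd M x then snd k v else 0)"


section \<open>Cotangent bundle\<close>

text \<open>
  A covector at \<open>x\<close> is a linear functional on \<open>T\<^sub>xM\<close>, extended by 0 outside of \<open>T\<^sub>xM\<close>.
\<close>

type_synonym ('a, 'e) covec = "('a, 'e) tvec \<Rightarrow> real"

definition cotangent_space :: "('a, 'e::real_inner) atlas \<Rightarrow> 'a \<Rightarrow> ('a, 'e) covec set" where
  "cotangent_space M x = {\<alpha>.
     (\<forall>v. v \<notin> tangent_space M x \<longrightarrow> \<alpha> v = 0) \<and>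
     (\<forall>v\<in>tangent_space M x. \<forall>w\<in>tangent_space M x. \<alpha> (\<lambda>c. v c + w c) = \<alpha> v + \<alpha> w) \<and>
     (\<forall>r. \<forall>v\<in>tangent_space M x. \<alpha> (\<lambda>c. r *\<^sub>R v c) = r * \<alpha> v)}"

text \<open>The coordinates \<open>p\<close> of a covector, with the dual of the model space identified with the
  model space through the inner product.\<close>

definition covec_coord ::
  "('a, 'e::real_inner) atlas \<Rightarrow> ('a, 'e) chart \<Rightarrow> 'a \<Rightarrow> ('a, 'e) covec \<Rightarrow> 'e" where
  "covec_coord M c x \<alpha> = (THE p. \<forall>v\<in>tangent_space M x. \<alpha> v = p \<bullet> v c)"

definition cotangent_chart ::
  "('a, 'e::real_inner) atlas \<Rightarrow> ('a, 'e) chart \<Rightarrow> ('a \<times> ('a, 'e) covec, 'e \<times> 'e) chart" where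
  "cotangent_chart M c =
     (Sigma (fst c) (cotangent_space M), \<lambda>(x, \<alpha>). (snd c x, covec_coord M c x \<alpha>))"

definition cotangent_bundle ::
  "('a, 'e::real_inner) atlas \<Rightarrow> ('a \<times> ('a, 'e) covec, 'e \<times> 'e) atlas" where
  "cotangent_bundle M = cotangent_chart M ` M"

text \<open>The open subset \<open>T\<^sup>*U\<close> of \<open>T\<^sup>*M\<close> for an open subset \<open>U\<close> of \<open>M\<close>.\<close>

definition cotangent_over ::
  "('a, 'e::real_inner) atlas \<Rightarrow> 'a set \<Rightarrow> ('a \<times> ('a, 'e) covec) set" where
  "cotangent_over M U = {(x, \<alpha>). x \<in> U \<and> (x, \<alpha>) \<in> carrier (cotangent_bundle M)}"

text \<open>The cotangent lift \<open>\<alpha>\<^sub>x \<mapsto> \<alpha>\<^sub>x \<circ> (T\<^sub>xF)\<^sup>-\<^sup>1\<close> of a local diffeomorphism.\<close>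

definition cotangent_lift ::
  "('a, 'e::real_inner) atlas \<Rightarrow> ('b, 'f::real_inner) atlas \<Rightarrow> ('a \<Rightarrow> 'b) \<Rightarrow>
   'a \<times> ('a, 'e) covec \<Rightarrow> 'b \<times> ('b, 'f) covec" where
  "cotangent_lift M N F = (\<lambda>(x, \<alpha>).
     (F x, \<lambda>w. if w \<in> tangent_space N (F x)
                then \<alpha> (inv_into (tangent_space M x) (tangent_map M N F x) w) else 0))"


section \<open>Discretization maps\<close>

definition discretization_map ::
  "('a, 'e::real_inner) atlas \<Rightarrow> ('a \<times> ('a, 'e) tvec) set \<Rightarrow>
   ('a \<times> ('a, 'e) tvec \<Rightarrow> 'a \<times> 'a) \<Rightarrow> bool" where
  "discretization_map M U R \<longleftrightarrow>
     smooth_manifold M \<and>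
     openin (mtop (tangent_bundle M)) U \<and> (\<forall>x\<in>carrier M. (x, tzero) \<in> U) \<and>
     smooth_map_on (tangent_bundle M) (prod_mfd M M) U R \<and>
     (\<forall>x\<in>carrier M. R (x, tzero) = (x, x)) \<and>
     (\<forall>x\<in>carrier M. \<forall>v\<in>tangent_space M x.
        (\<lambda>c. tangent_map (fibre_mfd M x) M (\<lambda>u. snd (R (x, u))) tzero (fibre_iso M x v) c
           - tangent_map (fibre_mfd M x) M (\<lambda>u. fst (R (x, u))) tzero (fibre_iso M x v) c) = v)"


section \<open>The maps \<open>\<alpha>\<^sub>Q\<close> and \<open>\<Phi>\<close>\<close>

text \<open>
  \<open>\<alpha>\<^sub>Q\<close> is specified by its expression in the natural coordinates \<open>((q, p), (q', p'))\<close> of \<open>TT\<^sup>*Q\<close>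
  and \<open>((q, v), (p_q, p_v))\<close> of \<open>T\<^sup>*TQ\<close> induced by every chart of \<open>Q\<close> around the base point.
\<close>

definition tulczyjew ::
  "('a, 'e::real_inner) atlas \<Rightarrow>
   ('a \<times> ('a, 'e) covec) \<times> ('a \<times> ('a, 'e) covec, 'e \<times> 'e) tvec \<Rightarrow>
   ('a \<times> ('a, 'e) tvec) \<times> ('a \<times> ('a, 'e) tvec, 'e \<times> 'e) covec" where
  "tulczyjew Q z = (THE w. w \<in> carrier (cotangent_bundle (tangent_bundle Q)) \<and>
     (\<forall>c\<in>Q.
        let C = tangent_chart (cotangent_bundle Q) (cotangent_chart Q c);
            D = cotangent_chart (tangent_bundle Q) (tangent_chart Q c)
        in z \<in> fst C \<longrightarrow>
           w \<in> fst D \<and> (case snd C z of ((q, p), (q', p')) \<Rightarrow> snd D w = ((q, q'), (p', p)))))"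

text \<open>
  \<open>\<Phi>(q\<^sub>0, p\<^sub>0; q\<^sub>1, p\<^sub>1) = (q\<^sub>0, q\<^sub>1, - p\<^sub>0, p\<^sub>1)\<close>, where \<open>(- p\<^sub>0, p\<^sub>1)\<close> acts on
  \<open>T(Q \<times> Q) = TQ \<times> TQ\<close> through the tangent maps of the two projections.
\<close>

definition Phi ::
  "('a, 'e::real_inner) atlas \<Rightarrow>
   ('a \<times> ('a, 'e) covec) \<times> ('a \<times> ('a, 'e) covec) \<Rightarrow>
   ('a \<times> 'a) \<times> ('a \<times> 'a, 'e \<times> 'e) covec" where
  "Phi Q = (\<lambda>((x, \<alpha>), (y, \<beta>)).
     ((x, y), \<lambda>w. if w \<in> tangent_space (prod_mfd Q Q) (x, y)
        then - \<alpha> (tangent_map (prod_mfd Q Q) Q fst (x, y) w)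
             + \<beta> (tangent_map (prod_mfd Q Q) Q snd (x, y) w)
        else 0))"

definition Phi_inv ::
  "('a, 'e::real_inner) atlas \<Rightarrow>
   ('a \<times> 'a) \<times> ('a \<times> 'a, 'e \<times> 'e) covec \<Rightarrow>
   ('a \<times> ('a, 'e) covec) \<times> ('a \<times> ('a, 'e) covec)" where
  "Phi_inv Q = inv_into (carrier (cotangent_bundle Q) \<times> carrier (cotangent_bundle Q)) (Phi Q)"

end

theory Submission
  imports Defs
begin

text \<open>
  In charts, let \<open>r = (r\<^sub>0, r\<^sub>1)\<close> be the expression of \<open>R\<^sub>d\<close>. The lift sends \<open>(q, p, q', p')\<close> to
  \<open>((r\<^sub>0, P\<^sub>0), (r\<^sub>1, P\<^sub>1))\<close>, where the \<open>r\<^sub>i\<close> are taken at \<open>(q, q')\<close> and the momenta are determined by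
  \<open>(- P\<^sub>0, P\<^sub>1) \<bullet> Dr(q, q') a = (p', p) \<bullet> a\<close> for all \<open>a\<close>. On the zero section \<open>r(q, 0) = (q, q)\<close> and
  \<open>\<partial>\<^sub>v(r\<^sub>1 - r\<^sub>0)(q, 0) = id\<close> force \<open>P\<^sub>0 = P\<^sub>1 = p\<close>. Differentiating the equation along the fibre for
  horizontal \<open>a\<close> gives \<open>P\<^sub>1' - P\<^sub>0' = p'\<close>, because the remaining term is \<open>p\<close> paired with a mixed
  second derivative of \<open>r\<^sub>1 - r\<^sub>0\<close>, which by symmetry is a derivative in \<open>q\<close> of the constant
  \<open>\<partial>\<^sub>v(r\<^sub>1 - r\<^sub>0)(q, 0)\<close>. The same symmetry makes \<open>\<alpha>\<^sub>Q\<close> independent of the chart.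
\<close>

text \<open>Momenta enter the lift only through pairings, and the two halves of the claim use that
  pairing in two forms. The implicit form, against the derivative of \<open>r\<close>, is the one to
  differentiate on the zero section, but it does not show that the momenta depend smoothly on the
  point. The explicit form \<open>(- P\<^sub>0, P\<^sub>1) \<bullet> b = (p', p) \<bullet> Ds
  b\<close>, with \<open>s\<close> a local inverse of \<open>r\<close>, shows just that. The local
  diffeomorphism hypothesis supplies \<open>s\<close>, and with it the invertibility of the tangent
  map inside the cotangent lift. The global objects are specified by \<open>THE\<close>,
  \<open>SOME\<close> and \<open>inv_into\<close>, so each needs an existence, uniqueness or
  independence argument before it has a coordinate formula. The charts around \<open>(x, v)\<close>
  and around the two components of \<open>R (x, v)\<close> are unrelated in general; on the zero
  section a single chart of the base serves at both ends, which is what allows the components there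
  to be subtracted.\<close>

abbreviation fderiv :: "('e::real_normed_vector \<Rightarrow> 'f::real_normed_vector) \<Rightarrow> 'e \<Rightarrow> 'e \<Rightarrow> 'f" ("\<D>") where
  "\<D> f x \<equiv> frechet_derivative f (at x)"

section \<open>Frechet derivatives and local equality\<close>

lemma fderivI: "(f has_derivative f') (at x) \<Longrightarrow> \<D> f x = f'"
  by (metis frechet_derivative_at)

lemma fderiv_works: "f differentiable (at x) \<Longrightarrow> (f has_derivative \<D> f x) (at x)"
  by (simp add: frechet_derivative_works)

lemma fderiv_cong_open:
  assumes "open S" "x \<in> S" "\<And>y. y \<in> S \<Longrightarrow> f y = g y"
  shows "\<D> f x = \<D> g x"
proof -
  have "(f has_derivative D) (at x) \<longleftrightarrow> (g has_derivative D) (at x)" for D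
    using has_derivative_transform_within_open[of f D x UNIV S g]
      has_derivative_transform_within_open[of g D x UNIV S f] assms by auto
  then show ?thesis by (simp add: frechet_derivative_def)
qed

lemma differentiable_cong_open:
  assumes "open S" "x \<in> S" "\<And>y. y \<in> S \<Longrightarrow> f y = g y" "f differentiable (at x)"
  shows "g differentiable (at x)"
  using has_derivative_transform_within_open[of f _ x UNIV S g] assms
  by (auto simp: differentiable_def)

section \<open>Calculus of \<open>C\<^sup>k\<close> maps\<close>

text \<open>Openness is what lets equality on \<open>S\<close> pass to the derivatives, since these
  look at a full neighbourhood of each point.\<close>

lemma Ck_on_cong:
  assumes "open S" "\<And>x. x \<in> S \<Longrightarrow> f x = g x"
  shows "Ck_on k S f \<longleftrightarrow> Ck_on k S g"
proof -
  have "Ck_on k S g" if "Ck_on k S f" "\<And>x. x \<in> S \<Longrightarrow> f x = g x" for f g :: "'a \<Rightarrow> 'b"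
    using that
  proof (induction k arbitrary: f g)
    case 0
    then show ?case by (simp cong: continuous_on_cong)
  next
    case (Suc k)
    have "g differentiable (at x)" if "x \<in> S" for x
      using differentiable_cong_open[OF \<open>open S\<close> that, of f g] Suc.prems that by auto
    moreover have "Ck_on k S (\<lambda>x. \<D> g x v)" for v
    proof (rule Suc.IH)
      show "Ck_on k S (\<lambda>x. \<D> f x v)" using Suc.prems by simp
      show "\<D> f x v = \<D> g x v" if "x \<in> S" for x
        using fderiv_cong_open[OF \<open>open S\<close> that, of f g] Suc.prems by simp
    qed
    ultimately show ?case by simp
  qed
  from this[of f g] this[of g f] show ?thesis using assms(2) by auto
qed

lemma Ck_on_subset: "Ck_on k S f \<Longrightarrow> T \<subseteq> S \<Longrightarrow> Ck_on k T f"
  by (induction k arbitrary: f) (auto intro: continuous_on_subset)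

lemma Ck_on_SucD: "Ck_on (Suc k) S f \<Longrightarrow> Ck_on k S f"
proof (induction k arbitrary: f)
  case 0
  then show ?case
    by (auto intro!: continuous_at_imp_continuous_on differentiable_imp_continuous_within)
next
  case (Suc k)
  have *: "\<forall>x\<in>S. f differentiable (at x)" "\<forall>v. Ck_on (Suc k) S (\<lambda>x. \<D> f x v)"
    using iffD1[OF Ck_on.simps(2) Suc.prems] by blast+
  show ?case unfolding Ck_on.simps(2)[of k] using * Suc.IH by blast
qed

lemma Ck_on_local:
  assumes "\<And>x. x \<in> S \<Longrightarrow> \<exists>T. open T \<and> x \<in> T \<and> Ck_on k T f"
  shows "Ck_on k S f"
  using assms
proof (induction k arbitrary: f)
  case 0
  show ?case
  proof (simp, rule continuous_at_imp_continuous_on, rule ballI)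
    fix x assume "x \<in> S"
    then show "isCont f x"
      using 0 by (metis Ck_on.simps(1) continuous_on_eq_continuous_at)
  qed
next
  case (Suc k)
  have "f differentiable (at x)" if "x \<in> S" for x using Suc.prems[OF that] by auto
  moreover have "Ck_on k S (\<lambda>x. \<D> f x v)" for v
  proof (rule Suc.IH)
    fix x assume "x \<in> S"
    from Suc.prems[OF this] show "\<exists>T. open T \<and> x \<in> T \<and> Ck_on k T (\<lambda>x. \<D> f x v)" by auto
  qed
  ultimately show ?case by simp
qed

lemma Ck_on_const: "Ck_on k S (\<lambda>x. c)"
  by (induction k arbitrary: c) auto

lemma Ck_on_bounded_linear:
  assumes "bounded_linear f"
  shows "Ck_on k S f"
proof (cases k)
  case 0
  then show ?thesis using assms by (simp add: linear_continuous_on)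
next
  case (Suc j)
  have "\<D> f x = f" for x
    by (rule fderivI) (rule bounded_linear_imp_has_derivative[OF assms])
  then show ?thesis using Suc assms
    by (auto simp: Ck_on_const intro: bounded_linear_imp_differentiable)
qed

lemma Ck_on_linear_comp:
  assumes L: "bounded_linear L" and "open S" "Ck_on k S f"
  shows "Ck_on k S (\<lambda>x. L (f x))"
  using assms(3)
proof (induction k arbitrary: f)
  case 0
  then show ?case using bounded_linear.continuous_on[OF L] by simp
next
  case (Suc k)
  have d: "((\<lambda>x. L (f x)) has_derivative (\<lambda>v. L (\<D> f x v))) (at x)" if "x \<in> S" for x
    using Suc.prems that by (auto intro!: bounded_linear.has_derivative[OF L] fderiv_works)
  have "Ck_on k S (\<lambda>x. \<D> (\<lambda>x. L (f x)) x v) \<longleftrightarrow> Ck_on k S (\<lambda>x. L (\<D> f x v))" for v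
    by (intro Ck_on_cong \<open>open S\<close>) (simp add: fderivI[OF d])
  then show ?case using d Suc by (auto simp: differentiable_def)
qed

lemma Ck_on_add:
  assumes "open S" "Ck_on k S f" "Ck_on k S g"
  shows "Ck_on k S (\<lambda>x. f x + g x)"
  using assms(2,3)
proof (induction k arbitrary: f g)
  case 0
  then show ?case by (simp add: continuous_on_add)
next
  case (Suc k)
  have d: "((\<lambda>x. f x + g x) has_derivative (\<lambda>v. \<D> f x v + \<D> g x v)) (at x)" if "x \<in> S" for x
    using Suc.prems that by (auto intro!: has_derivative_add fderiv_works)
  have "Ck_on k S (\<lambda>x. \<D> (\<lambda>x. f x + g x) x v) \<longleftrightarrow> Ck_on k S (\<lambda>x. \<D> f x v + \<D> g x v)" for v
    by (intro Ck_on_cong \<open>open S\<close>) (simp add: fderivI[OF d])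
  then show ?case using d Suc by (auto simp: differentiable_def)
qed

lemma Ck_on_sum:
  assumes "open S" "\<And>i. i \<in> I \<Longrightarrow> Ck_on k S (f i)"
  shows "Ck_on k S (\<lambda>x. \<Sum>i\<in>I. f i x)"
  using assms(2)
  by (induction I rule: infinite_finite_induct) (auto simp: Ck_on_const intro!: Ck_on_add[OF \<open>open S\<close>])

text \<open>The product rule yields two terms of the same shape, each with one factor
  differentiated. The undifferentiated factor is lowered by one order with \<open>Ck_on_SucD\<close>
  so that the induction hypothesis applies to both.\<close>

lemma Ck_on_bilinear:
  assumes B: "bounded_bilinear B" and "open S" "Ck_on k S f" "Ck_on k S g"
  shows "Ck_on k S (\<lambda>x. B (f x) (g x))"
  using assms(3,4)
proof (induction k arbitrary: f g)
  case 0
  then show ?case using bounded_bilinear.continuous_on[OF B] by simp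
next
  case (Suc k)
  have d: "((\<lambda>x. B (f x) (g x)) has_derivative (\<lambda>v. B (f x) (\<D> g x v) + B (\<D> f x v) (g x))) (at x)"
    if "x \<in> S" for x
    using Suc.prems that by (auto intro!: bounded_bilinear.FDERIV[OF B] fderiv_works)
  have "Ck_on k S (\<lambda>x. \<D> (\<lambda>x. B (f x) (g x)) x v) \<longleftrightarrow>
      Ck_on k S (\<lambda>x. B (f x) (\<D> g x v) + B (\<D> f x v) (g x))" for v
    by (intro Ck_on_cong \<open>open S\<close>) (simp add: fderivI[OF d])
  moreover have "Ck_on k S (\<lambda>x. B (f x) (\<D> g x v) + B (\<D> f x v) (g x))" for v
    using Suc.prems by (intro Ck_on_add \<open>open S\<close> Suc.IH) (auto intro: Ck_on_SucD)
  ultimately show ?case using d by (auto simp: differentiable_def)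
qed

section \<open>Finite Parseval frames\<close>

text \<open>
  Expansions in a frame replace expansions in \<open>Basis\<close>, which the class \<open>real_inner\<close> lacks.
\<close>

definition frame :: "'e::real_inner set \<Rightarrow> bool" where
  "frame B \<longleftrightarrow> finite B \<and> (\<forall>x. (\<Sum>b\<in>B. (x \<bullet> b) *\<^sub>R b) = x)"

definition fdim :: "'e::real_inner itself \<Rightarrow> bool" where
  "fdim _ \<longleftrightarrow> (\<exists>B::'e set. frame B)"

text \<open>Gram-Schmidt in frame form: each new vector contributes its normalized residual, or
  nothing when the residual vanishes.\<close>

lemma frame_of_finite:
  fixes S :: "'e::real_inner set"
  assumes "finite S"
  shows "\<exists>B. finite B \<and> B \<subseteq> span S \<and> (\<forall>x\<in>span S. (\<Sum>b\<in>B. (x \<bullet> b) *\<^sub>R b) = x)"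
  using assms
proof (induction S)
  case empty
  then show ?case by (intro exI[of _ "{}"]) auto
next
  case (insert a S)
  then obtain B where B: "finite B" "B \<subseteq> span S" "\<And>x. x \<in> span S \<Longrightarrow> (\<Sum>b\<in>B. (x \<bullet> b) *\<^sub>R b) = x"
    by blast
  \<comment> \<open>The residual of \<open>a\<close> after projection to
    \<open>span S\<close>.\<close>
  define a' where "a' = a - (\<Sum>b\<in>B. (a \<bullet> b) *\<^sub>R b)"
  have orth: "x \<bullet> a' = 0" if "x \<in> span S" for x
  proof -
    have "a \<bullet> x = a \<bullet> (\<Sum>b\<in>B. (x \<bullet> b) *\<^sub>R b)" using B(3)[OF that] by simp
    then show ?thesis
      by (simp add: a'_def inner_diff_right inner_sum_right inner_commute[of x a] mult.commute)
  qed
  have aa': "a - a' \<in> span S" unfolding a'_def using B(2)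
    by (auto intro!: span_sum span_scale)
  show ?case
  proof (cases "a' = 0")
    case True
    then have "span (insert a S) = span S" using aa' by (simp add: span_redundant)
    then show ?thesis using B by auto
  next
    case False
    define b' where "b' = a' /\<^sub>R norm a'"
    have dec: "\<exists>k s. y = k *\<^sub>R a' + s \<and> s \<in> span S" if "y \<in> span (insert a S)" for y
    proof -
      from that obtain k where k: "y - k *\<^sub>R a \<in> span S" by (auto simp: span_insert)
      have "y - k *\<^sub>R a' = (y - k *\<^sub>R a) + k *\<^sub>R (a - a')" by (simp add: scaleR_diff_right)
      also have "\<dots> \<in> span S" by (intro span_add span_scale k aa')
      finally show ?thesis by (metis add.commute diff_add_cancel)
    qed
    \<comment> \<open>Otherwise \<open>b'\<close> would be orthogonal to \<open>a'\<close>, of which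
      it is a nonzero multiple. Without this the sum over \<open>insert b' B\<close> could lose a
      term.\<close>
    have b'S: "b' \<notin> B"
    proof
      assume "b' \<in> B"
      then have "b' \<bullet> a' = 0" using B(2) orth by blast
      then show False using False by (simp add: b'_def)
    qed
    have "(\<Sum>b\<in>insert b' B. (y \<bullet> b) *\<^sub>R b) = y" if "y \<in> span (insert a S)" for y
    proof -
      from dec[OF that] obtain k s where ks: "y = k *\<^sub>R a' + s" "s \<in> span S" by blast
      have "(\<Sum>b\<in>B. (y \<bullet> b) *\<^sub>R b) = (\<Sum>b\<in>B. (s \<bullet> b) *\<^sub>R b)"
      proof (rule sum.cong[OF refl])
        fix b assume "b \<in> B"
        then have "a' \<bullet> b = 0" using orth[of b] B(2) by (auto simp: inner_commute)
        then show "(y \<bullet> b) *\<^sub>R b = (s \<bullet> b) *\<^sub>R b" by (simp add: ks inner_add_left)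
      qed
      moreover have "(y \<bullet> b') *\<^sub>R b' = k *\<^sub>R a'"
        using False orth[OF ks(2)]
        by (simp add: ks b'_def inner_add_left dot_square_norm power2_eq_square field_simps)
      ultimately show ?thesis using b'S B ks by simp
    qed
    moreover have "insert b' B \<subseteq> span (insert a S)"
    proof -
      have S: "span S \<subseteq> span (insert a S)" by (intro span_mono) auto
      then have "a' \<in> span (insert a S)"
        using aa' span_diff[of a "insert a S" "a - a'"] by (auto intro: span_base)
      then show ?thesis using S B(2) by (auto simp: b'_def intro: span_scale)
    qed
    ultimately show ?thesis using B(1) by (intro exI[of _ "insert b' B"]) auto
  qed
qed

lemma frameE: 
  assumes "fdim TYPE('e::real_inner)"
  obtains B :: "'e::real_inner set" where "finite B" "\<And>x. (\<Sum>b\<in>B. (x \<bullet> b) *\<^sub>R b) = x"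
  using assms by (auto simp: fdim_def frame_def)

text \<open>Links frames to the dimension clause of \<open>smooth_manifold\<close>; the nontrivial
  direction is Gram-Schmidt.\<close>

lemma fdim_iff: "fdim TYPE('e::real_inner) \<longleftrightarrow> (\<exists>B. finite B \<and> span B = (UNIV :: 'e set))"
proof
  assume "fdim TYPE('e)"
  then obtain B :: "'e set" where B: "finite B" "\<And>x. (\<Sum>b\<in>B. (x \<bullet> b) *\<^sub>R b) = x"
    by (rule frameE) blast
  have "x \<in> span B" for x
    by (subst B(2)[symmetric]) (intro span_sum span_scale span_base)
  then show "\<exists>B. finite B \<and> span B = (UNIV :: 'e set)" using B(1) by auto
next
  assume "\<exists>B. finite B \<and> span B = (UNIV :: 'e set)"
  then obtain S :: "'e set" where "finite S" "span S = UNIV" by blast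
  then show "fdim TYPE('e)" using frame_of_finite[of S] by (auto simp: fdim_def frame_def)
qed

lemma fdim_prod:
  assumes "fdim TYPE('e::real_inner)" "fdim TYPE('f::real_inner)"
  shows "fdim TYPE('e \<times> 'f)"
proof -
  obtain B :: "'e set" where B: "finite B" "span B = UNIV"
    using assms(1) unfolding fdim_iff by (elim exE conjE)
  obtain C :: "'f set" where C: "finite C" "span C = UNIV"
    using assms(2) unfolding fdim_iff by (elim exE conjE)
  have "span (B \<times> {0} \<union> {0} \<times> C) = UNIV"
  proof -
    have l: "linear (\<lambda>x::'e. (x, 0::'f))" "linear (\<lambda>y::'f. (0::'e, y))"
      by (auto intro!: linearI)
    have 1: "(x, 0) \<in> span (B \<times> {0} \<union> {0} \<times> C)" for x
    proof -
      have "(x, 0::'f) \<in> (\<lambda>x. (x, 0)) ` span B" using B by auto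
      also have "\<dots> = span ((\<lambda>x. (x, 0)) ` B)" by (simp only: linear_span_image[OF l(1)])
      also have "\<dots> \<subseteq> span (B \<times> {0} \<union> {0} \<times> C)" by (intro span_mono) auto
      finally show ?thesis .
    qed
    have 2: "(0, y) \<in> span (B \<times> {0} \<union> {0} \<times> C)" for y
    proof -
      have "(0::'e, y) \<in> (\<lambda>y. (0, y)) ` span C" using C by auto
      also have "\<dots> = span ((\<lambda>y. (0, y)) ` C)" by (simp only: linear_span_image[OF l(2)])
      also have "\<dots> \<subseteq> span (B \<times> {0} \<union> {0} \<times> C)" by (intro span_mono) auto
      finally show ?thesis .
    qed
    have "(x, y) \<in> span (B \<times> {0} \<union> {0} \<times> C)" for x y
      using span_add[OF 1 2, of x y] by simp
    then show ?thesis by auto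
  qed
  moreover have "finite (B \<times> {0} \<union> {0} \<times> C)" using B C by simp
  ultimately show ?thesis unfolding fdim_iff by (intro exI conjI)
qed

text \<open>Riesz representation, with the representing vector read off from the values of
  \<open>f\<close> on a frame.\<close>

lemma linear_functional_representation:
  assumes "fdim TYPE('e::real_inner)" "linear (f :: 'e \<Rightarrow> real)"
  shows "\<exists>p. \<forall>x. f x = p \<bullet> x"
proof -
  obtain B :: "'e set" where B: "finite B" "\<And>x. (\<Sum>b\<in>B. (x \<bullet> b) *\<^sub>R b) = x"
    using assms(1) by (rule frameE) blast
  have "f x = (\<Sum>b\<in>B. f b *\<^sub>R b) \<bullet> x" for x
  proof -
    have "f x = f (\<Sum>b\<in>B. (x \<bullet> b) *\<^sub>R b)" by (simp only: B(2))
    also have "\<dots> = (\<Sum>b\<in>B. (x \<bullet> b) * f b)"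
      by (simp add: linear_sum[OF assms(2)] linear_scale[OF assms(2)])
    also have "\<dots> = (\<Sum>b\<in>B. f b *\<^sub>R b) \<bullet> x"
      by (simp add: inner_sum_left inner_commute[of x] mult.commute)
    finally show ?thesis .
  qed
  then show ?thesis by blast
qed

text \<open>\<open>Ck_on\<close> speaks of derivatives in fixed directions, whereas the chain rule
  produces \<open>\<D> g (f x)\<close> in the moving direction \<open>\<D> f x v\<close>. Expanding
  that direction in a frame of the middle space leaves a finite sum of products, of a scalar
  depending on \<open>\<D> f\<close> and of \<open>\<D> g (f x) b\<close> with \<open>b\<close>
  fixed. The latter is again a composite with \<open>f\<close>, so the induction runs over
  \<open>g\<close> with \<open>f\<close> held fixed.\<close>

lemma Ck_on_compose:
  fixes f :: "'e::real_normed_vector \<Rightarrow> 'f::real_inner" and g :: "'f \<Rightarrow> 'g::real_normed_vector"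
  assumes "fdim TYPE('f)" "open S" "open T" "Ck_on k S f" "Ck_on k T g" "f ` S \<subseteq> T"
  shows "Ck_on k S (\<lambda>x. g (f x))"
  using assms(4-6)
proof (induction k arbitrary: g)
  case 0
  then show ?case using continuous_on_compose2[of T g S f] by simp
next
  case (Suc k)
  obtain B :: "'f set" where B: "finite B" "\<And>x. (\<Sum>b\<in>B. (x \<bullet> b) *\<^sub>R b) = x"
    using assms(1) by (rule frameE) blast
  have d: "((\<lambda>x. g (f x)) has_derivative (\<lambda>v. \<D> g (f x) (\<D> f x v))) (at x)" if "x \<in> S" for x
    using Suc.prems that by (intro has_derivative_compose[of f _ x UNIV g] fderiv_works) auto
  have lin: "\<D> g (f x) (\<D> f x v) = (\<Sum>b\<in>B. (\<D> f x v \<bullet> b) *\<^sub>R \<D> g (f x) b)" if "x \<in> S" for x v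
  proof -
    have l: "linear (\<D> g (f x))" using Suc.prems that by (intro linear_frechet_derivative) auto
    have "\<D> g (f x) (\<D> f x v) = \<D> g (f x) (\<Sum>b\<in>B. (\<D> f x v \<bullet> b) *\<^sub>R b)" by (simp only: B(2))
    then show ?thesis by (simp add: linear_sum[OF l] linear_scale[OF l])
  qed
  have "Ck_on k S (\<lambda>x. \<D> (\<lambda>x. g (f x)) x v) \<longleftrightarrow>
      Ck_on k S (\<lambda>x. \<Sum>b\<in>B. (\<D> f x v \<bullet> b) *\<^sub>R \<D> g (f x) b)" for v
    by (intro Ck_on_cong \<open>open S\<close>) (simp add: fderivI[OF d] lin)
  moreover have "Ck_on k S (\<lambda>x. \<Sum>b\<in>B. (\<D> f x v \<bullet> b) *\<^sub>R \<D> g (f x) b)" for v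
  proof (intro Ck_on_sum Ck_on_bilinear[OF bounded_bilinear_scaleR] \<open>open S\<close>)
    fix b
    show "Ck_on k S (\<lambda>x. \<D> f x v \<bullet> b)"
      using Suc.prems by (intro Ck_on_linear_comp[OF bounded_linear_inner_left] \<open>open S\<close>) auto
    show "Ck_on k S (\<lambda>x. \<D> g (f x) b)"
      using Suc.prems by (intro Suc.IH[of "\<lambda>y. \<D> g y b"] Ck_on_SucD[OF Suc.prems(1)]) auto
  qed
  ultimately show ?case using d by (auto simp: differentiable_def)
qed

section \<open>Smooth maps\<close>

lemma smooth_on_open: "smooth_on S f \<Longrightarrow> open S"
  by (simp add: smooth_on_def)

lemma smooth_on_Ck: "smooth_on S f \<Longrightarrow> Ck_on k S f"
  by (simp add: smooth_on_def)

lemma smooth_on_cong: "(\<And>x. x \<in> S \<Longrightarrow> f x = g x) \<Longrightarrow> smooth_on S f \<longleftrightarrow> smooth_on S g"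
  using Ck_on_cong[of S f g] by (auto simp: smooth_on_def)

lemma smooth_on_subset: "smooth_on S f \<Longrightarrow> open T \<Longrightarrow> T \<subseteq> S \<Longrightarrow> smooth_on T f"
  by (auto simp: smooth_on_def intro: Ck_on_subset)

text \<open>\<open>smooth_on\<close> includes openness of the domain, so that too is assembled from
  the local pieces.\<close>

lemma smooth_on_local:
  assumes "\<And>x. x \<in> S \<Longrightarrow> \<exists>T. x \<in> T \<and> T \<subseteq> S \<and> smooth_on T f"
  shows "smooth_on S f"
  unfolding smooth_on_def
proof (intro conjI allI)
  have *: "\<exists>T. open T \<and> x \<in> T \<and> T \<subseteq> S \<and> (\<forall>k. Ck_on k T f)" if "x \<in> S" for x
    using assms[OF that] unfolding smooth_on_def by blast
  show "open S"
  proof (subst open_subopen, rule ballI)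
    fix x assume "x \<in> S"
    from *[OF this] show "\<exists>T. open T \<and> x \<in> T \<and> T \<subseteq> S" by blast
  qed
  show "Ck_on k S f" for k
  proof (rule Ck_on_local)
    fix x assume "x \<in> S"
    from *[OF this] show "\<exists>T. open T \<and> x \<in> T \<and> Ck_on k T f" by blast
  qed
qed

lemma smooth_on_differentiable: "smooth_on S f \<Longrightarrow> x \<in> S \<Longrightarrow> f differentiable (at x)"
  using smooth_on_Ck[of S f "Suc 0"] by simp

lemma smooth_on_has_derivative: "smooth_on S f \<Longrightarrow> x \<in> S \<Longrightarrow> (f has_derivative \<D> f x) (at x)"
  by (intro fderiv_works smooth_on_differentiable)

lemma smooth_on_linear: "smooth_on S f \<Longrightarrow> x \<in> S \<Longrightarrow> linear (\<D> f x)"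
  by (intro linear_frechet_derivative smooth_on_differentiable)

lemma smooth_on_continuous: "smooth_on S f \<Longrightarrow> continuous_on S f"
  using smooth_on_Ck[of S f 0] by simp

lemma smooth_on_fderiv: "smooth_on S f \<Longrightarrow> smooth_on S (\<lambda>x. \<D> f x v)"
  using smooth_on_Ck[of S f "Suc k" for k] smooth_on_open[of S f]
    by (auto simp: smooth_on_def[of S "\<lambda>x. \<D> f x v"])

lemma smooth_on_const: "open S \<Longrightarrow> smooth_on S (\<lambda>x. c)"
  by (simp add: smooth_on_def Ck_on_const)

lemma smooth_on_bounded_linear: "open S \<Longrightarrow> bounded_linear f \<Longrightarrow> smooth_on S f"
  by (simp add: smooth_on_def Ck_on_bounded_linear)

lemma smooth_on_linear_comp: "bounded_linear L \<Longrightarrow> smooth_on S f \<Longrightarrow> smooth_on S (\<lambda>x. L (f x))"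
  by (simp add: smooth_on_def Ck_on_linear_comp)

lemma smooth_on_fst: "open S \<Longrightarrow> smooth_on S fst" and smooth_on_snd: "open S \<Longrightarrow> smooth_on S snd"
  by (simp_all add: smooth_on_bounded_linear bounded_linear_fst bounded_linear_snd)

lemma smooth_on_add: "smooth_on S f \<Longrightarrow> smooth_on S g \<Longrightarrow> smooth_on S (\<lambda>x. f x + g x)"
  by (simp add: smooth_on_def Ck_on_add)

lemma smooth_on_minus: "smooth_on S f \<Longrightarrow> smooth_on S (\<lambda>x. - f x)"
  by (rule smooth_on_linear_comp[OF bounded_linear_minus[OF bounded_linear_ident]])

lemma smooth_on_sum:
  "open S \<Longrightarrow> (\<And>i. i \<in> I \<Longrightarrow> smooth_on S (f i)) \<Longrightarrow> smooth_on S (\<lambda>x. \<Sum>i\<in>I. f i x)"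
  by (simp add: smooth_on_def Ck_on_sum)

lemma smooth_on_bilinear:
  "bounded_bilinear B \<Longrightarrow> smooth_on S f \<Longrightarrow> smooth_on S g \<Longrightarrow> smooth_on S (\<lambda>x. B (f x) (g x))"
  by (simp add: smooth_on_def Ck_on_bilinear)

lemmas smooth_on_inner = smooth_on_bilinear[OF bounded_bilinear_inner]
lemmas smooth_on_scaleR = smooth_on_bilinear[OF bounded_bilinear_scaleR]

lemma smooth_on_Pair:
  assumes "smooth_on S f" "smooth_on S g"
  shows "smooth_on S (\<lambda>x. (f x, g x))"
proof -
  have "smooth_on S (\<lambda>x. (f x, 0) + (0, g x))"
    using assms by (intro smooth_on_add bounded_linear_Pair bounded_linear_zero bounded_linear_ident
      smooth_on_linear_comp[of "\<lambda>x. (x, 0)"] smooth_on_linear_comp[of "\<lambda>x. (0, x)"])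
  then show ?thesis by simp
qed

lemma smooth_on_compose:
  fixes f :: "'e::real_normed_vector \<Rightarrow> 'f::real_inner"
  assumes "fdim TYPE('f)" "smooth_on S f" "smooth_on T g" "f ` S \<subseteq> T"
  shows "smooth_on S (\<lambda>x. g (f x))"
  using assms by (auto simp: smooth_on_def intro: Ck_on_compose)

text \<open>The frame expansion from the chain rule, now for a base point and a direction that both
  vary smoothly.\<close>

lemma smooth_on_fderiv_compose:
  fixes u :: "'d::real_normed_vector \<Rightarrow> 'e::real_inner"
  assumes "fdim TYPE('e)" "smooth_on S f" "smooth_on T u" "smooth_on T v" "u ` T \<subseteq> S"
  shows "smooth_on T (\<lambda>x. \<D> f (u x) (v x))"
proof -
  obtain B :: "'e set" where B: "finite B" "\<And>x. (\<Sum>b\<in>B. (x \<bullet> b) *\<^sub>R b) = x"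
    using assms(1) by (rule frameE) blast
  have "\<D> f (u x) (v x) = (\<Sum>b\<in>B. (v x \<bullet> b) *\<^sub>R \<D> f (u x) b)" if "x \<in> T" for x
  proof -
    have l: "linear (\<D> f (u x))" using assms that by (intro smooth_on_linear[of S]) auto
    have "\<D> f (u x) (v x) = \<D> f (u x) (\<Sum>b\<in>B. (v x \<bullet> b) *\<^sub>R b)" by (simp only: B(2))
    then show ?thesis by (simp add: linear_sum[OF l] linear_scale[OF l])
  qed
  moreover have "smooth_on T (\<lambda>x. \<Sum>b\<in>B. (v x \<bullet> b) *\<^sub>R \<D> f (u x) b)"
    using assms
    by (intro smooth_on_sum smooth_on_scaleR smooth_on_inner smooth_on_const
        smooth_on_compose[of T u S "\<lambda>x. \<D> f x _"] smooth_on_fderiv)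
      (auto simp: smooth_on_def)
  ultimately show ?thesis by (simp cong: smooth_on_cong)
qed

text \<open>For vectors that are known only through their pairings, as momenta are: the pairings
  with a frame are the coefficients of the vector itself.\<close>

lemma smooth_on_dual:
  fixes F :: "'d::real_normed_vector \<Rightarrow> 'e::real_inner \<Rightarrow> real"
  assumes "fdim TYPE('e)" "\<And>b. smooth_on S (\<lambda>x. F x b)" "\<And>x w. x \<in> S \<Longrightarrow> p x \<bullet> w = F x w"
  shows "smooth_on S p"
proof -
  obtain B :: "'e set" where B: "finite B" "\<And>x. (\<Sum>b\<in>B. (x \<bullet> b) *\<^sub>R b) = x"
    using assms(1) by (rule frameE) blast
  have "smooth_on S (\<lambda>x. \<Sum>b\<in>B. F x b *\<^sub>R b)"
    using assms(2) by (intro smooth_on_sum smooth_on_scaleR smooth_on_const) (auto simp: smooth_on_def)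
  moreover have "p x = (\<Sum>b\<in>B. F x b *\<^sub>R b)" if "x \<in> S" for x
    using B(2)[of "p x"] assms(3)[OF that] by simp
  ultimately show ?thesis by (simp cong: smooth_on_cong)
qed

section \<open>Symmetry of second derivatives\<close>

text \<open>The mean value theorem is applied once in each direction. The second difference on the
  left is symmetric in \<open>u\<close> and \<open>v\<close>, and this is what will force the mixed
  derivatives to agree.\<close>

lemma second_difference_mean_value:
  fixes f :: "'e::real_normed_vector \<Rightarrow> real"
  assumes diff: "\<And>s t. 0 \<le> s \<Longrightarrow> s \<le> h \<Longrightarrow> 0 \<le> t \<Longrightarrow> t \<le> h \<Longrightarrow> x + s *\<^sub>R u + t *\<^sub>R v \<in> S"
    and "smooth_on S f" "0 < h"
  shows "\<exists>s t. 0 < s \<and> s < h \<and> 0 < t \<and> t < h \<and>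
     f (x + h *\<^sub>R u + h *\<^sub>R v) - f (x + h *\<^sub>R u) - f (x + h *\<^sub>R v) + f x =
     h * h * \<D> (\<lambda>y. \<D> f y u) (x + s *\<^sub>R u + t *\<^sub>R v) v"
proof -
  have curve: "((\<lambda>r. g (a + r *\<^sub>R w)) has_real_derivative \<D> g (a + r *\<^sub>R w) w) (at r)"
    if "smooth_on S g" "a + r *\<^sub>R w \<in> S" for g :: "'e \<Rightarrow> real" and a w r
  proof -
    have g: "(g has_derivative \<D> g (a + r *\<^sub>R w)) (at (a + r *\<^sub>R w))"
      by (rule smooth_on_has_derivative[OF that])
    have "((\<lambda>r. a + r *\<^sub>R w) has_derivative (\<lambda>k. k *\<^sub>R w)) (at r)"
      by (auto intro!: derivative_eq_intros)
    from has_derivative_compose[OF this, of g] g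
    have "((\<lambda>r. g (a + r *\<^sub>R w)) has_derivative (\<lambda>k. \<D> g (a + r *\<^sub>R w) (k *\<^sub>R w))) (at r)" by auto
    moreover have "\<D> g (a + r *\<^sub>R w) (k *\<^sub>R w) = \<D> g (a + r *\<^sub>R w) w * k" for k
      using linear_scale[OF smooth_on_linear[OF that]] by simp
    ultimately show ?thesis by (simp add: has_field_derivative_def)
  qed
  \<comment> \<open>Increment in direction \<open>v\<close>, followed along \<open>u\<close>; the
    second difference is \<open>\<phi> h - \<phi> 0\<close>.\<close>
  define \<phi> where "\<phi> s = f ((x + h *\<^sub>R v) + s *\<^sub>R u) - f (x + s *\<^sub>R u)" for s
  have "\<exists>s>0. s < h \<and> \<phi> h - \<phi> 0 =
      (h - 0) * (\<D> f ((x + h *\<^sub>R v) + s *\<^sub>R u) u - \<D> f (x + s *\<^sub>R u) u)"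
  proof (rule MVT2[OF \<open>0 < h\<close>])
    fix s assume s: "0 \<le> s" "s \<le> h"
    then show "(\<phi> has_real_derivative \<D> f ((x + h *\<^sub>R v) + s *\<^sub>R u) u - \<D> f (x + s *\<^sub>R u) u) (at s)"
      unfolding \<phi>_def using assms diff[of s h] diff[of s 0]
      by (intro DERIV_diff curve) (auto simp: algebra_simps)
  qed
  then obtain s where s: "0 < s" "s < h"
    "\<phi> h - \<phi> 0 = h * (\<D> f ((x + h *\<^sub>R v) + s *\<^sub>R u) u - \<D> f (x + s *\<^sub>R u) u)" by auto
  \<comment> \<open>At the intermediate \<open>s\<close> just found, the remaining difference of
    \<open>u\<close>-derivatives is an increment along \<open>v\<close>.\<close>
  define \<psi> where "\<psi> t = \<D> f ((x + s *\<^sub>R u) + t *\<^sub>R v) u" for t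
  have "\<exists>t>0. t < h \<and> \<psi> h - \<psi> 0 = (h - 0) * \<D> (\<lambda>y. \<D> f y u) ((x + s *\<^sub>R u) + t *\<^sub>R v) v"
  proof (rule MVT2[OF \<open>0 < h\<close>])
    fix t assume t: "0 \<le> t" "t \<le> h"
    then show "(\<psi> has_real_derivative \<D> (\<lambda>y. \<D> f y u) ((x + s *\<^sub>R u) + t *\<^sub>R v) v) (at t)"
      unfolding \<psi>_def using s diff[of s t]
      by (intro curve smooth_on_fderiv assms) auto
  qed
  then obtain t where t: "0 < t" "t < h" "\<psi> h - \<psi> 0 = h * \<D> (\<lambda>y. \<D> f y u) ((x + s *\<^sub>R u) + t *\<^sub>R v) v"
    by auto
  have "\<D> f ((x + h *\<^sub>R v) + s *\<^sub>R u) u - \<D> f (x + s *\<^sub>R u) u = \<psi> h - \<psi> 0"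
    by (simp add: \<psi>_def algebra_simps)
  moreover have "f (x + h *\<^sub>R u + h *\<^sub>R v) - f (x + h *\<^sub>R u) - f (x + h *\<^sub>R v) + f x = \<phi> h - \<phi> 0"
    by (simp add: \<phi>_def algebra_simps)
  ultimately show ?thesis using s t by (intro exI[of _ s] exI[of _ t]) auto
qed

lemma second_difference_limit:
  fixes f :: "'e::real_normed_vector \<Rightarrow> real"
  assumes f: "smooth_on S f" and "x \<in> S" "0 < e"
  shows "\<forall>\<^sub>F h in at_right 0.
     \<bar>(f (x + h *\<^sub>R u + h *\<^sub>R v) - f (x + h *\<^sub>R u) - f (x + h *\<^sub>R v) + f x) / (h * h) - \<D> (\<lambda>y. \<D> f y u) x v\<bar> < e"
proof -
  have "continuous_on S (\<lambda>y. \<D> (\<lambda>y. \<D> f y u) y v)"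
    by (intro smooth_on_continuous smooth_on_fderiv f)
  then have "isCont (\<lambda>y. \<D> (\<lambda>y. \<D> f y u) y v) x"
    using smooth_on_open[OF f] assms(2) by (simp add: continuous_on_eq_continuous_at)
  then obtain d1 where d1: "0 < d1"
    "\<And>y. dist y x < d1 \<Longrightarrow> \<bar>\<D> (\<lambda>y. \<D> f y u) y v - \<D> (\<lambda>y. \<D> f y u) x v\<bar> < e"
    unfolding continuous_at_eps_delta using \<open>0 < e\<close> by (auto simp: dist_real_def)
  obtain d2 where d2: "0 < d2" "\<And>y. dist y x < d2 \<Longrightarrow> y \<in> S"
    using smooth_on_open[OF f] \<open>x \<in> S\<close> by (meson open_dist)
  \<comment> \<open>For steps below \<open>d\<close> the whole parallelogram stays within both
    radii, that of the continuity estimate and that of membership in \<open>S\<close>. The summand 1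
    keeps the denominator positive when \<open>u\<close> and \<open>v\<close> vanish.\<close>
  define d where "d = min d1 d2 / (norm u + norm v + 1)"
  have pos: "0 < norm u + norm v + 1" by (simp add: add_nonneg_pos)
  have d: "0 < d" using d1 d2 pos by (simp add: d_def)
  have near: "dist (x + s *\<^sub>R u + t *\<^sub>R v) x < min d1 d2" if "0 \<le> s" "s < d" "0 \<le> t" "t < d" for s t
  proof -
    have "dist (x + s *\<^sub>R u + t *\<^sub>R v) x = norm (s *\<^sub>R u + t *\<^sub>R v)" by (simp add: dist_norm)
    also have "\<dots> \<le> s * norm u + t * norm v" using norm_triangle_ineq[of "s *\<^sub>R u" "t *\<^sub>R v"] that by simp
    also have "\<dots> \<le> d * norm u + d * norm v" using that by (intro add_mono mult_right_mono) auto
    also have "\<dots> < d * (norm u + norm v + 1)" using d by (simp add: algebra_simps)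
    also have "\<dots> = min d1 d2" using pos by (simp add: d_def)
    finally show ?thesis .
  qed
  show ?thesis unfolding eventually_at_right_field
  proof (intro exI conjI allI impI, rule d)
    fix h :: real assume h: "0 < h" "h < d"
    obtain s t where st: "0 < s" "s < h" "0 < t" "t < h"
      "f (x + h *\<^sub>R u + h *\<^sub>R v) - f (x + h *\<^sub>R u) - f (x + h *\<^sub>R v) + f x =
       h * h * \<D> (\<lambda>y. \<D> f y u) (x + s *\<^sub>R u + t *\<^sub>R v) v"
      using second_difference_mean_value[of h x u v S f] near d2 h f by force
    have "dist (x + s *\<^sub>R u + t *\<^sub>R v) x < d1" using near[of s t] st h by simp
    from d1(2)[OF this] show "\<bar>(f (x + h *\<^sub>R u + h *\<^sub>R v) - f (x + h *\<^sub>R u) - f (x + h *\<^sub>R v) + f x) / (h * h)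
      - \<D> (\<lambda>y. \<D> f y u) x v\<bar> < e"
      using h by (simp add: st(5))
  qed
qed

lemma symmetric_second_derivative_real:
  fixes f :: "'e::real_normed_vector \<Rightarrow> real"
  assumes f: "smooth_on S f" and "x \<in> S"
  shows "\<D> (\<lambda>y. \<D> f y u) x v = \<D> (\<lambda>y. \<D> f y v) x u"
proof (rule ccontr)
  assume ne: "\<not> ?thesis"
  \<comment> \<open>Half the gap: one and the same quotient cannot be closer than this to both mixed
    derivatives.\<close>
  define e where "e = \<bar>\<D> (\<lambda>y. \<D> f y u) x v - \<D> (\<lambda>y. \<D> f y v) x u\<bar> / 2"
  have "0 < e" using ne by (simp add: e_def)
  have "\<forall>\<^sub>F h in at_right (0::real). False"
    using second_difference_limit[OF assms \<open>0 < e\<close>,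
      of u v] second_difference_limit[OF assms \<open>0 < e\<close>, of v u]
  proof eventually_elim
    case (elim h)
    have "x + h *\<^sub>R v + h *\<^sub>R u = x + h *\<^sub>R u + h *\<^sub>R v" by simp
    then have eq: "f (x + h *\<^sub>R v + h *\<^sub>R u) - f (x + h *\<^sub>R v) - f (x + h *\<^sub>R u) + f x =
       f (x + h *\<^sub>R u + h *\<^sub>R v) - f (x + h *\<^sub>R u) - f (x + h *\<^sub>R v) + f x" by (simp add: algebra_simps)
    have False if "\<bar>a - b\<bar> < \<bar>b - c\<bar> / 2" "\<bar>a - c\<bar> < \<bar>b - c\<bar> / 2" for a b c :: real
    proof -
      have "\<bar>b - c\<bar> \<le> \<bar>a - c\<bar> + \<bar>a - b\<bar>" using abs_triangle_ineq4[of "a - c" "a - b"] by simp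
      then show False using that by argo
    qed
    from this[OF elim(1)[unfolded e_def] elim(2)[unfolded eq e_def]] show ?case .
  qed
  then show False by simp
qed

text \<open>Pairing with a fixed \<open>w\<close> commutes with differentiation, and a vector is
  determined by its pairings, so the real-valued case suffices.\<close>

theorem symmetric_second_derivative:
  fixes f :: "'e::real_normed_vector \<Rightarrow> 'f::real_inner"
  assumes f: "smooth_on S f" and x: "x \<in> S"
  shows "\<D> (\<lambda>y. \<D> f y u) x v = \<D> (\<lambda>y. \<D> f y v) x u"
proof -
  have 1: "\<D> (\<lambda>y. g y \<bullet> w) z v = \<D> g z v \<bullet> w" if "smooth_on S g" "z \<in> S" for g :: "'e \<Rightarrow> 'f" and w z v
    by (subst fderivI[OF bounded_linear.has_derivative[OF bounded_linear_inner_left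
            smooth_on_has_derivative[OF that]]]) simp
  have 2: "\<D> (\<lambda>y. \<D> (\<lambda>y. f y \<bullet> w) y u) x v = \<D> (\<lambda>y. \<D> f y u) x v \<bullet> w" for u v w
  proof -
    have "\<D> (\<lambda>y. \<D> (\<lambda>y. f y \<bullet> w) y u) x = \<D> (\<lambda>y. \<D> f y u \<bullet> w) x"
      by (rule fderiv_cong_open[of S]) (auto simp: 1 f x smooth_on_open[OF f])
    then show ?thesis by (simp add: 1 smooth_on_fderiv f x)
  qed
  have "\<D> (\<lambda>y. \<D> f y u) x v \<bullet> w = \<D> (\<lambda>y. \<D> f y v) x u \<bullet> w" for w
    unfolding 2[symmetric]
    by (rule symmetric_second_derivative_real[OF smooth_on_linear_comp[OF bounded_linear_inner_left f] x])
  then show ?thesis by (metis inner_commute vector_eq_ldot)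
qed

section \<open>Atlases on finite-dimensional model spaces\<close>

abbreviation transition :: "('a, 'e) chart \<Rightarrow> ('a, 'f) chart \<Rightarrow> 'e \<Rightarrow> 'f" where
  "transition c d \<equiv> snd d \<circ> chart_inv c"

definition jac :: "('a, 'e::real_inner) chart \<Rightarrow> ('a, 'f::real_inner) chart \<Rightarrow> 'a \<Rightarrow> 'e \<Rightarrow> 'f" where
  "jac c d x = \<D> (transition c d) (snd c x)"

text \<open>Inverse of the component map \<open>\<lambda>v. v c\<close> on
  \<open>tangent_space M x\<close>, as \<open>covec_of\<close> is of
  \<open>covec_coord M c x\<close> on the cotangent space. The zeros elsewhere are imposed by the
  conventions that make equality of families equality of vectors.\<close>

definition tvec_of :: "('a, 'e::real_inner) atlas \<Rightarrow> ('a, 'e) chart \<Rightarrow> 'a \<Rightarrow> 'e \<Rightarrow> ('a, 'e) tvec" where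
  "tvec_of M c x w = (\<lambda>d. if d \<in> charts_at M x then jac c d x w else 0)"

definition covec_of :: "('a, 'e::real_inner) atlas \<Rightarrow> ('a, 'e) chart \<Rightarrow> 'a \<Rightarrow> 'e \<Rightarrow> ('a, 'e) covec" where
  "covec_of M c x p = (\<lambda>v. if v \<in> tangent_space M x then p \<bullet> v c else 0)"

lemma charts_at_iff: "c \<in> charts_at M x \<longleftrightarrow> c \<in> M \<and> x \<in> fst c"
  by (simp add: charts_at_def)

lemma carrier_iff: "x \<in> carrier M \<longleftrightarrow> (\<exists>c\<in>M. x \<in> fst c)"
  by (simp add: carrier_def)

text \<open>The local part of \<open>smooth_manifold\<close>. It passes to products, bundles and
  tangent fibres, so the chart calculus below can be instantiated for all of them.\<close>

locale fd_atlas =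
  fixes M :: "('a, 'e::real_inner) atlas"
  assumes atlas: "smooth_atlas M" and fdim: "fdim TYPE('e)"
begin

lemma inj_chart: "c \<in> M \<Longrightarrow> inj_on (snd c) (fst c)"
  using atlas by (simp add: smooth_atlas_def)

lemma open_chart_image: "c \<in> M \<Longrightarrow> open (snd c ` fst c)"
  using atlas by (simp add: smooth_atlas_def)

lemma chart_inv_snd [simp]: "c \<in> M \<Longrightarrow> x \<in> fst c \<Longrightarrow> chart_inv c (snd c x) = x"
  by (simp add: chart_inv_def inj_chart)

lemma chart_image_iff: "c \<in> M \<Longrightarrow> V \<subseteq> fst c \<Longrightarrow> x \<in> fst c \<Longrightarrow> snd c x \<in> snd c ` V \<longleftrightarrow> x \<in> V"
  using inj_chart[of c] by (meson inj_on_image_mem_iff)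

lemma transition_smooth:
  "c \<in> M \<Longrightarrow> d \<in> M \<Longrightarrow> smooth_on (snd c ` (fst c \<inter> fst d)) (transition c d)"
  using atlas by (simp add: smooth_atlas_def)

lemma openin_iff: "openin (mtop M) S \<longleftrightarrow> S \<subseteq> carrier M \<and> (\<forall>c\<in>M. open (snd c ` (S \<inter> fst c)))"
  by (rule openin_mtop[OF atlas])

lemma open_chart_image_of: "openin (mtop M) S \<Longrightarrow> c \<in> M \<Longrightarrow> open (snd c ` (S \<inter> fst c))"
  by (simp add: openin_iff)

text \<open>Openness in the manifold topology refers to every chart, but one chart around each point
  is enough: transitions are continuous, so the image in any other chart is locally a preimage of an
  open set, and injectivity of charts identifies that preimage.\<close>

lemma openinI:
  assumes loc: "\<And>x. x \<in> S \<Longrightarrow> \<exists>c\<in>M. \<exists>V. x \<in> V \<and> V \<subseteq> S \<inter> fst c \<and> open (snd c ` V)"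
  shows "openin (mtop M) S"
  unfolding openin_iff
proof (intro conjI ballI subsetI)
  fix x assume "x \<in> S"
  from loc[OF this] show "x \<in> carrier M" by (auto simp: carrier_iff)
next
  fix d assume d: "d \<in> M"
  show "open (snd d ` (S \<inter> fst d))"
  proof (subst open_subopen, rule ballI)
    fix y assume "y \<in> snd d ` (S \<inter> fst d)"
    then obtain x where x: "x \<in> S" "x \<in> fst d" "y = snd d x" by blast
    obtain c V where c: "c \<in> M" "x \<in> V" "V \<subseteq> S \<inter> fst c" "open (snd c ` V)"
      using loc[OF x(1)] by blast
    let ?T = "snd d ` (fst d \<inter> fst c) \<inter> transition d c -` (snd c ` V)"
    have "open ?T"
      using smooth_on_continuous[OF transition_smooth[OF d c(1)]] smooth_on_open[OF transition_smooth[OF d c(1)]] c(4)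
      by (rule continuous_open_preimage)
    moreover have "y \<in> ?T" using x c d by auto
    moreover have "?T \<subseteq> snd d ` (S \<inter> fst d)"
    proof
      fix z assume "z \<in> ?T"
      then obtain u where u: "u \<in> fst d" "u \<in> fst c" "z = snd d u" "snd c u \<in> snd c ` V"
        using d by auto
      then have "u \<in> V" using chart_image_iff[of c V u] c by blast
      then show "z \<in> snd d ` (S \<inter> fst d)" using u c by blast
    qed
    ultimately show "\<exists>T. open T \<and> y \<in> T \<and> T \<subseteq> snd d ` (S \<inter> fst d)" by blast
  qed
qed

lemma openin_subset_chartI:
  "c \<in> M \<Longrightarrow> V \<subseteq> fst c \<Longrightarrow> open (snd c ` V) \<Longrightarrow> openin (mtop M) V"
  by (rule openinI) blast

lemma openin_chart_vimage:
  assumes "c \<in> M" "open T"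
  shows "openin (mtop M) {x\<in>fst c. snd c x \<in> T}"
proof (rule openin_subset_chartI[OF assms(1)])
  have "snd c ` {x\<in>fst c. snd c x \<in> T} = snd c ` fst c \<inter> T" by auto
  then show "open (snd c ` {x\<in>fst c. snd c x \<in> T})"
    using assms open_chart_image by auto
qed auto

lemma openin_chart: "c \<in> M \<Longrightarrow> openin (mtop M) (fst c)"
  using openin_chart_vimage[of c UNIV] by simp

lemma topspace_mtop: "topspace (mtop M) = carrier M"
proof
  show "topspace (mtop M) \<subseteq> carrier M"
    using openin_iff[of "topspace (mtop M)"] by simp
  have "openin (mtop M) (\<Union>c\<in>M. fst c)" using openin_chart by blast
  then show "carrier M \<subseteq> topspace (mtop M)" unfolding carrier_def by (rule openin_subset)
qed

lemma transition_has_derivative: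
  assumes "c \<in> charts_at M x" "d \<in> charts_at M x"
  shows "(transition c d has_derivative jac c d x) (at (snd c x))"
  unfolding jac_def using assms
  by (intro smooth_on_has_derivative[OF transition_smooth]) (auto simp: charts_at_iff)

lemma jac_linear: "c \<in> charts_at M x \<Longrightarrow> d \<in> charts_at M x \<Longrightarrow> linear (jac c d x)"
  using transition_has_derivative has_derivative_linear by blast

lemma jac_refl [simp]: assumes "c \<in> charts_at M x" shows "jac c c x v = v"
proof -
  have "\<D> (transition c c) (snd c x) = \<D> (\<lambda>y. y) (snd c x)"
    using assms by (intro fderiv_cong_open[OF open_chart_image[of c]]) (auto simp: charts_at_iff)
  then show ?thesis by (simp add: jac_def)
qed

text \<open>Cocycle rule, from the chain rule for the transition maps on the overlap of
  \<open>c\<close> and \<open>d\<close>.\<close>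

lemma jac_trans:
  assumes c: "c \<in> charts_at M x" and d: "d \<in> charts_at M x" and e: "e \<in> charts_at M x"
  shows "jac d e x (jac c d x v) = jac c e x v"
proof -
  let ?S = "snd c ` (fst c \<inter> fst d)"
  have S: "open ?S" using c d smooth_on_open[OF transition_smooth[of c d]] by (simp add: charts_at_iff)
  have td: "transition c d (snd c x) = snd d x" using c by (simp add: charts_at_iff)
  have "((\<lambda>y. transition d e (transition c d y)) has_derivative (\<lambda>v. jac d e x (jac c d x v))) (at (snd c x))"
    using has_derivative_compose[OF transition_has_derivative[OF c d], of "transition d e" "jac d e x"]
      transition_has_derivative[OF d e] td by simp
  then have "\<D> (\<lambda>y. transition d e (transition c d y)) (snd c x) = (\<lambda>v. jac d e x (jac c d x v))"
    by (rule fderivI)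
  moreover have "\<D> (\<lambda>y. transition d e (transition c d y)) (snd c x) = jac c e x"
    unfolding jac_def using c d by (intro fderiv_cong_open[OF S]) (auto simp: charts_at_iff)
  ultimately show ?thesis by metis
qed

subsection \<open>Tangent and cotangent vectors in charts\<close>

lemma tangent_space_iff:
  "v \<in> tangent_space M x \<longleftrightarrow> (\<forall>c. c \<notin> charts_at M x \<longrightarrow> v c = 0) \<and>
     (\<forall>c\<in>charts_at M x. \<forall>d\<in>charts_at M x. v d = jac c d x (v c))"
  by (simp add: tangent_space_def jac_def)

lemma tangent_jac:
  "v \<in> tangent_space M x \<Longrightarrow> c \<in> charts_at M x \<Longrightarrow> d \<in> charts_at M x \<Longrightarrow> jac c d x (v c) = v d"
  unfolding tangent_space_iff by metis

lemma tangentI: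
  assumes "\<And>c. c \<notin> charts_at M x \<Longrightarrow> v c = 0"
    and "\<And>c d. c \<in> charts_at M x \<Longrightarrow> d \<in> charts_at M x \<Longrightarrow> jac c d x (v c) = v d"
  shows "v \<in> tangent_space M x"
  unfolding tangent_space_iff using assms by metis

lemma tangent_outside: "v \<in> tangent_space M x \<Longrightarrow> c \<notin> charts_at M x \<Longrightarrow> v c = 0"
  unfolding tangent_space_iff by blast

lemma tangent_eqI:
  assumes "v \<in> tangent_space M x" "w \<in> tangent_space M x" "c \<in> charts_at M x" "v c = w c"
  shows "v = w"
proof
  fix d
  show "v d = w d"
  proof (cases "d \<in> charts_at M x")
    case True
    then show ?thesis using tangent_jac[OF assms(1,3) True] tangent_jac[OF assms(2,3) True] assms(4)
      by simp
  next
    case False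
    then show ?thesis using tangent_outside assms(1,2) by metis
  qed
qed

lemma tvec_of_in: "c \<in> charts_at M x \<Longrightarrow> tvec_of M c x w \<in> tangent_space M x"
  by (rule tangentI) (simp_all add: tvec_of_def jac_trans)

lemma tvec_of_apply [simp]: "c \<in> charts_at M x \<Longrightarrow> tvec_of M c x w c = w"
  by (simp add: tvec_of_def)

lemma tvec_of_eq: "c \<in> charts_at M x \<Longrightarrow> v \<in> tangent_space M x \<Longrightarrow> tvec_of M c x (v c) = v"
  by (rule tangent_eqI[of _ x _ c]) (auto simp: tvec_of_in)

lemma tangent_bij: "c \<in> charts_at M x \<Longrightarrow> bij_betw (\<lambda>v. v c) (tangent_space M x) UNIV"
  by (rule bij_betw_byWitness[where f' = "tvec_of M c x"]) (auto simp: tvec_of_in tvec_of_eq)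

lemma tangent_add:
  assumes "v \<in> tangent_space M x" "w \<in> tangent_space M x"
  shows "(\<lambda>c. v c + w c) \<in> tangent_space M x"
  by (rule tangentI)
    (simp_all add: tangent_outside[OF assms(1)] tangent_outside[OF assms(2)] linear_add[OF jac_linear]
      tangent_jac[OF assms(1)] tangent_jac[OF assms(2)])

lemma tangent_scale:
  assumes "v \<in> tangent_space M x"
  shows "(\<lambda>c. r *\<^sub>R v c) \<in> tangent_space M x"
  by (rule tangentI)
    (simp_all add: tangent_outside[OF assms] linear_scale[OF jac_linear] tangent_jac[OF assms])

lemma tzero_in [simp]: "tzero \<in> tangent_space M x"
  by (rule tangentI) (simp_all add: tzero_def linear_0[OF jac_linear])

lemma covec_coord_unique:
  assumes "c \<in> charts_at M x" "\<And>v. v \<in> tangent_space M x \<Longrightarrow> \<alpha> v = p \<bullet> v c"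
  shows "covec_coord M c x \<alpha> = p"
  unfolding covec_coord_def
proof (rule the_equality)
  fix q assume q: "\<forall>v\<in>tangent_space M x. \<alpha> v = q \<bullet> v c"
  have "q \<bullet> w = p \<bullet> w" for w
    using q[rule_format, OF tvec_of_in[OF assms(1)]] assms(2)[OF tvec_of_in[OF assms(1)]] assms(1)
      by simp
  then show "q = p" by (metis inner_commute vector_eq_ldot)
qed (use assms in auto)

text \<open>Supplies existence for the \<open>THE\<close> in \<open>covec_coord\<close>: read in a
  chart, a covector is a linear functional on the model space and has a Riesz vector.\<close>

lemma covec_apply:
  assumes a: "\<alpha> \<in> cotangent_space M x" and c: "c \<in> charts_at M x" and v: "v \<in> tangent_space M x"
  shows "\<alpha> v = covec_coord M c x \<alpha> \<bullet> v c"
proof -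
  have "linear (\<lambda>w. \<alpha> (tvec_of M c x w))"
  proof (rule linearI)
    fix v w
    have "tvec_of M c x (v + w) = (\<lambda>d. tvec_of M c x v d + tvec_of M c x w d)"
      using linear_add[OF jac_linear[OF c]] by (auto simp: tvec_of_def)
    then show "\<alpha> (tvec_of M c x (v + w)) = \<alpha> (tvec_of M c x v) + \<alpha> (tvec_of M c x w)"
      using a tvec_of_in[OF c] by (simp add: cotangent_space_def)
  next
    fix r w
    have "tvec_of M c x (r *\<^sub>R w) = (\<lambda>d. r *\<^sub>R tvec_of M c x w d)"
      using linear_scale[OF jac_linear[OF c]] by (auto simp: tvec_of_def)
    then show "\<alpha> (tvec_of M c x (r *\<^sub>R w)) = r *\<^sub>R \<alpha> (tvec_of M c x w)"
      using a tvec_of_in[OF c] by (simp add: cotangent_space_def)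
  qed
  then obtain p where p: "\<And>w. \<alpha> (tvec_of M c x w) = p \<bullet> w"
    using linear_functional_representation[OF fdim] by blast
  have "\<alpha> v = p \<bullet> v c" if "v \<in> tangent_space M x" for v
    using p[of "v c"] tvec_of_eq[OF c that] by simp
  then show ?thesis using covec_coord_unique[OF c] v by simp
qed

lemma covec_of_in: "covec_of M c x p \<in> cotangent_space M x"
  by (auto simp: covec_of_def cotangent_space_def tangent_add tangent_scale inner_add_right)

lemma covec_coord_of [simp]: "c \<in> charts_at M x \<Longrightarrow> covec_coord M c x (covec_of M c x p) = p"
  by (rule covec_coord_unique) (auto simp: covec_of_def)

lemma covec_of_coord:
  assumes "c \<in> charts_at M x" "\<alpha> \<in> cotangent_space M x"
  shows "covec_of M c x (covec_coord M c x \<alpha>) = \<alpha>"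
proof
  fix v show "covec_of M c x (covec_coord M c x \<alpha>) v = \<alpha> v"
    using covec_apply[OF assms(2,1), of v] assms(2) by (auto simp: covec_of_def cotangent_space_def)
qed

lemma cotangent_eqI:
  "c \<in> charts_at M x \<Longrightarrow> \<alpha> \<in> cotangent_space M x \<Longrightarrow> \<beta> \<in> cotangent_space M x \<Longrightarrow>
   covec_coord M c x \<alpha> = covec_coord M c x \<beta> \<Longrightarrow> \<alpha> = \<beta>"
  by (metis covec_of_coord)

lemma cotangent_bij:
  "c \<in> charts_at M x \<Longrightarrow> bij_betw (covec_coord M c x) (cotangent_space M x) UNIV"
  by (rule bij_betw_byWitness[where f' = "covec_of M c x"]) (auto simp: covec_of_in covec_of_coord)

text \<open>Covector coordinates change by the adjoint of the opposite Jacobian. Phrasing this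
  through pairings avoids forming the adjoint.\<close>

lemma covec_coord_jac:
  assumes "\<alpha> \<in> cotangent_space M x" "c \<in> charts_at M x" "d \<in> charts_at M x"
  shows "covec_coord M d x \<alpha> \<bullet> w = covec_coord M c x \<alpha> \<bullet> jac d c x w"
  using covec_apply[OF assms(1,2) tvec_of_in[OF assms(3)], of w]
    covec_apply[OF assms(1,3) tvec_of_in[OF assms(3)], of w] assms(2,3)
  by (simp add: tvec_of_def)

end

section \<open>Smooth maps in charts\<close>

text \<open>\<open>smooth_map_on\<close> grants only some pair of charts at each point. Composing
  with transitions on both sides carries smoothness to any prescribed pair.\<close>

lemma smooth_map_chart:
  fixes M :: "('a, 'e::real_inner) atlas" and N :: "('b, 'f::real_inner) atlas"
  assumes "fd_atlas M" "fd_atlas N" and F: "smooth_map_on M N U F" and c: "c \<in> M" and d: "d \<in> N"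
  shows "smooth_on (snd c ` {x\<in>U \<inter> fst c. F x \<in> fst d}) (snd d \<circ> F \<circ> chart_inv c)"
proof (rule smooth_on_local)
  interpret M: fd_atlas M by fact
  interpret N: fd_atlas N by fact
  fix y assume "y \<in> snd c ` {x\<in>U \<inter> fst c. F x \<in> fst d}"
  then obtain x where x: "x \<in> U" "x \<in> fst c" "F x \<in> fst d" "y = snd c x" by blast
  obtain c' d' V where V: "c' \<in> M" "d' \<in> N" "openin (mtop M) V" "x \<in> V" "V \<subseteq> U \<inter> fst c'" "F ` V \<subseteq> fst d'"
    "smooth_on (snd c' ` V) (snd d' \<circ> F \<circ> chart_inv c')"
    using F x(1) unfolding smooth_map_on_def by metis
  let ?s = "snd d' \<circ> F \<circ> chart_inv c'"
  \<comment> \<open>The part of \<open>V\<close> where the prescribed charts apply as well. It is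
    open because the expression of \<open>F\<close> in the granted charts is continuous.\<close>
  define V' where "V' = {x\<in>V \<inter> fst c. F x \<in> fst d}"
  have V': "V' \<subseteq> V" "V' \<subseteq> fst c'" "V' \<subseteq> fst c" "x \<in> V'" using V x by (auto simp: V'_def)
  have "openin (mtop M) V'"
  proof (rule M.openin_subset_chartI[OF V(1) V'(2)])
    have o: "open (snd c' ` (V \<inter> fst c))"
    proof -
      have "V \<inter> fst c = V \<inter> fst c \<inter> fst c'" using V by blast
      then show ?thesis using V c M.open_chart_image_of[of "V \<inter> fst c" c'] M.openin_chart[OF c] by auto
    qed
    have "continuous_on (snd c' ` (V \<inter> fst c)) ?s"
      by (rule continuous_on_subset[OF smooth_on_continuous[OF V(7)]]) blast
    then have "open (snd c' ` (V \<inter> fst c) \<inter> ?s -` (snd d' ` (fst d' \<inter> fst d)))"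
      by (rule continuous_open_preimage[OF _ o smooth_on_open[OF N.transition_smooth[OF V(2) d]]])
    moreover have "snd c' ` V' = snd c' ` (V \<inter> fst c) \<inter> ?s -` (snd d' ` (fst d' \<inter> fst d))"
    proof (intro equalityI subsetI)
      fix z assume "z \<in> snd c' ` V'"
      then show "z \<in> snd c' ` (V \<inter> fst c) \<inter> ?s -` (snd d' ` (fst d' \<inter> fst d))"
        using V by (auto simp: V'_def subset_iff)
    next
      fix z assume "z \<in> snd c' ` (V \<inter> fst c) \<inter> ?s -` (snd d' ` (fst d' \<inter> fst d))"
      then obtain u where u: "u \<in> V" "u \<in> fst c" "z =
        snd c' u" "?s z \<in> snd d' ` (fst d' \<inter> fst d)" by blast
      have "snd d' (F u) \<in> snd d' ` (fst d' \<inter> fst d)" using u V by auto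
      then have "F u \<in> fst d"
        using N.chart_image_iff[of d' "fst d' \<inter> fst d" "F u"] V u(1) by blast
      then show "z \<in> snd c' ` V'" using u by (auto simp: V'_def)
    qed
    ultimately show "open (snd c' ` V')" by simp
  qed
  then have o: "open (snd c ` V')" using M.open_chart_image_of[OF _ c, of V'] V'
    by (simp add: Int_absorb2)
  have s1: "smooth_on (snd c ` V') (transition c c')"
    using V' by (intro smooth_on_subset[OF M.transition_smooth[OF c V(1)] o]) auto
  have s2: "smooth_on (snd c ` V') (\<lambda>z. ?s (transition c c' z))"
    using V' c by (intro smooth_on_compose[OF M.fdim s1 V(7)]) (auto simp: subset_iff)
  have s3: "smooth_on (snd c ` V') (\<lambda>z. transition d' d (?s (transition c c' z)))"
    using V' c d V by (intro smooth_on_compose[OF N.fdim s2 N.transition_smooth[OF V(2) d]])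
      (auto simp: subset_iff V'_def)
  have "smooth_on (snd c ` V') (snd d \<circ> F \<circ> chart_inv c)"
  proof (rule iffD1[OF smooth_on_cong s3])
    fix z assume "z \<in> snd c ` V'"
    then obtain u where u: "u \<in> V'" "z = snd c u" by blast
    then have "u \<in> fst c" "u \<in> fst c'" "F u \<in> fst d'" using V'(1-3) V(6) by blast+
    then show "transition d' d (?s (transition c c' z)) = (snd d \<circ> F \<circ> chart_inv c) z"
      using u c V by simp
  qed
  then show "\<exists>T. y \<in> T \<and> T \<subseteq> snd c ` {x \<in> U \<inter>
    fst c. F x \<in> fst d} \<and> smooth_on T (snd d \<circ> F \<circ> chart_inv c)"
    using V' V x by (intro exI[of _ "snd c ` V'"]) (auto simp: V'_def)
qed

text \<open>Openness of \<open>V\<close> in the manifold need not be supplied, because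
  \<open>smooth_on\<close> already says that its image in the chart is open.\<close>

lemma smooth_map_onI:
  assumes "fd_atlas M" "openin (mtop M) U"
    and "\<And>x. x \<in> U \<Longrightarrow> \<exists>c\<in>M. \<exists>d\<in>N. \<exists>V. x \<in> V \<and> V \<subseteq> U \<inter> fst c \<and> F ` V \<subseteq> fst d \<and>
        smooth_on (snd c ` V) (snd d \<circ> F \<circ> chart_inv c)"
  shows "smooth_map_on M N U F"
  unfolding smooth_map_on_def
proof (intro conjI ballI)
  interpret M: fd_atlas M by fact
  show "F ` U \<subseteq> carrier N"
  proof
    fix y assume "y \<in> F ` U"
    then obtain x where x: "x \<in> U" "y = F x" by blast
    show "y \<in> carrier N" using assms(3)[OF x(1)] x(2) unfolding carrier_iff by blast
  qed
  fix x assume "x \<in> U"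
  then obtain c d V where V: "c \<in> M" "d \<in> N" "x \<in> V" "V \<subseteq> U \<inter> fst c" "F ` V \<subseteq> fst d"
     "smooth_on (snd c ` V) (snd d \<circ> F \<circ> chart_inv c)" using assms(3) by metis
  moreover have "openin (mtop M) V"
    using M.openin_subset_chartI[of c V] smooth_on_open[OF V(6)] V by blast
  ultimately show "\<exists>c\<in>M. \<exists>d\<in>N. \<exists>V. openin (mtop M) V \<and> x \<in> V \<and> V \<subseteq> U \<inter> fst c \<and> F ` V \<subseteq> fst d \<and>
        smooth_on (snd c ` V) (snd d \<circ> F \<circ> chart_inv c)" by blast
qed (fact assms(2))

text \<open>\<open>tangent_map\<close> computes in a chart picked by \<open>SOME\<close>. The chain
  rule through the transition from that chart to \<open>c\<close> cancels the change of components
  of \<open>v\<close>.\<close>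

lemma tangent_map_eq:
  assumes "fd_atlas M" and c: "c \<in> charts_at M x" and d: "d \<in> charts_at N (F x)"
    and diff: "(snd d \<circ> F \<circ> chart_inv c) differentiable (at (snd c x))"
    and v: "v \<in> tangent_space M x"
  shows "tangent_map M N F x v d = \<D> (snd d \<circ> F \<circ> chart_inv c) (snd c x) (v c)"
proof -
  interpret M: fd_atlas M by fact
  define c' where "c' = (SOME c. c \<in> charts_at M x)"
  have c': "c' \<in> charts_at M x" unfolding c'_def by (rule someI[of _ c]) (rule c)
  have cc: "c \<in> M" "c' \<in> M" "x \<in> fst c" "x \<in> fst c'" using c c' by (auto simp: charts_at_iff)
  let ?G = "snd d \<circ> F \<circ> chart_inv c"
  let ?S = "snd c' ` (fst c' \<inter> fst c)"
  have "open ?S" using smooth_on_open[OF M.transition_smooth[of c' c]] cc by simp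
  have "((\<lambda>y. ?G (transition c' c y)) has_derivative (\<lambda>v. \<D> ?G (snd c x) (jac c' c x v))) (at (snd c' x))"
    using has_derivative_compose[OF M.transition_has_derivative[OF c' c], of ?G "\<D> ?G (snd c x)"]
      fderiv_works[OF diff] cc by simp
  then have "\<D> (\<lambda>y. ?G (transition c' c y)) (snd c' x) = (\<lambda>v. \<D> ?G (snd c x) (jac c' c x v))"
    by (rule fderivI)
  moreover have "\<D> (\<lambda>y. ?G (transition c' c y)) (snd c' x) = \<D> (snd d \<circ> F \<circ> chart_inv c') (snd c' x)"
    by (rule fderiv_cong_open[OF \<open>open ?S\<close>]) (use cc in auto)
  ultimately have "\<D> (snd d \<circ> F \<circ> chart_inv c') (snd c' x) = (\<lambda>v. \<D> ?G (snd c x) (jac c' c x v))" by simp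
  then show ?thesis
    unfolding tangent_map_def Let_def c'_def[symmetric] using d M.tangent_jac[OF v c' c] by simp
qed

lemma tangent_map_smooth:
  assumes "fd_atlas M" "fd_atlas N" and F: "smooth_map_on M N U F" and x: "x \<in> U"
    and c: "c \<in> charts_at M x" and d: "d \<in> charts_at N (F x)" and v: "v \<in> tangent_space M x"
  shows "tangent_map M N F x v d = \<D> (snd d \<circ> F \<circ> chart_inv c) (snd c x) (v c)"
proof -
  have "smooth_on (snd c ` {x\<in>U \<inter> fst c. F x \<in> fst d}) (snd d \<circ> F \<circ> chart_inv c)"
    using c d by (intro smooth_map_chart[OF assms(1,2) F]) (auto simp: charts_at_iff)
  then have "(snd d \<circ> F \<circ> chart_inv c) differentiable (at (snd c x))"
    by (rule smooth_on_differentiable) (use c d x in \<open>auto simp: charts_at_iff\<close>)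
  then show ?thesis using assms by (intro tangent_map_eq)
qed

lemma tangent_map_in:
  assumes "fd_atlas M" "fd_atlas N" and F: "smooth_map_on M N U F" and x: "x \<in> U"
    and v: "v \<in> tangent_space M x"
  shows "tangent_map M N F x v \<in> tangent_space N (F x)"
proof -
  interpret M: fd_atlas M by fact
  interpret N: fd_atlas N by fact
  have "x \<in> carrier M" using F x M.openin_iff[of U] unfolding smooth_map_on_def by blast
  then obtain c where c: "c \<in> charts_at M x" by (auto simp: carrier_iff charts_at_iff)
  note eq = tangent_map_smooth[OF assms(1,2) F x c _ v]
  show ?thesis unfolding N.tangent_space_iff
  proof (intro conjI allI impI ballI)
    show "tangent_map M N F x v d = 0" if "d \<notin> charts_at N (F x)" for d
      using that by (simp add: tangent_map_def Let_def)
    fix d e assume d: "d \<in> charts_at N (F x)" and e: "e \<in> charts_at N (F x)"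
    have c': "c \<in> M" "x \<in> fst c" and de: "d \<in> N" "F x \<in> fst d" "e \<in> N" "F x \<in> fst e"
      using c d e by (auto simp: charts_at_iff)
    let ?S = "\<lambda>d. snd c ` {x\<in>U \<inter> fst c. F x \<in> fst d}" and ?G = "\<lambda>d. snd d \<circ> F \<circ> chart_inv c"
    have G: "smooth_on (?S d) (?G d)" "smooth_on (?S e) (?G e)"
      using c' de smooth_map_chart[OF assms(1,2) F] by auto
    have "(?G d has_derivative \<D> (?G d) (snd c x)) (at (snd c x))"
      using c' de x by (intro smooth_on_has_derivative[OF G(1)]) auto
    from has_derivative_compose[OF this, of "transition d e" "jac d e (F x)"]
    have "((\<lambda>y. transition d e (?G d y)) has_derivative (\<lambda>w. jac d e (F x) (\<D> (?G d) (snd c x) w))) (at (snd c x))"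
      using N.transition_has_derivative[OF d e] c' de by simp
    then have "\<D> (\<lambda>y. transition d e (?G d y)) (snd c x) = (\<lambda>w. jac d e (F x) (\<D> (?G d) (snd c x) w))"
      by (rule fderivI)
    moreover have "\<D> (\<lambda>y. transition d e (?G d y)) (snd c x) = \<D> (?G e) (snd c x)"
    proof (rule fderiv_cong_open[of "?S d \<inter> ?S e"])
      show "open (?S d \<inter> ?S e)" using smooth_on_open[OF G(1)] smooth_on_open[OF G(2)] by (rule open_Int)
      show "snd c x \<in> ?S d \<inter> ?S e" using c' de x by blast
      fix y assume "y \<in> ?S d \<inter> ?S e"
      then have "y \<in> ?S d" by blast
      then have "F (chart_inv c y) \<in> fst d" using c' by auto
      then show "transition d e (?G d y) = ?G e y" using de by simp
    qed
    ultimately show "tangent_map M N F x v e = jac d e (F x) (tangent_map M N F x v d)"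
      using eq[OF d] eq[OF e] by metis
  qed
qed

section \<open>Products of atlases\<close>

lemma fst_prod_chart [simp]: "fst (prod_chart c d) = fst c \<times> fst d"
  and snd_prod_chart [simp]: "snd (prod_chart c d) (x, y) = (snd c x, snd d y)"
  by (simp_all add: prod_chart_def)

lemma prod_chart_image: "snd (prod_chart c d) ` (A \<times> B) = (snd c ` A) \<times> (snd d ` B)"
  by (force simp: prod_chart_def)

lemma prod_mfd_iff: "C \<in> prod_mfd M N \<longleftrightarrow> (\<exists>c\<in>M. \<exists>d\<in>N. C = prod_chart c d)"
  by (auto simp: prod_mfd_def)

lemma charts_at_prod:
  "C \<in> charts_at (prod_mfd M N) (x, y) \<longleftrightarrow>
     (\<exists>c\<in>charts_at M x. \<exists>d\<in>charts_at N y. C = prod_chart c d)"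
  unfolding charts_at_iff prod_mfd_iff Bex_def by (metis SigmaD1 SigmaD2 SigmaI fst_prod_chart)

lemma fd_atlas_prod:
  fixes M :: "('a, 'e::real_inner) atlas" and N :: "('b, 'f::real_inner) atlas"
  assumes "fd_atlas M" "fd_atlas N"
  shows "fd_atlas (prod_mfd M N)"
proof
  interpret M: fd_atlas M by fact
  interpret N: fd_atlas N by fact
  show "fdim TYPE('e \<times> 'f)" using M.fdim N.fdim by (rule fdim_prod)
  have inj: "inj_on (snd (prod_chart c d)) (fst (prod_chart c d))" if "c \<in> M" "d \<in> N" for c d
    using M.inj_chart[OF that(1)] N.inj_chart[OF that(2)] by (auto simp: inj_on_def)
  have inv: "chart_inv (prod_chart c d) (snd c x, snd d y) = (x, y)"
    if "c \<in> M" "d \<in> N" "x \<in> fst c" "y \<in> fst d" for c d x y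
    using inv_into_f_f[OF inj[OF that(1,2)], of "(x, y)"] that by (simp add: chart_inv_def)
  show "smooth_atlas (prod_mfd M N)" unfolding smooth_atlas_def
  proof (intro conjI ballI)
    fix C assume "C \<in> prod_mfd M N"
    then obtain c d where C: "C = prod_chart c d" "c \<in> M" "d \<in> N" by (auto simp: prod_mfd_iff)
    show "inj_on (snd C) (fst C)" using C inj by simp
    show "open (snd C ` fst C)"
      using C M.open_chart_image N.open_chart_image by (simp add: prod_chart_image open_Times)
    fix C' assume "C' \<in> prod_mfd M N"
    then obtain c' d' where C': "C' = prod_chart c' d'" "c' \<in> M" "d' \<in> N" by (auto simp: prod_mfd_iff)
    let ?A = "snd c ` (fst c \<inter> fst c')" and ?B = "snd d ` (fst d \<inter> fst d')"
    have im: "snd C ` (fst C \<inter> fst C') = ?A \<times> ?B"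
      using C C' by (simp add: Times_Int_Times prod_chart_image)
    have s: "smooth_on ?A (transition c c')" "smooth_on ?B (transition d d')"
      using C C' M.transition_smooth N.transition_smooth by auto
    have o: "open (?A \<times> ?B)" using smooth_on_open[OF s(1)] smooth_on_open[OF s(2)] by (rule open_Times)
    have "smooth_on (?A \<times> ?B) (\<lambda>p. (transition c c' (fst p), transition d d' (snd p)))"
      by (intro smooth_on_Pair smooth_on_compose[OF M.fdim smooth_on_fst[OF o] s(1)]
          smooth_on_compose[OF N.fdim smooth_on_snd[OF o] s(2)]) auto
    moreover have "transition C C' p = (transition c c' (fst p), transition d d' (snd p))"
      if p: "p \<in> ?A \<times> ?B" for p
    proof -
      obtain x y where xy: "x \<in> fst c" "x \<in> fst c'" "y \<in> fst d" "y \<in> fst d'" "p = (snd c x, snd d y)"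
        using p by auto
      then show ?thesis using C C' by (simp add: inv[OF C(2,3) xy(1,3)])
    qed
    ultimately show "smooth_on (snd C ` (fst C \<inter> fst C')) (transition C C')"
      unfolding im using smooth_on_cong[of "?A \<times> ?B" "transition C C'"] by simp
  qed
qed

section \<open>Vector bundles over an atlas\<close>

text \<open>Common shape of \<open>tangent_chart\<close> and \<open>cotangent_chart\<close>:
  \<open>\<kappa> c x\<close> is the fibre coordinate over \<open>x\<close> belonging to the chart
  \<open>c\<close> of the base.\<close>

definition bundle_chart ::
  "('a \<Rightarrow> 'v set) \<Rightarrow> (('a, 'e) chart \<Rightarrow> 'a \<Rightarrow> 'v \<Rightarrow> 'f) \<Rightarrow> ('a, 'e) chart \<Rightarrow> ('a \<times> 'v, 'e \<times> 'f) chart" where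
  "bundle_chart F \<kappa> c = (Sigma (fst c) F, \<lambda>(x, v). (snd c x, \<kappa> c x v))"

lemma fst_bundle_chart [simp]: "fst (bundle_chart F \<kappa> c) = Sigma (fst c) F"
  and snd_bundle_chart [simp]: "snd (bundle_chart F \<kappa> c) (x, v) = (snd c x, \<kappa> c x v)"
  by (simp_all add: bundle_chart_def)

section \<open>Countable bases of the model spaces\<close>

lemma countable_dense_fdim:
  assumes "fdim TYPE('e::real_inner)"
  shows "\<exists>D::'e set. countable D \<and> (\<forall>x. \<forall>e>0. \<exists>y\<in>D. dist x y < e)"
proof -
  obtain B :: "'e set" where B: "finite B" "\<And>x. (\<Sum>b\<in>B. (x \<bullet> b) *\<^sub>R b) = x"
    using assms by (rule frameE) blast
  \<comment> \<open>Rational combinations of a frame; extensional coefficient functions on the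
    finite set \<open>B\<close> form a countable set.\<close>
  define D where "D = (\<lambda>q. \<Sum>b\<in>B. q b *\<^sub>R b) ` (PiE B (\<lambda>_. \<rat>))"
  have "countable (PiE B (\<lambda>_. \<rat> :: real set))"
    using B(1) by (intro countable_PiE) (auto simp: countable_rat)
  then have "countable D" by (simp add: D_def)
  moreover have "\<exists>y\<in>D. dist x y < e" if "0 < e" for x and e :: real
  proof -
    \<comment> \<open>Error allowed in each coefficient. The summand 1 keeps the denominator
      positive for an empty or vanishing frame.\<close>
    define \<delta> where "\<delta> = e / (1 + (\<Sum>b\<in>B. norm b))"
    have pos: "0 < 1 + (\<Sum>b\<in>B. norm b)" by (simp add: add_pos_nonneg sum_nonneg)
    have \<delta>: "0 < \<delta>" using that pos by (simp add: \<delta>_def)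
    have "\<forall>b. \<exists>q\<in>\<rat>. x \<bullet> b < q \<and> q < x \<bullet> b + \<delta>"
      using Rats_dense_in_real \<delta> by simp
    then obtain q where q: "\<And>b. q b \<in> \<rat>" "\<And>b. x \<bullet> b < q b" "\<And>b. q b < x \<bullet> b + \<delta>" by metis
    let ?y = "\<Sum>b\<in>B. restrict q B b *\<^sub>R b"
    have "?y \<in> D" unfolding D_def using q(1) by (intro imageI) auto
    moreover have "dist x ?y < e"
    proof -
      have "x - ?y = (\<Sum>b\<in>B. (x \<bullet> b - q b) *\<^sub>R b)"
        using B(2)[of x] by (simp add: scaleR_diff_left sum_subtractf)
      then have "dist x ?y \<le> (\<Sum>b\<in>B. norm ((x \<bullet> b - q b) *\<^sub>R b))"
        by (simp only: dist_norm norm_sum)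
      also have "\<dots> \<le> (\<Sum>b\<in>B. \<delta> * norm b)"
      proof (rule sum_mono)
        fix b
        have "\<bar>x \<bullet> b - q b\<bar> \<le> \<delta>" using q(2,3)[of b] by linarith
        then show "norm ((x \<bullet> b - q b) *\<^sub>R b) \<le> \<delta> * norm b" by (simp add: mult_right_mono)
      qed
      also have "\<dots> < \<delta> * (1 + (\<Sum>b\<in>B. norm b))" using \<delta> by (simp add: algebra_simps sum_distrib_left)
      also have "\<dots> = e" using pos by (simp add: \<delta>_def)
      finally show ?thesis .
    qed
    ultimately show ?thesis by blast
  qed
  ultimately show ?thesis by blast
qed

text \<open>Balls of radius \<open>1 / (n + 1)\<close> about a countable dense set: one that
  contains \<open>x\<close> and has radius below \<open>e / 2\<close> lies inside
  \<open>ball x e\<close>.\<close>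

lemma countable_base_fdim:
  assumes "fdim TYPE('e::real_inner)"
  shows "\<exists>\<O>::'e set set. countable \<O> \<and> (\<forall>T\<in>\<O>. open T) \<and>
    (\<forall>S x. open S \<and> x \<in> S \<longrightarrow> (\<exists>T\<in>\<O>. x \<in> T \<and> T \<subseteq> S))"
proof -
  obtain D :: "'e set" where D: "countable D" "\<And>x e. 0 < e \<Longrightarrow> \<exists>y\<in>D. dist x y < e"
    using countable_dense_fdim[OF assms] by blast
  let ?O = "(\<lambda>(y, n). ball y (inverse (real (Suc n)))) ` (D \<times> UNIV)"
  have "\<exists>T\<in>?O. x \<in> T \<and> T \<subseteq> S" if S: "open S" "x \<in> S" for S x
  proof -
    obtain e where e: "0 < e" "ball x e \<subseteq> S" using S open_contains_ball by blast
    obtain n where n: "inverse (real (Suc n)) < e / 2" using reals_Archimedean[of "e / 2"] e by auto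
    obtain y where y: "y \<in> D" "dist x y < inverse (real (Suc n))"
      using D(2)[of "inverse (real (Suc n))" x] by auto
    have "ball y (inverse (real (Suc n))) \<subseteq> S"
    proof
      fix z assume "z \<in> ball y (inverse (real (Suc n)))"
      then have "dist y z < inverse (real (Suc n))" by simp
      then have "dist x z < e" using dist_triangle[of x z y] y(2) n by linarith
      then show "z \<in> S" using e by auto
    qed
    moreover have "x \<in> ball y (inverse (real (Suc n)))" using y(2) by (simp add: dist_commute)
    ultimately show ?thesis using y(1) by (intro bexI[of _ "ball y (inverse (real (Suc n)))"]) auto
  qed
  moreover have "countable ?O" using D(1) by auto
  ultimately show ?thesis by (intro exI[of _ ?O]) auto
qed

text \<open>The fibre coordinate change is asked to be smooth jointly in the base point and the
  fibre coordinate, over the whole model fibre; together with the base transition it is the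
  transition map of the total space.\<close>

locale fd_bundle = fd_atlas M for M :: "('a, 'e::real_inner) atlas" +
  fixes F :: "'a \<Rightarrow> 'v set" and \<kappa> :: "('a, 'e) chart \<Rightarrow> 'a \<Rightarrow> 'v \<Rightarrow> 'f::real_inner"
  assumes fdim_fibre: "fdim TYPE('f)"
    and fibre_bij: "c \<in> charts_at M x \<Longrightarrow> bij_betw (\<kappa> c x) (F x) UNIV"
    and fibre_transition: "c \<in> M \<Longrightarrow> d \<in> M \<Longrightarrow>
      \<exists>g. smooth_on (snd c ` (fst c \<inter> fst d) \<times> UNIV) g \<and>
          (\<forall>x\<in>fst c \<inter> fst d. \<forall>v\<in>F x. \<kappa> d x v = g (snd c x, \<kappa> c x v))"
begin

abbreviation total :: "('a \<times> 'v, 'e \<times> 'f) atlas" where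
  "total \<equiv> bundle_chart F \<kappa> ` M"

lemma bundle_chart_image:
  assumes "c \<in> M" "A \<subseteq> fst c"
  shows "snd (bundle_chart F \<kappa> c) ` Sigma A F = snd c ` A \<times> UNIV"
proof (intro equalityI subsetI)
  fix p assume "p \<in> snd c ` A \<times> (UNIV :: 'f set)"
  then obtain x w where x: "x \<in> A" "p = (snd c x, w)" by auto
  have "\<kappa> c x ` F x = UNIV" using fibre_bij[of c x] x assms by (auto simp: charts_at_iff bij_betw_def)
  then obtain v where "v \<in> F x" "w = \<kappa> c x v" by (metis UNIV_I imageE)
  then show "p \<in> snd (bundle_chart F \<kappa> c) ` Sigma A F"
    using x by (intro image_eqI[of _ _ "(x, v)"]) auto
qed auto

lemma bundle_inj: "c \<in> M \<Longrightarrow> inj_on (snd (bundle_chart F \<kappa> c)) (fst (bundle_chart F \<kappa> c))"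
proof (rule inj_onI)
  fix p q assume c: "c \<in> M" and p: "p \<in> fst (bundle_chart F \<kappa> c)" and q: "q \<in> fst (bundle_chart F \<kappa> c)"
    and eq: "snd (bundle_chart F \<kappa> c) p = snd (bundle_chart F \<kappa> c) q"
  obtain x v y w where pq: "p = (x, v)" "q = (y, w)" by fastforce
  have "x = y" using inj_onD[OF inj_chart[OF c], of x y] p q eq pq by simp
  moreover have "inj_on (\<kappa> c x) (F x)"
    using fibre_bij[of c x] c p pq by (simp add: charts_at_iff bij_betw_def)
  then have "v = w" using \<open>x = y\<close> p q eq pq by (simp add: inj_on_def)
  ultimately show "p = q" using pq by simp
qed

lemma bundle_chart_inv:
  "c \<in> M \<Longrightarrow> x \<in> fst c \<Longrightarrow> v \<in> F x \<Longrightarrow> chart_inv (bundle_chart F \<kappa> c) (snd c x, \<kappa> c x v) = (x, v)"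
  using inv_into_f_f[OF bundle_inj[of c], of "(x, v)"] by (simp add: chart_inv_def)

lemma fd_atlas_total: "fd_atlas total"
proof
  show "fdim TYPE('e \<times> 'f)" using fdim fdim_fibre by (rule fdim_prod)
  show "smooth_atlas total" unfolding smooth_atlas_def
  proof (intro conjI ballI)
    fix C assume "C \<in> total"
    then obtain c where c: "C = bundle_chart F \<kappa> c" "c \<in> M" by blast
    show "inj_on (snd C) (fst C)" using c bundle_inj by simp
    show "open (snd C ` fst C)" using c bundle_chart_image[of c "fst c"] open_chart_image
      by (simp add: open_Times)
    fix D assume "D \<in> total"
    then obtain d where d: "D = bundle_chart F \<kappa> d" "d \<in> M" by blast
    let ?A = "snd c ` (fst c \<inter> fst d)"
    have "fst C \<inter> fst D = Sigma (fst c \<inter> fst d) F" using c d by auto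
    then have im: "snd C ` (fst C \<inter> fst D) = ?A \<times> UNIV"
      using c bundle_chart_image[of c "fst c \<inter> fst d"] by simp
    obtain g where g: "smooth_on (?A \<times> UNIV) g"
      "\<And>x v. x \<in> fst c \<inter> fst d \<Longrightarrow> v \<in> F x \<Longrightarrow> \<kappa> d x v = g (snd c x, \<kappa> c x v)"
      using fibre_transition[OF c(2) d(2)] by blast
    have s: "smooth_on (?A \<times> UNIV) (\<lambda>p. (transition c d (fst p), g p))"
      by (rule smooth_on_Pair[OF smooth_on_compose[OF fdim smooth_on_fst[OF smooth_on_open[OF g(1)]]
         transition_smooth[OF c(2) d(2)]] g(1)]) auto
    have "transition C D p = (transition c d (fst p), g p)" if p: "p \<in> ?A \<times> UNIV" for p
    proof -
      have "p \<in> snd (bundle_chart F \<kappa> c) ` Sigma (fst c \<inter> fst d) F"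
        using p c bundle_chart_image[of c "fst c \<inter> fst d"] by simp
      then obtain x v where "x \<in> fst c" "x \<in> fst d" "v \<in> F x" "p = (snd c x, \<kappa> c x v)" by auto
      then show ?thesis using c d g(2) by (simp add: bundle_chart_inv)
    qed
    then show "smooth_on (snd C ` (fst C \<inter> fst D)) (transition C D)"
      unfolding im using iffD1[OF smooth_on_cong s] by simp
  qed
qed

sublocale total: fd_atlas total
  by (rule fd_atlas_total)

section \<open>Topology of the total space\<close>

lemma openin_total_Sigma:
  assumes "openin (mtop M) S"
  shows "openin (mtop total) (Sigma S F)"
proof (rule total.openinI)
  fix p assume "p \<in> Sigma S F"
  then obtain x v where x: "p = (x, v)" "x \<in> S" "v \<in> F x" by blast
  then obtain c where c: "c \<in> M" "x \<in> fst c"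
    using assms openin_iff[of S] unfolding carrier_iff subset_iff by blast
  have "snd (bundle_chart F \<kappa> c) ` Sigma (S \<inter> fst c) F = snd c ` (S \<inter> fst c) \<times> UNIV"
    by (rule bundle_chart_image) (use c in auto)
  then have "open (snd (bundle_chart F \<kappa> c) ` Sigma (S \<inter> fst c) F)"
    using open_chart_image_of[OF assms c(1)] by (simp add: open_Times)
  then show "\<exists>C\<in>total. \<exists>V. p \<in> V \<and> V \<subseteq> Sigma S F \<inter> fst C \<and> open (snd C ` V)"
    using x c by (intro bexI[of _ "bundle_chart F \<kappa> c"] exI[of _ "Sigma (S \<inter> fst c) F"]) auto
qed

text \<open>Points over different base points are separated by the preimages of separating sets of
  the base. Points of one fibre share a bundle chart and are separated in the model space.\<close>

lemma Hausdorff_total: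
  assumes "Hausdorff_space (mtop M)"
  shows "Hausdorff_space (mtop total)"
  unfolding Hausdorff_space_def
proof (intro allI impI, elim conjE)
  fix p q assume p: "p \<in> topspace (mtop total)" and q: "q \<in> topspace (mtop total)" and "p \<noteq> q"
  obtain x v y w where pq: "p = (x, v)" "q = (y, w)" by fastforce
  have in_Sigma: "z \<in> carrier M" "u \<in> F z" if "(z, u) \<in> topspace (mtop total)" for z u
    using that by (auto simp: total.topspace_mtop carrier_iff)
  have xv: "x \<in> carrier M" "v \<in> F x" "y \<in> carrier M" "w \<in> F y" using in_Sigma p q pq by auto
  show "\<exists>U V. openin (mtop total) U \<and> openin (mtop total) V \<and> p \<in> U \<and> q \<in> V \<and> disjnt U V"
  proof (cases "x = y")
    case False
    then obtain S T where ST: "openin (mtop M) S" "openin (mtop M) T" "x \<in> S" "y \<in> T" "disjnt S T"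
      using assms xv unfolding Hausdorff_space_def topspace_mtop by metis
    then show ?thesis using pq xv
      by (intro exI[of _ "Sigma S F"] exI[of _ "Sigma T F"])
        (auto simp: disjnt_def intro!: openin_total_Sigma)
  next
    case True
    obtain c where c: "c \<in> M" "x \<in> fst c" using xv(1) unfolding carrier_iff by (rule bexE)
    let ?C = "bundle_chart F \<kappa> c"
    have C: "?C \<in> total" "p \<in> fst ?C" "q \<in> fst ?C" using c xv pq True by auto
    then have "snd ?C p \<noteq> snd ?C q" using bundle_inj[OF c(1)] \<open>p \<noteq> q\<close> by (meson inj_onD)
    then obtain S T where ST: "open S" "open T" "snd ?C p \<in> S" "snd ?C q \<in> T" "S \<inter> T = {}"
      by (metis hausdorff)
    then show ?thesis
      using total.openin_chart_vimage[OF C(1) ST(1)] total.openin_chart_vimage[OF C(1) ST(2)] C(2,3)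
      by (intro exI[of _ "{z\<in>fst ?C. snd ?C z \<in> S}"] exI[of _ "{z\<in>fst ?C. snd ?C z \<in> T}"])
        (auto simp: disjnt_def)
  qed
qed

lemma second_countable_total:
  assumes "second_countable (mtop M)"
  shows "second_countable (mtop total)"
proof -
  obtain \<B> where \<B>: "countable \<B>" "\<forall>B\<in>\<B>. openin (mtop M) B"
      "\<forall>S x. openin (mtop M) S \<and> x \<in> S \<longrightarrow> (\<exists>B\<in>\<B>. x \<in> B \<and> B \<subseteq> S)"
    using assms unfolding second_countable_def by (elim exE conjE) (rule that)
  note B = \<B>(1) bspec[OF \<B>(2)] \<B>(3)[rule_format, OF conjI]
  \<comment> \<open>The atlas may be uncountable. Choosing one chart for each basic set that fits
    into some chart domain leaves a countable family \<open>K\<close> of charts that still covers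
    the base.\<close>
  define pick where "pick B = (SOME c. c \<in> M \<and> B \<subseteq> fst c)" for B
  define K where "K = pick ` {B\<in>\<B>. \<exists>c\<in>M. B \<subseteq> fst c}"
  have pick: "pick B \<in> M \<and> B \<subseteq> fst (pick B)" if "\<exists>c\<in>M. B \<subseteq> fst c" for B
    unfolding pick_def using that unfolding Bex_def by (rule someI_ex)
  have "countable K" using B(1) by (simp add: K_def)
  moreover have "K \<subseteq> M" unfolding K_def using pick by blast
  ultimately have K: "countable K" "K \<subseteq> M" .
  have cover: "\<exists>c\<in>K. x \<in> fst c" if "x \<in> carrier M" for x
  proof -
    obtain c where c: "c \<in> M" "x \<in> fst c" using \<open>x \<in> carrier M\<close> by (auto simp: carrier_iff)
    obtain B where "B \<in> \<B>" "x \<in> B" "B \<subseteq> fst c" using B(3)[OF openin_chart[OF c(1)] c(2)] by blast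
    then show ?thesis using pick[of B] c(1) unfolding K_def by blast
  qed
  obtain \<O> :: "('e \<times> 'f) set set" where \<O>: "countable \<O>" "\<forall>T\<in>\<O>. open T"
      "\<forall>S x. open S \<and> x \<in> S \<longrightarrow> (\<exists>T\<in>\<O>. x \<in> T \<and> T \<subseteq> S)"
    using countable_base_fdim[OF total.fdim] by (elim exE conjE) (rule that)
  note O = \<O>(1) bspec[OF \<O>(2)] \<O>(3)[rule_format, OF conjI]
  \<comment> \<open>Basic sets of the model space pulled back along the bundle charts over
    \<open>K\<close>.\<close>
  define nbhd where "nbhd = (\<lambda>(c, T). {z\<in>fst (bundle_chart F \<kappa> c). snd (bundle_chart F \<kappa> c) z \<in> T})"
  show ?thesis unfolding second_countable_def
  proof (intro exI[of _ "nbhd ` (K \<times> \<O>)"] conjI ballI allI impI)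
    show "countable (nbhd ` (K \<times> \<O>))" using K O by simp
    fix B assume "B \<in> nbhd ` (K \<times> \<O>)"
    then obtain c T where "c \<in> K" "T \<in> \<O>" "B = nbhd (c, T)" by blast
    then show "openin (mtop total) B"
      using K O(2) total.openin_chart_vimage[of "bundle_chart F \<kappa> c" T] unfolding nbhd_def by auto
  next
    fix S z assume S: "openin (mtop total) S \<and> z \<in> S"
    then have "z \<in> carrier total" using total.openin_iff by blast
    then obtain x v where z: "z = (x, v)" "x \<in> carrier M" "v \<in> F x" by (auto simp: carrier_iff)
    then obtain c where c: "c \<in> K" "x \<in> fst c" using cover by blast
    let ?C = "bundle_chart F \<kappa> c"
    have C: "?C \<in> total" using c K by auto
    have zC: "z \<in> fst ?C" using z c by simp
    have "open (snd ?C ` (S \<inter> fst ?C))" using total.open_chart_image_of C S by blast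
    moreover have "snd ?C z \<in> snd ?C ` (S \<inter> fst ?C)" using S zC by blast
    ultimately obtain T where T: "T \<in> \<O>" "snd ?C z \<in> T" "T \<subseteq> snd ?C ` (S \<inter> fst ?C)"
      using O(3) by meson
    have "nbhd (c, T) \<subseteq> S"
    proof
      fix u assume "u \<in> nbhd (c, T)"
      then have u: "u \<in> fst ?C" "snd ?C u \<in> snd ?C ` (S \<inter> fst ?C)" using T by (auto simp: nbhd_def)
      then show "u \<in> S" using total.chart_image_iff[OF C, of "S \<inter> fst ?C" u] by blast
    qed
    moreover have "z \<in> nbhd (c, T)" using zC T by (simp add: nbhd_def)
    ultimately show "\<exists>B\<in>nbhd ` (K \<times> \<O>). z \<in> B \<and> B \<subseteq> S" using c T by blast
  qed
qed

lemma smooth_manifold_total: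
  "smooth_manifold M \<Longrightarrow> smooth_manifold total"
  using total.atlas total.fdim Hausdorff_total second_countable_total
  by (simp add: smooth_manifold_def fdim_iff)

end

section \<open>The tangent and cotangent bundles\<close>

lemma tangent_bundle_eq: "tangent_bundle M = bundle_chart (tangent_space M) (\<lambda>c x v. v c) ` M"
  by (auto simp: tangent_bundle_def tangent_chart_def bundle_chart_def)

lemma cotangent_bundle_eq: "cotangent_bundle M = bundle_chart (cotangent_space M) (covec_coord M) ` M"
  by (auto simp: cotangent_bundle_def cotangent_chart_def bundle_chart_def)

context fd_atlas
begin

lemma fd_bundle_tangent: "fd_bundle M (tangent_space M) (\<lambda>c x v. v c)"
proof
  show "fdim TYPE('e)" by (rule fdim)
  show "bij_betw (\<lambda>v. v c) (tangent_space M x) UNIV" if "c \<in> charts_at M x" for c x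
    using that by (rule tangent_bij)
  fix c d assume c: "c \<in> M" and d: "d \<in> M"
  let ?A = "snd c ` (fst c \<inter> fst d)"
  have o: "open (?A \<times> (UNIV :: 'e set))"
    using smooth_on_open[OF transition_smooth[OF c d]] by (simp add: open_Times)
  have "smooth_on (?A \<times> UNIV) (\<lambda>p. \<D> (transition c d) (fst p) (snd p))"
    by (rule smooth_on_fderiv_compose[OF fdim transition_smooth[OF c d] smooth_on_fst[OF o] smooth_on_snd[OF o]]) auto
  moreover have "v d = \<D> (transition c d) (snd c x) (v c)"
    if "x \<in> fst c \<inter> fst d" "v \<in> tangent_space M x" for x v
    using tangent_jac[OF that(2), of c d] that(1) c d by (simp add: charts_at_iff jac_def)
  ultimately show "\<exists>g. smooth_on (?A \<times> UNIV) g \<and>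
     (\<forall>x\<in>fst c \<inter> fst d. \<forall>v\<in>tangent_space M x. v d = g (snd c x, v c))"
    by (intro exI[of _ "\<lambda>p. \<D> (transition c d) (fst p) (snd p)"]) simp
qed

lemma fd_bundle_cotangent: "fd_bundle M (cotangent_space M) (covec_coord M)"
proof
  show "fdim TYPE('e)" by (rule fdim)
  show "bij_betw (covec_coord M c x) (cotangent_space M x) UNIV" if "c \<in> charts_at M x" for c x
    using that by (rule cotangent_bij)
  fix c d assume c: "c \<in> M" and d: "d \<in> M"
  let ?A = "snd c ` (fst c \<inter> fst d)"
  have o: "open (?A \<times> (UNIV :: 'e set))"
    using smooth_on_open[OF transition_smooth[OF c d]] by (simp add: open_Times)
  \<comment> \<open>Covectors move against tangent vectors, so this is the Jacobian of the
    transition from \<open>d\<close> back to \<open>c\<close>, at the point with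
    \<open>c\<close>-coordinate \<open>fst p\<close>.\<close>
  define J where "J p w = \<D> (transition d c) (transition c d (fst p)) w" for p :: "'e \<times> 'e" and w
  have Js: "smooth_on (?A \<times> UNIV) (\<lambda>p. J p w)" for w unfolding J_def
  proof (rule smooth_on_fderiv_compose[OF fdim transition_smooth[OF d c]])
    show "smooth_on (?A \<times> (UNIV :: 'e set)) (\<lambda>p. transition c d (fst p))"
      by (rule smooth_on_compose[OF fdim smooth_on_fst[OF o] transition_smooth[OF c d]]) auto
    show "smooth_on (?A \<times> (UNIV :: 'e set)) (\<lambda>p. w)" using o by (rule smooth_on_const)
    show "(\<lambda>p. transition c d (fst p)) ` (?A \<times> (UNIV :: 'e set)) \<subseteq> snd d ` (fst d \<inter> fst c)" using c by auto
  qed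
  have Jx: "J (snd c x, p) w = jac d c x w" if "x \<in> fst c \<inter> fst d" for x p w
    using that c by (simp add: J_def jac_def)
  \<comment> \<open>The adjoint of \<open>J p\<close> applied to \<open>snd p\<close>. Riesz
    representation gives its existence, and \<open>smooth_on_dual\<close> its smooth dependence on
    \<open>p\<close>.\<close>
  define g where "g p = (SOME q. \<forall>w. q \<bullet> w = snd p \<bullet> J p w)" for p
  have g: "g p \<bullet> w = snd p \<bullet> J p w" if p: "p \<in> ?A \<times> UNIV" for p w
  proof -
    obtain x where x: "x \<in> fst c \<inter> fst d" "fst p = snd c x" using p by auto
    have "linear (\<lambda>w. snd p \<bullet> jac d c x w)"
      using jac_linear[of d x c] x c d
      by (auto simp: charts_at_iff linear_iff inner_add_right)
    then have "\<exists>q. \<forall>w. snd p \<bullet> jac d c x w = q \<bullet> w" by (rule linear_functional_representation[OF fdim])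
    moreover have "J p w = jac d c x w" for w using Jx[OF x(1), of "snd p"] x(2) by (metis prod.collapse)
    ultimately have "\<exists>q. \<forall>w. q \<bullet> w = snd p \<bullet> J p w" by metis
    then have "\<forall>w. g p \<bullet> w = snd p \<bullet> J p w" unfolding g_def by (rule someI_ex)
    then show ?thesis by blast
  qed
  have "smooth_on (?A \<times> UNIV) g"
    by (rule smooth_on_dual[OF fdim smooth_on_inner[OF smooth_on_snd[OF o] Js] g])
  moreover have "covec_coord M d x \<alpha> = g (snd c x, covec_coord M c x \<alpha>)"
    if x: "x \<in> fst c \<inter> fst d" and a: "\<alpha> \<in> cotangent_space M x" for x \<alpha>
  proof -
    have "covec_coord M d x \<alpha> \<bullet> w = g (snd c x, covec_coord M c x \<alpha>) \<bullet> w" for w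
      using covec_coord_jac[OF a, of c d w] g[of "(snd c x, covec_coord M c x \<alpha>)" w] x c d Jx[OF x]
      by (simp add: charts_at_iff)
    then show ?thesis by (metis inner_commute vector_eq_ldot)
  qed
  ultimately show "\<exists>g. smooth_on (?A \<times> UNIV) g \<and>
     (\<forall>x\<in>fst c \<inter> fst d. \<forall>v\<in>cotangent_space M x. covec_coord M d x v = g (snd c x, covec_coord M c x v))"
    by blast
qed

lemma fd_atlas_tangent: "fd_atlas (tangent_bundle M)"
  unfolding tangent_bundle_eq by (rule fd_bundle.fd_atlas_total[OF fd_bundle_tangent])

lemma fd_atlas_cotangent: "fd_atlas (cotangent_bundle M)"
  unfolding cotangent_bundle_eq by (rule fd_bundle.fd_atlas_total[OF fd_bundle_cotangent])

lemma smooth_manifold_cotangent: "smooth_manifold M \<Longrightarrow> smooth_manifold (cotangent_bundle M)"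
  unfolding cotangent_bundle_eq by (rule fd_bundle.smooth_manifold_total[OF fd_bundle_cotangent])

end

lemma smooth_manifold_fd_atlas: "smooth_manifold M \<Longrightarrow> fd_atlas M"
  by unfold_locales (auto simp: smooth_manifold_def fdim_iff)

lemma tangent_chart_bundle: "tangent_chart M c = bundle_chart (tangent_space M) (\<lambda>c x v. v c) c"
  by (simp add: tangent_chart_def bundle_chart_def)

lemma cotangent_chart_bundle: "cotangent_chart M c = bundle_chart (cotangent_space M) (covec_coord M) c"
  by (simp add: cotangent_chart_def bundle_chart_def)

lemma fst_tangent_chart [simp]: "fst (tangent_chart M c) = Sigma (fst c) (tangent_space M)"
  and snd_tangent_chart [simp]: "snd (tangent_chart M c) (x, v) = (snd c x, v c)"
  and fst_cotangent_chart [simp]: "fst (cotangent_chart M c) = Sigma (fst c) (cotangent_space M)"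
  and snd_cotangent_chart [simp]: "snd (cotangent_chart M c) (x, \<alpha>) = (snd c x, covec_coord M c x \<alpha>)"
  by (simp_all add: tangent_chart_bundle cotangent_chart_bundle)

lemma charts_at_tangent:
  "C \<in> charts_at (tangent_bundle M) (x, v) \<longleftrightarrow>
     v \<in> tangent_space M x \<and> (\<exists>c\<in>charts_at M x. C = tangent_chart M c)"
  unfolding charts_at_iff tangent_bundle_def image_iff Bex_def
  by (metis SigmaD1 SigmaD2 SigmaI fst_tangent_chart)

lemma charts_at_cotangent:
  "C \<in> charts_at (cotangent_bundle M) (x, \<alpha>) \<longleftrightarrow>
     \<alpha> \<in> cotangent_space M x \<and> (\<exists>c\<in>charts_at M x. C = cotangent_chart M c)"
  unfolding charts_at_iff cotangent_bundle_def image_iff Bex_def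
  by (metis SigmaD1 SigmaD2 SigmaI fst_cotangent_chart)

lemma carrier_tangent: "carrier (tangent_bundle M) = Sigma (carrier M) (tangent_space M)"
  unfolding carrier_def tangent_bundle_def by auto

lemma carrier_cotangent: "carrier (cotangent_bundle M) = Sigma (carrier M) (cotangent_space M)"
  unfolding carrier_def cotangent_bundle_def by auto

section \<open>Derivatives of the transition maps of the bundles\<close>

text \<open>Second derivative of the transition map: \<open>w\<close> is the direction of the first
  differentiation and \<open>a\<close> that of the second. The slots are kept apart until
  \<open>hess_sym\<close>, because the two bundles fill them in opposite orders.\<close>

definition hess :: "('a, 'e::real_inner) chart \<Rightarrow> ('a, 'f::real_inner) chart \<Rightarrow> 'a \<Rightarrow> 'e \<Rightarrow> 'e \<Rightarrow> 'f" where
  "hess c d x w a = \<D> (\<lambda>y. \<D> (transition c d) y w) (snd c x) a"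

lemma fderiv_partials:
  assumes g: "g differentiable (at (y, w))"
  shows "\<D> (\<lambda>y. g (y, w)) y a = \<D> g (y, w) (a, 0)"
    and "\<D> (\<lambda>w. g (y, w)) w b = \<D> g (y, w) (0, b)"
proof -
  have "((\<lambda>y. (y, w)) has_derivative (\<lambda>a. (a, 0))) (at y)"
    and "((\<lambda>w. (y, w)) has_derivative (\<lambda>b. (0, b))) (at w)"
    by (auto intro!: derivative_eq_intros)
  note this[THEN has_derivative_compose, OF fderiv_works[OF g]]
  then show "\<D> (\<lambda>y. g (y, w)) y a = \<D> g (y, w) (a, 0)" "\<D> (\<lambda>w. g (y, w)) w b = \<D> g (y, w) (0, b)"
    using fderivI by metis+
qed

text \<open>Joint smoothness makes the total derivative the sum of its two partials, and in the
  fibre variable the map is linear, hence its own derivative.\<close>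

lemma has_derivative_fderiv_apply:
  fixes f :: "'e::real_inner \<Rightarrow> 'f::real_normed_vector"
  assumes "fdim TYPE('e)" and f: "smooth_on S f" and y: "y \<in> S"
  shows "((\<lambda>p. \<D> f (fst p) (snd p)) has_derivative
     (\<lambda>p. \<D> (\<lambda>y. \<D> f y w) y (fst p) + \<D> f y (snd p))) (at (y, w))"
proof -
  let ?G = "\<lambda>p. \<D> f (fst p) (snd p)"
  have o: "open (S \<times> (UNIV :: 'e set))" using smooth_on_open[OF f] by (simp add: open_Times)
  have "smooth_on (S \<times> UNIV) ?G"
    by (rule smooth_on_fderiv_compose[OF assms(1) f smooth_on_fst[OF o] smooth_on_snd[OF o]]) auto
  then have G: "?G differentiable (at (y, w))" by (rule smooth_on_differentiable) (use y in auto)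
  have l: "linear (\<D> ?G (y, w))" by (rule linear_frechet_derivative[OF G])
  have "bounded_linear (\<D> f y)" using smooth_on_has_derivative[OF f y]
    by (rule has_derivative_bounded_linear)
  then have "\<D> (\<D> f y) w = \<D> f y" by (intro fderivI bounded_linear_imp_has_derivative)
  then have "\<D> ?G (y, w) p = \<D> (\<lambda>y. \<D> f y w) y (fst p) + \<D> f y (snd p)" for p
    using fderiv_partials[OF G] linear_add[OF l, of "(fst p, 0)" "(0, snd p)"] by simp
  then have "\<D> ?G (y, w) = (\<lambda>p. \<D> (\<lambda>y. \<D> f y w) y (fst p) + \<D> f y (snd p))" by (rule ext)
  then show ?thesis using fderiv_works[OF G] by simp
qed

context fd_atlas
begin

interpretation TM: fd_atlas "tangent_bundle M" by (rule fd_atlas_tangent)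
interpretation CM: fd_atlas "cotangent_bundle M" by (rule fd_atlas_cotangent)

lemma hess_sym: "c \<in> charts_at M x \<Longrightarrow> d \<in> charts_at M x \<Longrightarrow> hess c d x w a = hess c d x a w"
  unfolding hess_def by (rule symmetric_second_derivative[OF transition_smooth]) (auto simp: charts_at_iff)

lemma tangent_chart_inv:
  assumes "c \<in> charts_at M x"
  shows "chart_inv (tangent_chart M c) (snd c x, w) = (x, tvec_of M c x w)"
  using TM.chart_inv_snd[of "tangent_chart M c" "(x, tvec_of M c x w)"] assms tvec_of_in[OF assms, of w]
  by (auto simp: tangent_bundle_def charts_at_iff)

lemma cotangent_chart_inv:
  assumes "c \<in> charts_at M x"
  shows "chart_inv (cotangent_chart M c) (snd c x, p) = (x, covec_of M c x p)"
  using CM.chart_inv_snd[of "cotangent_chart M c" "(x, covec_of M c x p)"] assms covec_of_in[of c x p]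
  by (auto simp: cotangent_bundle_def charts_at_iff)

text \<open>In charts the transition of the tangent bundle is the base transition paired with its
  derivative, so differentiating once more brings in the second derivative.\<close>

lemma jac_tangent:
  assumes c: "c \<in> charts_at M x" and d: "d \<in> charts_at M x" and v: "v \<in> tangent_space M x"
  shows "jac (tangent_chart M c) (tangent_chart M d) (x, v) (a, b) =
    (jac c d x a, hess c d x (v c) a + jac c d x b)"
proof -
  let ?\<tau> = "transition c d" and ?A = "snd c ` (fst c \<inter> fst d)"
  have cd: "c \<in> M" "d \<in> M" "x \<in> fst c" "x \<in> fst d" using c d by (auto simp: charts_at_iff)
  note sm = transition_smooth[OF cd(1,2)]
  have xA: "snd c x \<in> ?A" using cd by blast
  have eq: "(?\<tau> (fst p), \<D> ?\<tau> (fst p) (snd p)) = transition (tangent_chart M c) (tangent_chart M d) p"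
    if p: "p \<in> ?A \<times> UNIV" for p
  proof -
    obtain x' where x': "x' \<in> fst c" "x' \<in> fst d" "fst p = snd c x'" using p by auto
    then have cx': "c \<in> charts_at M x'" "d \<in> charts_at M x'" using cd by (auto simp: charts_at_iff)
    have "p = (snd c x', snd p)" using x' by (simp add: prod_eq_iff)
    then have "transition (tangent_chart M c) (tangent_chart M d) p =
        snd (tangent_chart M d) (chart_inv (tangent_chart M c) (snd c x', snd p))"
      by (metis comp_apply)
    also have "\<dots> = (snd d x', jac c d x' (snd p))"
      using cx' by (simp add: tangent_chart_inv tvec_of_def)
    finally show ?thesis using x' cd by (simp add: jac_def)
  qed
  have "((\<lambda>p. ?\<tau> (fst p)) has_derivative (\<lambda>p. \<D> ?\<tau> (snd c x) (fst p))) (at (snd c x, v c))"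
    using has_derivative_compose[OF has_derivative_fst[OF has_derivative_ident],
        of ?\<tau> "\<D> ?\<tau> (snd c x)" "(snd c x, v c)" UNIV] smooth_on_has_derivative[OF sm xA] by simp
  from has_derivative_Pair[OF this has_derivative_fderiv_apply[OF fdim sm xA]]
  have "\<D> (\<lambda>p. (?\<tau> (fst p), \<D> ?\<tau> (fst p) (snd p))) (snd c x, v c) (a, b) =
     (jac c d x a, hess c d x (v c) a + jac c d x b)"
    by (simp add: fderivI jac_def hess_def)
  moreover have "\<D> (\<lambda>p. (?\<tau> (fst p), \<D> ?\<tau> (fst p) (snd p))) (snd c x, v c) =
     \<D> (transition (tangent_chart M c) (tangent_chart M d)) (snd c x, v c)"
    by (rule fderiv_cong_open[of "?A \<times> UNIV"])
      (use smooth_on_open[OF sm] xA eq in \<open>auto simp: open_Times\<close>)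
  ultimately show ?thesis by (simp add: jac_def[of "tangent_chart M c"])
qed

text \<open>The new momentum is known only through its pairing with \<open>w\<close>, so that
  pairing is differentiated. It contains the derivative of the opposite transition at the moved base
  point; hence \<open>hess d c\<close>, with \<open>jac c d x a\<close> from the chain rule in its
  second slot.\<close>

lemma jac_cotangent:
  assumes c: "c \<in> charts_at M x" and d: "d \<in> charts_at M x" and \<alpha>: "\<alpha> \<in> cotangent_space M x"
  shows "fst (jac (cotangent_chart M c) (cotangent_chart M d) (x, \<alpha>) (a, b)) = jac c d x a"
    and "snd (jac (cotangent_chart M c) (cotangent_chart M d) (x, \<alpha>) (a, b)) \<bullet> w =
      b \<bullet> jac d c x w + covec_coord M c x \<alpha> \<bullet> hess d c x w (jac c d x a)"
proof -
  let ?\<tau> = "transition c d" and ?\<sigma> = "transition d c" and ?A = "snd c ` (fst c \<inter> fst d)"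
  let ?T = "transition (cotangent_chart M c) (cotangent_chart M d)"
  let ?J = "jac (cotangent_chart M c) (cotangent_chart M d) (x, \<alpha>)"
  let ?t = "(snd c x, covec_coord M c x \<alpha>)"
  have cd: "c \<in> M" "d \<in> M" "x \<in> fst c" "x \<in> fst d" using c d by (auto simp: charts_at_iff)
  note sm = transition_smooth[OF cd(1,2)] and sm' = transition_smooth[OF cd(2,1)]
  have xA: "snd c x \<in> ?A" and xB: "snd d x \<in> snd d ` (fst d \<inter> fst c)" using cd by blast+
  have o: "open (?A \<times> (UNIV::'e set))" using smooth_on_open[OF sm] by (simp add: open_Times)
  have tA: "?t \<in> ?A \<times> UNIV" using xA by simp
  have T: "(?T has_derivative ?J) (at ?t)"
    using CM.transition_has_derivative[of "cotangent_chart M c" "(x, \<alpha>)" "cotangent_chart M d"] c d \<alpha>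
    by (auto simp: charts_at_cotangent)
  have eq: "fst (?T p) = ?\<tau> (fst p)" "snd (?T p) \<bullet> w = snd p \<bullet> \<D> ?\<sigma> (?\<tau> (fst p)) w"
    if p: "p \<in> ?A \<times> UNIV" for p
  proof -
    obtain x' where x': "x' \<in> fst c" "x' \<in> fst d" "fst p = snd c x'" using p by auto
    then have cx': "c \<in> charts_at M x'" "d \<in> charts_at M x'" using cd by (auto simp: charts_at_iff)
    have "p = (snd c x', snd p)" using x' by (simp add: prod_eq_iff)
    then have "?T p = snd (cotangent_chart M d) (chart_inv (cotangent_chart M c) (snd c x', snd p))"
      by (metis comp_apply)
    also have "\<dots> = (snd d x', covec_coord M d x' (covec_of M c x' (snd p)))"
      using cx' by (simp add: cotangent_chart_inv)
    finally have T: "?T p = \<dots>" .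
    show "fst (?T p) = ?\<tau> (fst p)" unfolding T using x' cd by simp
    show "snd (?T p) \<bullet> w = snd p \<bullet> \<D> ?\<sigma> (?\<tau> (fst p)) w" unfolding T
      using x' cd covec_coord_jac[OF covec_of_in cx', of c "snd p" w] cx' by (simp add: jac_def)
  qed
  have \<tau>: "((\<lambda>p. ?\<tau> (fst p)) has_derivative (\<lambda>p. jac c d x (fst p))) (at ?t)"
    using has_derivative_compose[OF has_derivative_fst[OF has_derivative_ident],
        of ?\<tau> "jac c d x" ?t UNIV] transition_has_derivative[OF c d] by simp
  have "\<D> (\<lambda>p. fst (?T p)) ?t = \<D> (\<lambda>p. ?\<tau> (fst p)) ?t"
    by (rule fderiv_cong_open[OF o tA eq(1)])
  then show "fst (?J (a, b)) = jac c d x a"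
    unfolding fderivI[OF has_derivative_fst[OF T]] fderivI[OF \<tau>] by (metis fst_conv)
  have "((\<lambda>y. \<D> ?\<sigma> y w) has_derivative hess d c x w) (at (?\<tau> (fst ?t)))"
    unfolding hess_def using smooth_on_has_derivative[OF smooth_on_fderiv[OF sm'] xB, of w] cd by simp
  from has_derivative_compose[OF \<tau> this]
  have "((\<lambda>p. \<D> ?\<sigma> (?\<tau> (fst p)) w) has_derivative (\<lambda>p. hess d c x w (jac c d x (fst p)))) (at ?t)" .
  from has_derivative_inner[OF has_derivative_snd[OF has_derivative_ident] this]
  have r: "((\<lambda>p. snd p \<bullet> \<D> ?\<sigma> (?\<tau> (fst p)) w) has_derivative
     (\<lambda>p. covec_coord M c x \<alpha> \<bullet> hess d c x w (jac c d x (fst p)) + snd p \<bullet> jac d c x w)) (at ?t)"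
    using cd by (simp add: jac_def[of d c])
  have l: "((\<lambda>p. snd (?T p) \<bullet> w) has_derivative (\<lambda>p. snd (?J p) \<bullet> w)) (at ?t)"
    using has_derivative_inner_left[OF has_derivative_snd[OF T]] by simp
  have "\<D> (\<lambda>p. snd (?T p) \<bullet> w) ?t = \<D> (\<lambda>p. snd p \<bullet> \<D> ?\<sigma> (?\<tau> (fst p)) w) ?t"
    by (rule fderiv_cong_open[OF o tA eq(2)])
  then have "(\<lambda>p. snd (?J p) \<bullet> w) =
     (\<lambda>p. covec_coord M c x \<alpha> \<bullet> hess d c x w (jac c d x (fst p)) + snd p \<bullet> jac d c x w)"
    unfolding fderivI[OF l] fderivI[OF r] .
  from fun_cong[OF this, of "(a, b)"]
  show "snd (?J (a, b)) \<bullet> w = b \<bullet> jac d c x w + covec_coord M c x \<alpha> \<bullet> hess d c x w (jac c d x a)"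
    by simp
qed

section \<open>The Tulczyjew isomorphism in charts\<close>

text \<open>
  The fibre coordinates of \<open>TT\<^sup>*Q\<close> and \<open>T\<^sup>*TQ\<close> transform with the second derivatives of the
  transition maps in swapped arguments, so that their symmetry makes the coordinate swap
  independent of the chart.
\<close>

lemma tulczyjew_eq:
  assumes c: "c \<in> charts_at M x" and \<alpha>: "\<alpha> \<in> cotangent_space M x"
    and \<zeta>: "\<zeta> \<in> tangent_space (cotangent_bundle M) (x, \<alpha>)"
  defines "v \<equiv> tvec_of M c x (fst (\<zeta> (cotangent_chart M c)))"
  shows "tulczyjew M ((x, \<alpha>), \<zeta>) = ((x, v),
    covec_of (tangent_bundle M) (tangent_chart M c) (x, v)
      (snd (\<zeta> (cotangent_chart M c)), covec_coord M c x \<alpha>))"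
    (is "_ = ((x, v), ?\<beta>)")
proof -
  let ?z = "((x, \<alpha>), \<zeta>)"
  have v: "v \<in> tangent_space M x" unfolding v_def by (rule tvec_of_in[OF c])
  have vc: "v c = fst (\<zeta> (cotangent_chart M c))" unfolding v_def using c by simp
  have \<beta>: "?\<beta> \<in> cotangent_space (tangent_bundle M) (x, v)" by (rule TM.covec_of_in)
  have Tc: "tangent_chart M d \<in> charts_at (tangent_bundle M) (x, v)" if "d \<in> charts_at M x" for d
    using that v by (auto simp: charts_at_tangent)
  have Cc: "cotangent_chart M d \<in> charts_at (cotangent_bundle M) (x, \<alpha>)" if "d \<in> charts_at M x" for d
    using that \<alpha> by (auto simp: charts_at_cotangent)
  have coords: "v d = fst (\<zeta> (cotangent_chart M d))"
    "covec_coord (tangent_bundle M) (tangent_chart M d) (x, v) ?\<beta> =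
       (snd (\<zeta> (cotangent_chart M d)), covec_coord M d x \<alpha>)" if d: "d \<in> charts_at M x" for d
  proof -
    let ?p = "covec_coord M c x \<alpha>" and ?q' = "fst (\<zeta> (cotangent_chart M c))"
      and ?p' = "snd (\<zeta> (cotangent_chart M c))"
    have J: "\<zeta> (cotangent_chart M d) = jac (cotangent_chart M c) (cotangent_chart M d) (x, \<alpha>) (?q', ?p')"
      using CM.tangent_jac[OF \<zeta> Cc[OF c] Cc[OF d]] by simp
    show vd: "v d = fst (\<zeta> (cotangent_chart M d))"
      unfolding J jac_cotangent[OF c d \<alpha>] using tangent_jac[OF v c d] vc by simp
    have vd': "v d = jac c d x ?q'" using tangent_jac[OF v c d] vc by simp
    have "covec_coord (tangent_bundle M) (tangent_chart M d) (x, v) ?\<beta> \<bullet> w =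
       (snd (\<zeta> (cotangent_chart M d)), covec_coord M d x \<alpha>) \<bullet> w" for w
    proof -
      obtain a b where w: "w = (a, b)" by fastforce
      have "covec_coord (tangent_bundle M) (tangent_chart M d) (x, v) ?\<beta> \<bullet> w =
        (?p', ?p) \<bullet> jac (tangent_chart M d) (tangent_chart M c) (x, v) w"
        using TM.covec_coord_jac[OF \<beta> Tc[OF c] Tc[OF d], of w] Tc[OF c] by simp
      also have "\<dots> = ?p' \<bullet> jac d c x a + ?p \<bullet> hess d c x (v d) a + ?p \<bullet> jac d c x b"
        unfolding w jac_tangent[OF d c v] by (simp add: inner_add_right)
      \<comment> \<open>\<open>jac_tangent\<close> and \<open>jac_cotangent\<close> place the
        velocity in opposite slots; here they are reconciled.\<close>
      also have "hess d c x (v d) a = hess d c x a (jac c d x ?q')"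
        unfolding vd' by (rule hess_sym[OF d c])
      also have "?p' \<bullet> jac d c x a + ?p \<bullet> hess d c x a (jac c d x ?q') =
        snd (\<zeta> (cotangent_chart M d)) \<bullet> a"
        unfolding J jac_cotangent[OF c d \<alpha>] by simp
      also have "?p \<bullet> jac d c x b = covec_coord M d x \<alpha> \<bullet> b"
        using covec_coord_jac[OF \<alpha> c d] by simp
      finally show ?thesis by (simp add: w)
    qed
    then show "covec_coord (tangent_bundle M) (tangent_chart M d) (x, v) ?\<beta> =
       (snd (\<zeta> (cotangent_chart M d)), covec_coord M d x \<alpha>)"
      by (metis inner_commute vector_eq_ldot)
  qed
  have cM: "c \<in> M" "x \<in> fst c" using c by (auto simp: charts_at_iff)
  show ?thesis unfolding tulczyjew_def Let_def
  proof (rule the_equality, intro conjI ballI impI)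
    show "((x, v), ?\<beta>) \<in> carrier (cotangent_bundle (tangent_bundle M))"
      using \<beta> v cM by (auto simp: carrier_cotangent carrier_tangent carrier_iff)
    fix d assume d: "d \<in> M" "?z \<in> fst (tangent_chart (cotangent_bundle M) (cotangent_chart M d))"
    then have dx: "d \<in> charts_at M x" by (simp add: charts_at_iff)
    then show "((x, v), ?\<beta>) \<in> fst (cotangent_chart (tangent_bundle M) (tangent_chart M d))"
      using v \<beta> by (simp add: charts_at_iff)
    show "case snd (tangent_chart (cotangent_bundle M) (cotangent_chart M d)) ?z of
      ((q, p), q', p') \<Rightarrow> snd (cotangent_chart (tangent_bundle M) (tangent_chart M d)) ((x, v), ?\<beta>) =
         ((q, q'), p', p)"
      using coords[OF dx] by (simp add: case_prod_unfold)
  next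
    fix u assume u: "u \<in> carrier (cotangent_bundle (tangent_bundle M)) \<and>
      (\<forall>d\<in>M. ?z \<in> fst (tangent_chart (cotangent_bundle M) (cotangent_chart M d)) \<longrightarrow>
        u \<in> fst (cotangent_chart (tangent_bundle M) (tangent_chart M d)) \<and>
        (case snd (tangent_chart (cotangent_bundle M) (cotangent_chart M d)) ?z of
          ((q, p), q', p') \<Rightarrow> snd (cotangent_chart (tangent_bundle M) (tangent_chart M d)) u =
            ((q, q'), p', p)))"
    have z: "?z \<in> fst (tangent_chart (cotangent_bundle M) (cotangent_chart M c))"
      using cM \<alpha> \<zeta> by simp
    obtain x' v' \<beta>' where u': "u = ((x', v'), \<beta>')" by (metis surj_pair)
    from u[THEN conjunct2, rule_format, OF cM(1) z] u' vc
    have *: "x' \<in> fst c" "v' \<in> tangent_space M x'" "\<beta>' \<in> cotangent_space (tangent_bundle M) (x', v')"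
      "snd c x' = snd c x" "v' c = v c"
      "covec_coord (tangent_bundle M) (tangent_chart M c) (x', v') \<beta>' =
       (snd (\<zeta> (cotangent_chart M c)), covec_coord M c x \<alpha>)"
      by (auto simp: case_prod_unfold)
    \<comment> \<open>The chart \<open>c\<close> alone pins down a candidate: its base point by
      injectivity, then its tangent vector by one component, then its covector by the
      coordinates.\<close>
    have x: "x' = x" using inj_onD[OF inj_chart[OF cM(1)] *(4) *(1) cM(2)] .
    have v': "v' = v" using *(2) v c *(5) unfolding x by (rule tangent_eqI)
    have "\<beta>' = ?\<beta>" using TM.cotangent_eqI[OF Tc[OF c] _ \<beta>] * coords(2)[OF c] by (simp add: x v')
    then show "u = ((x, v), ?\<beta>)" by (simp add: u' x v')
  qed
qed

section \<open>The map \<open>\<Phi>\<close> in charts\<close>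

interpretation PM: fd_atlas "prod_mfd M M" by (rule fd_atlas_prod) unfold_locales

lemma prod_chart_inv:
  assumes "c \<in> M" "d \<in> M" "x \<in> fst c" "y \<in> fst d"
  shows "chart_inv (prod_chart c d) (snd c x, snd d y) = (x, y)"
  using PM.chart_inv_snd[of "prod_chart c d" "(x, y)"] assms by (auto simp: prod_mfd_iff)

text \<open>In product charts the two projections become the linear projections of the model space,
  which are their own derivatives.\<close>

lemma tangent_map_fst_snd:
  assumes c: "c \<in> charts_at M x" and d: "d \<in> charts_at M y"
    and w: "w \<in> tangent_space (prod_mfd M M) (x, y)"
  shows "tangent_map (prod_mfd M M) M fst (x, y) w c = fst (w (prod_chart c d))"
    and "tangent_map (prod_mfd M M) M snd (x, y) w d = snd (w (prod_chart c d))"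
    and "tangent_map (prod_mfd M M) M fst (x, y) w \<in> tangent_space M x"
    and "tangent_map (prod_mfd M M) M snd (x, y) w \<in> tangent_space M y"
proof -
  have C: "prod_chart a b \<in> charts_at (prod_mfd M M) (u, v)" if "a \<in> charts_at M u"
    "b \<in> charts_at M v" for a b u v
    using that by (auto simp: charts_at_prod)
  have im: "snd (prod_chart a b) ` fst (prod_chart a b) =
    snd a ` fst a \<times> snd b ` fst b" for a b :: "('a, 'e) chart"
    by (simp add: prod_chart_image)
  have loc: "(snd a \<circ> fst \<circ> chart_inv (prod_chart a b)) p = fst p"
    "(snd b \<circ> snd \<circ> chart_inv (prod_chart a b)) p = snd p"
    if "a \<in> M" "b \<in> M" "p \<in> snd a ` fst a \<times> snd b ` fst b" for a b p
    using that by (auto simp: prod_chart_inv)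
  have op: "open (snd a ` fst a \<times> snd b ` fst b)" if "a \<in> M" "b \<in> M" for a b
    using that open_chart_image by (auto intro: open_Times)
  have sm: "smooth_on (snd a ` fst a \<times> snd b ` fst b) (snd a \<circ> fst \<circ> chart_inv (prod_chart a b))"
    "smooth_on (snd a ` fst a \<times> snd b ` fst b) (snd b \<circ> snd \<circ> chart_inv (prod_chart a b))"
    if ab: "a \<in> M" "b \<in> M" for a b
    using iffD2[OF smooth_on_cong[OF loc(1)[OF ab]] smooth_on_fst[OF op[OF ab]]]
      iffD2[OF smooth_on_cong[OF loc(2)[OF ab]] smooth_on_snd[OF op[OF ab]]] by (simp_all add: o_def)
  have smooth: "smooth_map_on (prod_mfd M M) M (carrier (prod_mfd M M)) fst"
    "smooth_map_on (prod_mfd M M) M (carrier (prod_mfd M M)) snd"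
  proof -
    have o: "openin (mtop (prod_mfd M M)) (carrier (prod_mfd M M))"
      using PM.topspace_mtop openin_topspace by metis
    have pt: "\<exists>a\<in>M. \<exists>b\<in>M. z \<in> fst (prod_chart a b)" if "z \<in> carrier (prod_mfd M M)" for z
      using that unfolding carrier_iff prod_mfd_iff Bex_def by metis
    show "smooth_map_on (prod_mfd M M) M (carrier (prod_mfd M M)) fst"
    proof (rule smooth_map_onI[OF PM.fd_atlas_axioms o])
      fix z assume "z \<in> carrier (prod_mfd M M)"
      then obtain a b where ab: "a \<in> M" "b \<in> M" "z \<in> fst (prod_chart a b)" using pt by blast
      then have P: "prod_chart a b \<in> prod_mfd M M" unfolding prod_mfd_iff by blast
      then show "\<exists>C\<in>prod_mfd M M. \<exists>d\<in>M. \<exists>V. z \<in> V \<and>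
        V \<subseteq> carrier (prod_mfd M M) \<inter> fst C \<and> fst ` V \<subseteq> fst d \<and>
        smooth_on (snd C ` V) (snd d \<circ> fst \<circ> chart_inv C)"
        using ab sm(1)[OF ab(1,2)] im[of a b]
        by (intro bexI[OF _ P] bexI[OF _ ab(1)] exI[of _ "fst (prod_chart a b)"])
          (auto simp: carrier_iff simp del: fst_prod_chart intro!: bexI[OF _ P], auto)
    qed
    show "smooth_map_on (prod_mfd M M) M (carrier (prod_mfd M M)) snd"
    proof (rule smooth_map_onI[OF PM.fd_atlas_axioms o])
      fix z assume "z \<in> carrier (prod_mfd M M)"
      then obtain a b where ab: "a \<in> M" "b \<in> M" "z \<in> fst (prod_chart a b)" using pt by blast
      then have P: "prod_chart a b \<in> prod_mfd M M" unfolding prod_mfd_iff by blast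
      then show "\<exists>C\<in>prod_mfd M M. \<exists>d\<in>M. \<exists>V. z \<in> V \<and>
        V \<subseteq> carrier (prod_mfd M M) \<inter> fst C \<and> snd ` V \<subseteq> fst d \<and>
        smooth_on (snd C ` V) (snd d \<circ> snd \<circ> chart_inv C)"
        using ab sm(2)[OF ab(1,2)] im[of a b]
        by (intro bexI[OF _ P] bexI[OF _ ab(2)] exI[of _ "fst (prod_chart a b)"])
          (auto simp: carrier_iff simp del: fst_prod_chart intro!: bexI[OF _ P], auto)
    qed
  qed
  have cd: "c \<in> M" "d \<in> M" "x \<in> fst c" "y \<in> fst d" using c d by (auto simp: charts_at_iff)
  have xy: "(x, y) \<in> carrier (prod_mfd M M)" using C[OF c d] unfolding carrier_iff charts_at_iff by blast
  note E = tangent_map_smooth[OF PM.fd_atlas_axioms fd_atlas_axioms _ xy C[OF c d] _ w]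
  have in_im: "snd (prod_chart c d) (x, y) \<in> snd c ` fst c \<times> snd d ` fst d" using cd by simp
  have "\<D> (snd c \<circ> fst \<circ> chart_inv (prod_chart c d)) (snd (prod_chart c d) (x, y)) =
    \<D> fst (snd (prod_chart c d) (x, y))"
    "\<D> (snd d \<circ> snd \<circ> chart_inv (prod_chart c d)) (snd (prod_chart c d) (x, y)) =
      \<D> snd (snd (prod_chart c d) (x, y))"
    using fderiv_cong_open[OF op[OF cd(1,2)] in_im loc(1)[OF cd(1,2)]]
      fderiv_cong_open[OF op[OF cd(1,2)] in_im loc(2)[OF cd(1,2)]] by (simp_all add: o_def)
  moreover have "\<D> fst p = fst" "\<D> snd p = snd" for p :: "'e \<times> 'e"
    by (auto intro!: fderivI bounded_linear_imp_has_derivative bounded_linear_fst bounded_linear_snd)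
  ultimately show "tangent_map (prod_mfd M M) M fst (x, y) w c = fst (w (prod_chart c d))"
    "tangent_map (prod_mfd M M) M snd (x, y) w d = snd (w (prod_chart c d))"
    using E[OF smooth(1), of c] E[OF smooth(2), of d] c d by simp_all
  show "tangent_map (prod_mfd M M) M fst (x, y) w \<in> tangent_space M x"
    "tangent_map (prod_mfd M M) M snd (x, y) w \<in> tangent_space M y"
    using tangent_map_in[OF PM.fd_atlas_axioms fd_atlas_axioms smooth(1) xy w]
      tangent_map_in[OF PM.fd_atlas_axioms fd_atlas_axioms smooth(2) xy w] by simp_all
qed

lemma Phi_eq:
  assumes c: "c \<in> charts_at M x" and d: "d \<in> charts_at M y"
    and \<alpha>: "\<alpha> \<in> cotangent_space M x" and \<beta>: "\<beta> \<in> cotangent_space M y"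
  shows "Phi M ((x, \<alpha>), (y, \<beta>)) = ((x, y),
    covec_of (prod_mfd M M) (prod_chart c d) (x, y) (- covec_coord M c x \<alpha>, covec_coord M d y \<beta>))"
proof -
  have "\<alpha> (tangent_map (prod_mfd M M) M fst (x, y) w) = covec_coord M c x \<alpha> \<bullet> fst (w (prod_chart c d))"
    "\<beta> (tangent_map (prod_mfd M M) M snd (x, y) w) = covec_coord M d y \<beta> \<bullet> snd (w (prod_chart c d))"
    if w: "w \<in> tangent_space (prod_mfd M M) (x, y)" for w
    using covec_apply[OF \<alpha> c] covec_apply[OF \<beta> d] tangent_map_fst_snd[OF c d w] by simp_all
  then show ?thesis by (auto simp: Phi_def covec_of_def inner_prod_def fun_eq_iff)
qed

text \<open>Makes the \<open>inv_into\<close> in \<open>Phi_inv\<close> a genuine inverse on the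
  range of \<open>Phi\<close>.\<close>

lemma inj_Phi: "inj_on (Phi M) (carrier (cotangent_bundle M) \<times> carrier (cotangent_bundle M))"
proof (rule inj_onI)
  fix P P' assume P: "P \<in> carrier (cotangent_bundle M) \<times> carrier (cotangent_bundle M)"
    and P': "P' \<in> carrier (cotangent_bundle M) \<times> carrier (cotangent_bundle M)"
      and eq: "Phi M P = Phi M P'"
  obtain x \<alpha> y \<beta> where P1: "P = ((x, \<alpha>), (y, \<beta>))" by (metis surj_pair)
  obtain x' \<alpha>' y' \<beta>' where P2: "P' = ((x', \<alpha>'), (y', \<beta>'))" by (metis surj_pair)
  have xy: "x' = x" "y' = y" using eq P1 P2 by (auto simp: Phi_def)
  have in1: "\<alpha> \<in> cotangent_space M x" "\<alpha>' \<in> cotangent_space M x"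
    "\<beta> \<in> cotangent_space M y" "\<beta>' \<in> cotangent_space M y" "x \<in> carrier M" "y \<in> carrier M"
    using P P' P1 P2 xy by (auto simp: carrier_cotangent)
  obtain c where c: "c \<in> charts_at M x" using in1(5) unfolding carrier_iff charts_at_iff by blast
  obtain d where d: "d \<in> charts_at M y" using in1(6) unfolding carrier_iff charts_at_iff by blast
  have C: "prod_chart c d \<in> charts_at (prod_mfd M M) (x, y)" using c d by (auto simp: charts_at_prod)
  have "covec_of (prod_mfd M M) (prod_chart c d) (x, y) (- covec_coord M c x \<alpha>, covec_coord M d y \<beta>) =
    covec_of (prod_mfd M M) (prod_chart c d) (x, y) (- covec_coord M c x \<alpha>', covec_coord M d y \<beta>')"
    using eq unfolding P1 P2 xy Phi_eq[OF c d in1(1,3)] Phi_eq[OF c d in1(2,4)] by simp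
  then have "(- covec_coord M c x \<alpha>, covec_coord M d y \<beta>) =
    (- covec_coord M c x \<alpha>', covec_coord M d y \<beta>')"
    using PM.covec_coord_of[OF C] by metis
  then have "\<alpha> = \<alpha>'" "\<beta> = \<beta>'" using cotangent_eqI[OF c in1(1,2)] cotangent_eqI[OF d in1(3,4)] by simp_all
  then show "P = P'" using P1 P2 xy by simp
qed

text \<open>The preimage comes from solving \<open>Phi_eq\<close> for the two momenta;
  \<open>- fst P\<close> undoes the sign in the first slot.\<close>

lemma Phi_inv_eq:
  assumes c: "c \<in> charts_at M x" and d: "d \<in> charts_at M y"
    and \<gamma>: "\<gamma> \<in> cotangent_space (prod_mfd M M) (x, y)"
  defines "P \<equiv> covec_coord (prod_mfd M M) (prod_chart c d) (x, y) \<gamma>"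
  shows "Phi_inv M ((x, y), \<gamma>) = ((x, covec_of M c x (- fst P)), (y, covec_of M d y (snd P)))"
  unfolding Phi_inv_def
proof (rule inv_into_f_eq[OF inj_Phi])
  have xy: "x \<in> carrier M" "y \<in> carrier M" using c d unfolding carrier_iff charts_at_iff by blast+
  then show "((x, covec_of M c x (- fst P)), (y, covec_of M d y (snd P))) \<in>
      carrier (cotangent_bundle M) \<times> carrier (cotangent_bundle M)"
    by (simp add: carrier_cotangent covec_of_in)
  have C: "prod_chart c d \<in> charts_at (prod_mfd M M) (x, y)" using c d by (auto simp: charts_at_prod)
  show "Phi M ((x, covec_of M c x (- fst P)), (y, covec_of M d y (snd P))) = ((x, y), \<gamma>)"
    unfolding Phi_eq[OF c d covec_of_in covec_of_in] using c d PM.covec_of_coord[OF C \<gamma>]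
    by (simp add: P_def)
qed

end

section \<open>Cotangent lifts in charts\<close>

text \<open>\<open>V\<^sub>0\<close> carries the smooth map and its smooth inverse; \<open>V\<close>
  is its part that fits into both charts, and \<open>s\<close> is the inverse read in them.
  \<open>V\<^sub>0\<close> is returned too, because the tangent map is controlled by smoothness on
  it.\<close>

lemma local_diffeo_chart:
  assumes "fd_atlas M" "fd_atlas N" and F: "local_diffeo_on M N U F" and x: "x \<in> U"
    and c: "c \<in> charts_at M x" and d: "d \<in> charts_at N (F x)"
  obtains V\<^sub>0 V s where "smooth_map_on M N V\<^sub>0 F" "V \<subseteq> V\<^sub>0"
    "openin (mtop M) V" "x \<in> V" "V \<subseteq> U \<inter> fst c" "F ` V \<subseteq> fst d"
    "smooth_on (snd c ` V) (snd d \<circ> F \<circ> chart_inv c)" "smooth_on (snd d ` F ` V) s"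
    "\<forall>x'\<in>V. s (snd d (F x')) = snd c x'"
proof -
  interpret M: fd_atlas M by fact
  interpret N: fd_atlas N by fact
  have cd: "c \<in> M" "x \<in> fst c" "d \<in> N" "F x \<in> fst d" using c d by (auto simp: charts_at_iff)
  obtain V\<^sub>0 where V\<^sub>0: "x \<in> V\<^sub>0" "V\<^sub>0 \<subseteq> U" "inj_on F V\<^sub>0" "smooth_map_on M N V\<^sub>0 F"
    "smooth_map_on N M (F ` V\<^sub>0) (inv_into V\<^sub>0 F)"
    using F x unfolding local_diffeo_on_def by metis
  define V where "V = {x\<in>V\<^sub>0 \<inter> fst c. F x \<in> fst d}"
  define s where "s = snd c \<circ> inv_into V\<^sub>0 F \<circ> chart_inv d"
  have r: "smooth_on (snd c ` V) (snd d \<circ> F \<circ> chart_inv c)"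
    unfolding V_def by (rule smooth_map_chart[OF assms(1,2) V\<^sub>0(4) cd(1,3)])
  \<comment> \<open>The domain on which \<open>smooth_map_chart\<close> makes the inverse smooth is
    exactly the image of \<open>V\<close>.\<close>
  have "{y\<in>F ` V\<^sub>0 \<inter> fst d. inv_into V\<^sub>0 F y \<in> fst c} = F ` V"
    using V\<^sub>0(3) by (auto simp: V_def)
  then have s: "smooth_on (snd d ` F ` V) s"
    using smooth_map_chart[OF assms(2,1) V\<^sub>0(5) cd(3,1)] by (simp add: s_def)
  show thesis
  proof
    show "openin (mtop M) V"
      by (rule M.openin_subset_chartI[OF cd(1) _ smooth_on_open[OF r]]) (auto simp: V_def)
    show "\<forall>x'\<in>V. s (snd d (F x')) = snd c x'"
      using V\<^sub>0(3) cd by (simp add: s_def V_def)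
  qed (use V\<^sub>0 cd r s in \<open>auto simp: V_def\<close>)
qed

text \<open>The derivatives of the local expression and of \<open>s\<close> invert each other, so
  the \<open>inv_into\<close> in the lift is the derivative of \<open>s\<close> in charts. The
  pairing through \<open>s\<close> will give smoothness, the pairing through the derivative of
  \<open>F\<close> the values and derivatives on the zero section.\<close>

lemma cotangent_lift_coord:
  fixes M :: "('a, 'e::real_inner) atlas" and N :: "('b, 'f::real_inner) atlas"
  assumes "fd_atlas M" "fd_atlas N" and F: "smooth_map_on M N V\<^sub>0 F"
    and V: "V \<subseteq> V\<^sub>0" "V \<subseteq> fst c" "F ` V \<subseteq> fst d" and c: "c \<in> M" and d: "d \<in> N"
    and r: "smooth_on (snd c ` V) (snd d \<circ> F \<circ> chart_inv c)" and s: "smooth_on (snd d ` F ` V) s"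
    and inv: "\<forall>x'\<in>V. s (snd d (F x')) = snd c x'"
    and x: "x \<in> V" and \<alpha>: "\<alpha> \<in> cotangent_space M x"
  defines "\<gamma> \<equiv> snd (cotangent_lift M N F (x, \<alpha>))"
  shows "\<gamma> \<in> cotangent_space N (F x)"
    and "covec_coord N d (F x) \<gamma> \<bullet> w = covec_coord M c x \<alpha> \<bullet> \<D> s (snd d (F x)) w"
    and "covec_coord N d (F x) \<gamma> \<bullet> \<D> (snd d \<circ> F \<circ> chart_inv c) (snd c x) a = covec_coord M c x \<alpha> \<bullet> a"
proof -
  interpret M: fd_atlas M by fact
  interpret N: fd_atlas N by fact
  let ?r = "snd d \<circ> F \<circ> chart_inv c" and ?T = "tangent_map M N F x"
  let ?L = "\<D> ?r (snd c x)" and ?K = "\<D> s (snd d (F x))"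
  have cx: "c \<in> charts_at M x" and dx: "d \<in> charts_at N (F x)" and xV\<^sub>0: "x \<in> V\<^sub>0"
    using c d V x by (auto simp: charts_at_iff)
  have rx: "?r (snd c x') = snd d (F x')" if "x' \<in> V" for x' using that V c by auto
  have xc: "snd c x \<in> snd c ` V" and xd: "snd d (F x) \<in> snd d ` F ` V" using x by auto
  have Lr: "(?r has_derivative ?L) (at (snd c x))" by (rule smooth_on_has_derivative[OF r xc])
  have Ks: "(s has_derivative ?K) (at (?r (snd c x)))"
    unfolding rx[OF x] by (rule smooth_on_has_derivative[OF s xd])
  have KL: "?K (?L a) = a" for a
  proof -
    have "\<D> (\<lambda>y. s (?r y)) (snd c x) = (\<lambda>a. ?K (?L a))"
      by (rule fderivI[OF has_derivative_compose[OF Lr Ks]])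
    moreover have "\<D> (\<lambda>y. s (?r y)) (snd c x) = \<D> (\<lambda>y. y) (snd c x)"
      by (rule fderiv_cong_open[OF smooth_on_open[OF r] xc]) (use rx inv in auto)
    ultimately show ?thesis by (metis frechet_derivative_ident)
  qed
  have LK: "?L (?K b) = b" for b
  proof -
    have Ks': "(s has_derivative ?K) (at (snd d (F x)))" by (rule smooth_on_has_derivative[OF s xd])
    have Lr': "(?r has_derivative ?L) (at (s (snd d (F x))))" using Lr inv x by simp
    have "\<D> (\<lambda>y. ?r (s y)) (snd d (F x)) = (\<lambda>a. ?L (?K a))"
      by (rule fderivI[OF has_derivative_compose[OF Ks' Lr']])
    moreover have "\<D> (\<lambda>y. ?r (s y)) (snd d (F x)) = \<D> (\<lambda>y. y) (snd d (F x))"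
      by (rule fderiv_cong_open[OF smooth_on_open[OF s] xd]) (use rx inv in auto)
    ultimately show ?thesis by (metis frechet_derivative_ident)
  qed
  have T: "?T u d = ?L (u c)" "?T u \<in> tangent_space N (F x)" if "u \<in> tangent_space M x" for u
    using tangent_map_smooth[OF assms(1,2) F xV\<^sub>0 cx dx that] tangent_map_in[OF assms(1,2) F xV\<^sub>0 that] by simp_all
  have inj: "inj_on ?T (tangent_space M x)"
  proof (rule inj_onI)
    fix u u' assume u: "u \<in> tangent_space M x" "u' \<in> tangent_space M x" "?T u = ?T u'"
    then have "?L (u c) = ?L (u' c)" using T(1)[OF u(1)] T(1)[OF u(2)] by simp
    then have "u c = u' c" using KL by metis
    then show "u = u'" by (rule M.tangent_eqI[OF u(1,2) cx])
  qed
  have Tinv: "inv_into (tangent_space M x) ?T w =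
    tvec_of M c x (?K (w d))" if w: "w \<in> tangent_space N (F x)" for w
  proof (rule inv_into_f_eq[OF inj M.tvec_of_in[OF cx]])
    note in_T = M.tvec_of_in[OF cx, of "?K (w d)"]
    show "?T (tvec_of M c x (?K (w d))) = w"
      by (rule N.tangent_eqI[OF T(2)[OF in_T] w dx]) (simp add: T(1)[OF in_T] LK cx)
  qed
  have "linear ?K" by (rule smooth_on_linear[OF s xd])
  then have "linear (\<lambda>w. covec_coord M c x \<alpha> \<bullet> ?K w)"
    by (simp add: linear_iff inner_add_right)
  then obtain P where P: "\<And>w. covec_coord M c x \<alpha> \<bullet> ?K w = P \<bullet> w"
    using linear_functional_representation[OF N.fdim] by metis
  have "\<gamma> w = (if w \<in> tangent_space N (F x) then P \<bullet> w d else 0)" for w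
    using M.covec_apply[OF \<alpha> cx M.tvec_of_in[OF cx]] P cx by (simp add: \<gamma>_def cotangent_lift_def Tinv)
  then have \<gamma>: "\<gamma> = covec_of N d (F x) P" by (simp add: covec_of_def fun_eq_iff)
  show "\<gamma> \<in> cotangent_space N (F x)" unfolding \<gamma> by (rule N.covec_of_in)
  show *: "covec_coord N d (F x) \<gamma> \<bullet> w = covec_coord M c x \<alpha> \<bullet> ?K w" for w
    unfolding \<gamma> using P dx by simp
  show "covec_coord N d (F x) \<gamma> \<bullet> ?L a = covec_coord M c x \<alpha> \<bullet> a"
    unfolding * KL by simp
qed

section \<open>Derivatives along the fibres\<close>

lemma (in fd_atlas) fibre_chart_inv:
  assumes "c \<in> charts_at M x"
  shows "chart_inv (tangent_space M x, \<lambda>v. v c) w = tvec_of M c x w"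
  unfolding chart_inv_def using tangent_bij[OF assms] assms tvec_of_in[OF assms]
  by (intro inv_into_f_eq) (auto simp: bij_betw_def)

text \<open>The charts of a fibre are linear, so their transition is the Jacobian itself and not
  merely approximated by it.\<close>

lemma (in fd_atlas) fibre_transition_eq:
  assumes "c \<in> charts_at M x" "d \<in> charts_at M x"
  shows "transition (tangent_space M x, \<lambda>v. v c) (tangent_space M x, \<lambda>v. v d) = jac c d x"
  using assms by (auto simp: fibre_chart_inv tvec_of_def fun_eq_iff)

lemma (in fd_atlas) fd_atlas_fibre: "fd_atlas (fibre_mfd M x)"
proof
  show "fdim TYPE('e)" by (rule fdim)
  show "smooth_atlas (fibre_mfd M x)" unfolding smooth_atlas_def
  proof (intro conjI ballI)
    fix k assume "k \<in> fibre_mfd M x"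
    then obtain c where c: "c \<in> charts_at M x" "k = (tangent_space M x, \<lambda>v. v c)"
      unfolding fibre_mfd_def by blast
    have k: "inj_on (snd k) (fst k)" "snd k ` fst k = UNIV"
      using tangent_bij[OF c(1)] c(2) by (auto simp: bij_betw_def)
    show "inj_on (snd k) (fst k)" "open (snd k ` fst k)" using k by simp_all
    fix l assume "l \<in> fibre_mfd M x"
    then obtain d where d: "d \<in> charts_at M x" "l = (tangent_space M x, \<lambda>v. v d)"
      unfolding fibre_mfd_def by blast
    have "snd k ` (fst k \<inter> fst l) = UNIV" using k c d by simp
    moreover have "bounded_linear (jac c d x)"
      using transition_has_derivative[OF c(1) d(1)] by (rule has_derivative_bounded_linear)
    ultimately show "smooth_on (snd k ` (fst k \<inter> fst l)) (transition k l)"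
      using fibre_transition_eq[OF c(1) d(1)] smooth_on_bounded_linear[of UNIV] c d by simp
  qed
qed

text \<open>Reduces the second condition on discretization maps to calculus on the model space:
  after \<open>fibre_iso\<close>, the tangent map along a fibre is an ordinary derivative at 0 in
  the component coordinate.\<close>

lemma (in fd_atlas) tangent_map_fibre:
  assumes c: "c \<in> charts_at M x" and f: "f tzero = x"
    and diff: "(\<lambda>w. snd c (f (tvec_of M c x w))) differentiable (at 0)"
    and v: "v \<in> tangent_space M x"
  shows "tangent_map (fibre_mfd M x) M f tzero (fibre_iso M x v) c =
    \<D> (\<lambda>w. snd c (f (tvec_of M c x w))) 0 (v c)"
proof -
  interpret F: fd_atlas "fibre_mfd M x" by (rule fd_atlas_fibre)
  let ?k = "\<lambda>c. (tangent_space M x, \<lambda>v :: ('a, 'e) tvec. v c)"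
  have k: "?k c \<in> charts_at (fibre_mfd M x) tzero" if "c \<in> charts_at M x" for c
    using that by (auto simp: charts_at_iff fibre_mfd_def)
  have eq: "snd c \<circ> f \<circ> chart_inv (?k c) = (\<lambda>w. snd c (f (tvec_of M c x w)))"
    by (simp add: fun_eq_iff fibre_chart_inv[OF c])
  have z: "snd (?k c) tzero = 0" by (simp add: tzero_def)
  have "fibre_iso M x v \<in> tangent_space (fibre_mfd M x) tzero"
  proof (rule F.tangentI)
    fix k assume "k \<notin> charts_at (fibre_mfd M x) tzero"
    then have "k \<notin> fibre_mfd M x" unfolding charts_at_iff fibre_mfd_def by auto
    then show "fibre_iso M x v k = 0" by (simp add: fibre_iso_def)
  next
    fix k l assume kl: "k \<in> charts_at (fibre_mfd M x) tzero" "l \<in> charts_at (fibre_mfd M x) tzero"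
    have "k \<in> ?k ` charts_at M x" using kl(1) unfolding charts_at_iff fibre_mfd_def by blast
    moreover have "l \<in> ?k ` charts_at M x" using kl(2) unfolding charts_at_iff fibre_mfd_def by blast
    ultimately obtain a b where ab: "a \<in> charts_at M x" "k = ?k a" "b \<in> charts_at M x" "l = ?k b"
      by blast
    have "bounded_linear (jac a b x)"
      using transition_has_derivative[OF ab(1,3)] by (rule has_derivative_bounded_linear)
    then have "jac k l tzero = jac a b x"
      unfolding ab(2,4) jac_def[of "?k a"] fibre_transition_eq[OF ab(1,3)]
      by (intro fderivI bounded_linear_imp_has_derivative)
    moreover have "fibre_iso M x v k = v a" "fibre_iso M x v l = v b"
      using kl ab by (auto simp: fibre_iso_def charts_at_iff)
    ultimately show "jac k l tzero (fibre_iso M x v k) = fibre_iso M x v l"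
      using tangent_jac[OF v ab(1,3)] by simp
  qed
  then have "tangent_map (fibre_mfd M x) M f tzero (fibre_iso M x v) c =
     \<D> (snd c \<circ> f \<circ> chart_inv (?k c)) (snd (?k c) tzero) (fibre_iso M x v (?k c))"
    using k[OF c] c f diff by (intro tangent_map_eq F.fd_atlas_axioms) (simp_all only: eq z)
  moreover have "fibre_iso M x v (?k c) = v c" using k[OF c] by (simp add: fibre_iso_def charts_at_iff)
  ultimately show ?thesis by (simp only: eq z)
qed

section \<open>The lifted map in coordinates at the zero section\<close>

text \<open>\<open>Y\<close> is the lifted map on the fibre over the fixed point
  \<open>(q, p)\<close>, as a function of \<open>w = (q', p')\<close>. The data of \<open>r\<close>
  on the zero section are assumed on a neighbourhood \<open>A\<close> of \<open>q\<close>, because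
  they get differentiated in the base direction.\<close>

lemma lifted_discretization_coordinates:
  fixes r :: "'e::real_inner \<times> 'e \<Rightarrow> 'e \<times> 'e" and Y :: "'e \<times> 'e \<Rightarrow> ('e \<times> 'e) \<times> ('e \<times> 'e)"
  assumes "fdim TYPE('e)" and r: "smooth_on S r"
    and A: "open A" "q \<in> A" "\<And>y. y \<in> A \<Longrightarrow> (y, 0) \<in> S" "\<And>y. y \<in> A \<Longrightarrow> r (y, 0) = (y, y)"
      "\<And>y h. y \<in> A \<Longrightarrow> snd (\<D> r (y, 0) (0, h)) - fst (\<D> r (y, 0) (0, h)) = h"
    and N: "open N" "0 \<in> N" "\<And>w. w \<in> N \<Longrightarrow> fst (fst (Y w)) = fst (r (q, fst w))"
      "\<And>w. w \<in> N \<Longrightarrow> fst (snd (Y w)) = snd (r (q, fst w))"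
      "\<And>w a. w \<in> N \<Longrightarrow> (- snd (fst (Y w)), snd (snd (Y w))) \<bullet> \<D> r (q, fst w) a = (snd w, p) \<bullet> a"
    and Y: "Y differentiable (at 0)"
  shows "Y 0 = ((q, p), (q, p))" and "snd (\<D> Y 0 w) - fst (\<D> Y 0 w) = w"
proof -
  have vec_eqI: "u = v" if "\<And>h. u \<bullet> h = v \<bullet> h" for u v :: 'e
    using that by (metis inner_commute vector_eq_ldot)
  have base: "\<D> r (y, 0) (h, 0) = (h, h)" if y: "y \<in> A" for y h
  proof -
    have "\<D> r (y, 0) (h, 0) = \<D> (\<lambda>y. r (y, 0)) y h"
      by (rule fderiv_partials(1)[symmetric]) (rule smooth_on_differentiable[OF r A(3)[OF y]])
    also have "\<D> (\<lambda>y. r (y, 0)) y = \<D> (\<lambda>y. (y, y)) y"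
      by (rule fderiv_cong_open[OF A(1) y A(4)])
    also have "\<D> (\<lambda>y. (y, y)) y = (\<lambda>h. (h, h))"
      by (rule fderivI) (auto intro!: derivative_eq_intros)
    finally show ?thesis .
  qed
  note at0 = N(5)[OF N(2)]
  \<comment> \<open>Horizontal test vectors are sent to the diagonal, which sees only the difference
    of the two momenta.\<close>
  have sum0: "snd (snd (Y 0)) - snd (fst (Y 0)) = 0"
  proof (rule vec_eqI)
    fix h show "(snd (snd (Y 0)) - snd (fst (Y 0))) \<bullet> h = 0 \<bullet> h"
      using at0[of "(h, 0)"] by (simp add: base A(2) inner_diff_left)
  qed
  \<comment> \<open>The image of a vertical test vector has components that differ by
    \<open>h\<close>; on their common part the equal momenta cancel.\<close>
  have p1: "snd (snd (Y 0)) = p"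
  proof (rule vec_eqI)
    fix h
    let ?X = "\<D> r (q, 0) (0, h)"
    have "snd ?X = fst ?X + h" using A(5)[OF A(2), of h] by (simp add: algebra_simps)
    then have "- (snd (fst (Y 0)) \<bullet> fst ?X) + snd (snd (Y 0)) \<bullet> (fst ?X + h) = p \<bullet> h"
      using at0[of "(0, h)"] by (simp add: inner_prod_def)
    then show "snd (snd (Y 0)) \<bullet> h = p \<bullet> h" using sum0 by (simp add: inner_add_right)
  qed
  have p0: "snd (fst (Y 0)) = p" using sum0 p1 by simp
  show "Y 0 = ((q, p), (q, p))"
    using p0 p1 N(3,4)[OF N(2)] A(4)[OF A(2)] by (simp add: prod_eq_iff)
  let ?Y' = "\<D> Y 0"
  have Y': "(Y has_derivative ?Y') (at 0)" by (rule fderiv_works[OF Y])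
  have aff: "((\<lambda>w. (q, fst w)) has_derivative (\<lambda>w. (0, fst w))) (at (0 :: 'e \<times> 'e))"
    by (auto intro!: derivative_eq_intros)
  have rq: "(r has_derivative \<D> r (q, 0)) (at (q, 0))"
    by (rule smooth_on_has_derivative[OF r A(3)[OF A(2)]])
  have "((\<lambda>w. r (q, fst w)) has_derivative (\<lambda>w. \<D> r (q, 0) (0, fst w))) (at (0 :: 'e \<times> 'e))"
    using has_derivative_compose[OF aff, of r "\<D> r (q, 0)"] rq by simp
  from has_derivative_diff[OF has_derivative_snd[OF this] has_derivative_fst[OF this]]
  have "\<D> (\<lambda>w. snd (r (q, fst w)) - fst (r (q, fst w))) (0 :: 'e \<times> 'e) = (\<lambda>w. fst w)"
    using A(5)[OF A(2)] by (subst fderivI) auto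
  moreover have "\<D> (\<lambda>w. fst (snd (Y w)) - fst (fst (Y w))) 0 =
    (\<lambda>w. fst (snd (?Y' w)) - fst (fst (?Y' w)))"
    using Y' by (intro fderivI has_derivative_diff has_derivative_fst has_derivative_snd)
  moreover have "\<D> (\<lambda>w. fst (snd (Y w)) - fst (fst (Y w))) 0 =
    \<D> (\<lambda>w. snd (r (q, fst w)) - fst (r (q, fst w))) 0"
    by (rule fderiv_cong_open[OF N(1,2)]) (simp add: N(3,4))
  ultimately have 1: "fst (snd (?Y' w)) - fst (fst (?Y' w)) = fst w" by metis
  have 2: "snd (snd (?Y' w)) - snd (fst (?Y' w)) = snd w"
  proof (rule vec_eqI)
    fix h
    let ?P = "\<lambda>w. (- snd (fst (Y w)), snd (snd (Y w)))"
      and ?P' = "\<lambda>w. (- snd (fst (?Y' w)), snd (snd (?Y' w)))"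
    \<comment> \<open>Rate of change of the horizontal derivative along the fibre. In the product
      rule, \<open>?P' w\<close> against the diagonal vector \<open>(h, h)\<close> is the wanted
      difference, and \<open>?P 0\<close> against \<open>?X w\<close> has to vanish.\<close>
    let ?X = "\<lambda>w. \<D> (\<lambda>y. \<D> r y (h, 0)) (q, 0) (0, fst w)"
    have P': "(?P has_derivative ?P') (at 0)"
      using Y' by (intro has_derivative_Pair has_derivative_minus has_derivative_fst has_derivative_snd)
    have "((\<lambda>w. \<D> r (q, fst w) (h, 0)) has_derivative ?X) (at (0 :: 'e \<times> 'e))"
      using has_derivative_compose[OF aff, of "\<lambda>y. \<D> r y (h, 0)" "\<D> (\<lambda>y. \<D> r y (h, 0)) (q, 0)"]
        smooth_on_has_derivative[OF smooth_on_fderiv[OF r] A(3)[OF A(2)], of "(h, 0)"] by simp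
    from fderivI[OF has_derivative_inner[OF P' this]]
    have "\<D> (\<lambda>w. ?P w \<bullet> \<D> r (q, fst w) (h, 0)) 0 w = ?P 0 \<bullet> ?X w + ?P' w \<bullet> \<D> r (q, 0) (h, 0)"
      by simp
    also have "\<D> (\<lambda>w. ?P w \<bullet> \<D> r (q, fst w) (h, 0)) 0 = \<D> (\<lambda>w. snd w \<bullet> h) 0"
      by (rule fderiv_cong_open[OF N(1,2)]) (simp add: N(5))
    also have "\<D> (\<lambda>w. snd w \<bullet> h) 0 = (\<lambda>w. snd w \<bullet> h)"
      by (intro fderivI bounded_linear_imp_has_derivative bounded_linear_intros)
    also have "?P 0 \<bullet> ?X w = 0"
    proof -
      let ?k = "fst w"
      have g: "(\<lambda>z. \<D> r z (0, ?k)) differentiable (at (q, 0))"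
        by (rule smooth_on_differentiable[OF smooth_on_fderiv[OF r] A(3)[OF A(2)]])
      \<comment> \<open>By symmetry the mixed derivative is that of the vertical derivative of \<open>r\<close> along the
        zero section, where the difference of its two components is constant.\<close>
      have "?X w = \<D> (\<lambda>y. \<D> r y (0, ?k)) (q, 0) (h, 0)"
        by (rule symmetric_second_derivative[OF r A(3)[OF A(2)]])
      also have "\<dots> = \<D> (\<lambda>y. \<D> r (y, 0) (0, ?k)) q h" by (rule fderiv_partials(1)[OF g, symmetric])
      finally have X: "?X w = \<D> (\<lambda>y. \<D> r (y, 0) (0, ?k)) q h" .
      have "(\<lambda>y. \<D> r (y, 0) (0, ?k)) differentiable (at q)"
        using differentiable_chain_at[of "\<lambda>y. (y, 0)" q "\<lambda>z. \<D> r z (0, ?k)"] g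
        by (auto simp: o_def intro!: derivative_intros)
      from fderiv_works[OF this]
      have "((\<lambda>y. snd (\<D> r (y, 0) (0, ?k)) - fst (\<D> r (y, 0) (0, ?k))) has_derivative
          (\<lambda>h. snd (\<D> (\<lambda>y. \<D> r (y, 0) (0, ?k)) q h) - fst (\<D> (\<lambda>y. \<D> r (y, 0) (0, ?k)) q h))) (at q)"
        by (intro has_derivative_diff has_derivative_fst has_derivative_snd)
      from fderivI[OF this]
      have "\<D> (\<lambda>y. snd (\<D> r (y, 0) (0, ?k)) - fst (\<D> r (y, 0) (0, ?k))) q h = snd (?X w) - fst (?X w)"
        unfolding X by simp
      moreover have "\<D> (\<lambda>y. snd (\<D> r (y, 0) (0, ?k)) - fst (\<D> r (y, 0) (0, ?k))) q = \<D> (\<lambda>y. ?k) q"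
        by (rule fderiv_cong_open[OF A(1,2) A(5)])
      ultimately have "snd (?X w) = fst (?X w)" by simp
      then show ?thesis by (simp add: p0 p1 inner_prod_def)
    qed
    finally show "(snd (snd (?Y' w)) - snd (fst (?Y' w))) \<bullet> h = snd w \<bullet> h"
      by (simp add: base A(2) inner_diff_left)
  qed
  show "snd (?Y' w) - fst (?Y' w) = w" using 1 2 by (simp add: prod_eq_iff)
qed

section \<open>The lifted discretization map\<close>

definition lifted_map ::
  "('a, 'e::real_inner) atlas \<Rightarrow> ('a \<times> ('a, 'e) tvec \<Rightarrow> 'a \<times> 'a) \<Rightarrow>
   ('a \<times> ('a, 'e) covec) \<times> ('a \<times> ('a, 'e) covec, 'e \<times> 'e) tvec \<Rightarrow>
   ('a \<times> ('a, 'e) covec) \<times> ('a \<times> ('a, 'e) covec)" where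
  "lifted_map Q R = Phi_inv Q \<circ> cotangent_lift (tangent_bundle Q) (prod_mfd Q Q) R \<circ> tulczyjew Q"

definition lifted_domain ::
  "('a, 'e::real_inner) atlas \<Rightarrow> ('a \<times> ('a, 'e) tvec) set \<Rightarrow>
   (('a \<times> ('a, 'e) covec) \<times> ('a \<times> ('a, 'e) covec, 'e \<times> 'e) tvec) set" where
  "lifted_domain Q U = {z \<in> carrier (tangent_bundle (cotangent_bundle Q)).
     tulczyjew Q z \<in> cotangent_over (tangent_bundle Q) U}"

lemma (in fd_atlas) tvec_of_zero: "c \<in> charts_at M x \<Longrightarrow> tvec_of M c x 0 = tzero"
  using tvec_of_eq[OF _ tzero_in, of c x] by (simp add: tzero_def)

context fd_atlas
begin

interpretation TM: fd_atlas "tangent_bundle M" by (rule fd_atlas_tangent)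
interpretation CM: fd_atlas "cotangent_bundle M" by (rule fd_atlas_cotangent)
interpretation TCM: fd_atlas "tangent_bundle (cotangent_bundle M)" by (rule CM.fd_atlas_tangent)
interpretation PM: fd_atlas "prod_mfd M M" by (rule fd_atlas_prod) unfold_locales
interpretation PCM: fd_atlas "prod_mfd (cotangent_bundle M) (cotangent_bundle M)"
  by (rule fd_atlas_prod) unfold_locales

lemma tangent_chart_image_iff:
  assumes "c \<in> charts_at M x" "W \<subseteq> fst (tangent_chart M c)"
  shows "(snd c x, w) \<in> snd (tangent_chart M c) ` W \<longleftrightarrow> (x, tvec_of M c x w) \<in> W"
proof -
  have "tangent_chart M c \<in> tangent_bundle M" "(x, tvec_of M c x w) \<in> fst (tangent_chart M c)"
    using assms(1) tvec_of_in[OF assms(1)] by (auto simp: tangent_bundle_def charts_at_iff)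
  from TM.chart_image_iff[OF this(1) assms(2) this(2)] show ?thesis using assms(1) by simp
qed

lemma carrier_TCM_E:
  assumes "z \<in> carrier (tangent_bundle (cotangent_bundle M))"
  obtains x \<alpha> \<zeta> c where "z = ((x, \<alpha>), \<zeta>)" "c \<in> charts_at M x" "\<alpha> \<in> cotangent_space M x"
    "\<zeta> \<in> tangent_space (cotangent_bundle M) (x, \<alpha>)"
proof -
  obtain x \<alpha> \<zeta> where z: "z = ((x, \<alpha>), \<zeta>)" by (metis surj_pair)
  have in1: "x \<in> carrier M" "\<alpha> \<in> cotangent_space M x" "\<zeta> \<in> tangent_space (cotangent_bundle M) (x, \<alpha>)"
    using assms z by (auto simp: carrier_tangent carrier_cotangent)
  obtain c where "c \<in> charts_at M x" using in1(1) unfolding carrier_iff charts_at_iff by blast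
  then show thesis using that z in1 by blast
qed

text \<open>\<open>tulczyjew\<close> puts the base point and the velocity into the base of the
  target cotangent bundle; the momenta are fibre coordinates there and do not affect
  membership.\<close>

lemma lifted_domain_iff:
  assumes c: "c \<in> charts_at M x" and \<alpha>: "\<alpha> \<in> cotangent_space M x"
    and \<zeta>: "\<zeta> \<in> tangent_space (cotangent_bundle M) (x, \<alpha>)"
  shows "((x, \<alpha>), \<zeta>) \<in> lifted_domain M U \<longleftrightarrow> (x, tvec_of M c x (fst (\<zeta> (cotangent_chart M c)))) \<in> U"
proof -
  have "x \<in> carrier M" using c unfolding carrier_iff charts_at_iff by blast
  then show ?thesis unfolding lifted_domain_def cotangent_over_def
    using \<alpha> \<zeta> tvec_of_in[OF c]
    by (simp add: tulczyjew_eq[OF assms] carrier_tangent carrier_cotangent TM.covec_of_in)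
qed

lemma chart_TCM:
  assumes "c \<in> M"
  shows "tangent_chart (cotangent_bundle M) (cotangent_chart M c) \<in> tangent_bundle (cotangent_bundle M)"
  using assms unfolding tangent_bundle_def cotangent_bundle_def by blast

lemma chart_TCM_E:
  assumes "z \<in> fst (tangent_chart (cotangent_bundle M) (cotangent_chart M c))" "c \<in> M"
  obtains x \<alpha> \<zeta> where "z = ((x, \<alpha>), \<zeta>)" "c \<in> charts_at M x" "\<alpha> \<in> cotangent_space M x"
    "\<zeta> \<in> tangent_space (cotangent_bundle M) (x, \<alpha>)"
  using assms by (auto simp: charts_at_iff)

text \<open>Selects \<open>(q, q')\<close> from \<open>((q, p), (q', p'))\<close>: the coordinate
  form of the tangent map of the projection from the cotangent bundle to its base.\<close>

abbreviation base_coords :: "('e \<times> 'e) \<times> ('e \<times> 'e) \<Rightarrow> 'e \<times> 'e" where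
  "base_coords t \<equiv> (fst (fst t), fst (snd t))"

lemma open_base_coords: "open T \<Longrightarrow> open {t. base_coords t \<in> T}"
  using open_vimage[of T base_coords] by (simp add: vimage_def continuous_intros)

lemma openin_lifted_domain:
  assumes U: "openin (mtop (tangent_bundle M)) U"
  shows "openin (mtop (tangent_bundle (cotangent_bundle M))) (lifted_domain M U)"
proof (rule TCM.openinI)
  fix z assume z: "z \<in> lifted_domain M U"
  then have "z \<in> carrier (tangent_bundle (cotangent_bundle M))" by (simp add: lifted_domain_def)
  then obtain x \<alpha> \<zeta> c where zx: "z = ((x, \<alpha>), \<zeta>)" "c \<in> charts_at M x" "\<alpha> \<in> cotangent_space M x"
    "\<zeta> \<in> tangent_space (cotangent_bundle M) (x, \<alpha>)" by (rule carrier_TCM_E)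
  have c: "c \<in> M" "x \<in> fst c" using zx by (auto simp: charts_at_iff)
  let ?C = "tangent_chart (cotangent_bundle M) (cotangent_chart M c)" and ?W =
    "U \<inter> fst (tangent_chart M c)"
  let ?O = "snd (tangent_chart M c) ` ?W"
  define V where "V = {z\<in>fst ?C. snd ?C z \<in> {t. base_coords t \<in> ?O}}"
  have Tc: "tangent_chart M c \<in> tangent_bundle M" using c by (auto simp: tangent_bundle_def)
  have "open {t. base_coords t \<in> ?O}"
    by (rule open_base_coords[OF TM.open_chart_image_of[OF U Tc]])
  then have "openin (mtop (tangent_bundle (cotangent_bundle M))) V"
    unfolding V_def by (rule TCM.openin_chart_vimage[OF chart_TCM[OF c(1)]])
  from TCM.open_chart_image_of[OF this chart_TCM[OF c(1)]]
  have "open (snd ?C ` V)" by (simp add: V_def Int_absorb2 subset_iff)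
  moreover have iff: "z' \<in> V \<longleftrightarrow> z' \<in> lifted_domain M U" if z'_in: "z' \<in> fst ?C" for z'
  proof -
    obtain x' \<alpha>' \<zeta>' where z': "z' = ((x', \<alpha>'), \<zeta>')" "c \<in> charts_at M x'" "\<alpha>' \<in> cotangent_space M x'"
      "\<zeta>' \<in> tangent_space (cotangent_bundle M) (x', \<alpha>')" using z'_in c(1) by (rule chart_TCM_E)
    have "z' \<in> V \<longleftrightarrow> (snd c x', fst (\<zeta>' (cotangent_chart M c))) \<in> ?O"
      using z'_in by (simp add: V_def z'(1))
    also have "\<dots> \<longleftrightarrow> (x', tvec_of M c x' (fst (\<zeta>' (cotangent_chart M c)))) \<in> ?W"
      by (rule tangent_chart_image_iff[OF z'(2)]) simp
    also have "\<dots> \<longleftrightarrow> z' \<in> lifted_domain M U"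
      using lifted_domain_iff[OF z'(2-4)] z'(1,2) tvec_of_in[OF z'(2)] by (simp add: charts_at_iff)
    finally show ?thesis .
  qed
  moreover have zC: "z \<in> fst ?C" using zx c by simp
  moreover have "V \<subseteq> fst ?C" by (auto simp: V_def)
  ultimately show "\<exists>C\<in>tangent_bundle (cotangent_bundle M). \<exists>V. z \<in> V \<and>
    V \<subseteq> lifted_domain M U \<inter> fst C \<and> open (snd C ` V)"
    using z chart_TCM[OF c(1)] by (intro bexI[of _ ?C] exI[of _ V]) auto
qed

text \<open>Composes the coordinate formulas of the three factors. The target charts
  \<open>d\<^sub>0\<close> and \<open>d\<^sub>1\<close> are independent, since the two components of
  \<open>R\<close> may lie far apart; the zero section later takes both equal to
  \<open>c\<close>.\<close>

lemma lifted_map_chart: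
  assumes V: "V \<subseteq> V\<^sub>0" "V \<subseteq> fst (tangent_chart M c)" "R ` V \<subseteq> fst (prod_chart d\<^sub>0 d\<^sub>1)"
    and c: "c \<in> M" and d: "d\<^sub>0 \<in> M" "d\<^sub>1 \<in> M"
    and R: "smooth_map_on (tangent_bundle M) (prod_mfd M M) V\<^sub>0 R"
    and r: "smooth_on (snd (tangent_chart M c) ` V) r"
    and r_def: "r = snd (prod_chart d\<^sub>0 d\<^sub>1) \<circ> R \<circ> chart_inv (tangent_chart M c)"
    and s: "smooth_on (snd (prod_chart d\<^sub>0 d\<^sub>1) ` R ` V) s"
    and inv: "\<forall>z\<in>V. s (snd (prod_chart d\<^sub>0 d\<^sub>1) (R z)) = snd (tangent_chart M c) z"
  defines "D \<equiv> prod_chart (cotangent_chart M d\<^sub>0) (cotangent_chart M d\<^sub>1)"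
    and "C \<equiv> tangent_chart (cotangent_bundle M) (cotangent_chart M c)"
  defines "Y \<equiv> snd D \<circ> lifted_map M R \<circ> chart_inv C"
    and "N \<equiv> {t. base_coords t \<in> snd (tangent_chart M c) ` V}"
  shows "t \<in> N \<Longrightarrow> chart_inv C t \<in> fst C \<and> snd C (chart_inv C t) = t \<and>
    lifted_map M R (chart_inv C t) \<in> fst D"
    and "t \<in> N \<Longrightarrow> fst (fst (Y t)) = fst (r (base_coords t))"
    and "t \<in> N \<Longrightarrow> fst (snd (Y t)) = snd (r (base_coords t))"
    and "t \<in> N \<Longrightarrow> (- snd (fst (Y t)), snd (snd (Y t))) \<bullet> \<D> r (base_coords t) a =
      (snd (snd t), snd (fst t)) \<bullet> a"
    and "smooth_on N Y"
proof -
  have Tc: "tangent_chart M c \<in> tangent_bundle M" and Pd: "prod_chart d\<^sub>0 d\<^sub>1 \<in> prod_mfd M M"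
    using c d by (auto simp: tangent_bundle_def prod_mfd_iff)
  \<comment> \<open>The last conjunct, the pairing through \<open>s\<close>, is carried along solely
    for the smoothness of \<open>Y\<close>.\<close>
  have main: "chart_inv C t \<in> fst C \<and> snd C (chart_inv C t) = t \<and>
    lifted_map M R (chart_inv C t) \<in> fst D \<and>
      fst (fst (Y t)) = fst (r (base_coords t)) \<and> fst (snd (Y t)) = snd (r (base_coords t)) \<and>
      (\<forall>a. (- snd (fst (Y t)), snd (snd (Y t))) \<bullet> \<D> r (base_coords t) a =
        (snd (snd t), snd (fst t)) \<bullet> a) \<and>
      (\<forall>w. (- snd (fst (Y t)), snd (snd (Y t))) \<bullet> w =
         (snd (snd t), snd (fst t)) \<bullet> \<D> s (r (base_coords t)) w)"
    if t: "t \<in> N" for t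
  proof -
    obtain q p q' p' where tq: "t = ((q, p), (q', p'))" by (metis surj_pair)
    obtain x v where xv: "(x, v) \<in> V" "q = snd c x" "q' = v c" using t by (auto simp: N_def tq)
    have cx: "c \<in> charts_at M x" and vT: "v \<in> tangent_space M x"
      using xv(1) V(2) c by (auto simp: charts_at_iff)
    have v: "tvec_of M c x q' = v" unfolding xv(3) by (rule tvec_of_eq[OF cx vT])
    define \<alpha> where "\<alpha> = covec_of M c x p"
    have \<alpha>: "\<alpha> \<in> cotangent_space M x" "covec_coord M c x \<alpha> = p"
      using covec_of_in cx by (simp_all add: \<alpha>_def)
    have Cc: "cotangent_chart M c \<in> charts_at (cotangent_bundle M) (x, \<alpha>)"
      using cx \<alpha> by (auto simp: charts_at_cotangent)
    define \<zeta> where "\<zeta> = tvec_of (cotangent_bundle M) (cotangent_chart M c) (x, \<alpha>) (q', p')"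
    have \<zeta>: "\<zeta> \<in> tangent_space (cotangent_bundle M) (x, \<alpha>)" "\<zeta> (cotangent_chart M c) = (q', p')"
      using CM.tvec_of_in[OF Cc] Cc by (simp_all add: \<zeta>_def)
    have t': "t = (snd (cotangent_chart M c) (x, \<alpha>), (q', p'))" by (simp add: tq xv(2) \<alpha>)
    have Cinv: "chart_inv C t = ((x, \<alpha>), \<zeta>)"
      unfolding t' C_def \<zeta>_def by (rule CM.tangent_chart_inv[OF Cc])
    have zC: "((x, \<alpha>), \<zeta>) \<in> fst C" "snd C ((x, \<alpha>), \<zeta>) = t"
      using cx \<alpha> \<zeta> by (simp_all add: C_def charts_at_iff tq xv(2))
    define \<beta> where "\<beta> = covec_of (tangent_bundle M) (tangent_chart M c) (x, v) (p', p)"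
    have Tcx: "tangent_chart M c \<in> charts_at (tangent_bundle M) (x, v)"
      using cx vT by (auto simp: charts_at_tangent)
    have \<beta>: "\<beta> \<in> cotangent_space (tangent_bundle M) (x, v)"
      "covec_coord (tangent_bundle M) (tangent_chart M c) (x, v) \<beta> = (p', p)"
      using TM.covec_of_in Tcx by (simp_all add: \<beta>_def)
    have tul: "tulczyjew M ((x, \<alpha>), \<zeta>) = ((x, v), \<beta>)"
      unfolding tulczyjew_eq[OF cx \<alpha>(1) \<zeta>(1)] by (simp add: \<zeta>(2) v \<alpha>(2) \<beta>_def)
    obtain y0 y1 where y: "R (x, v) = (y0, y1)" by fastforce
    have dy: "d\<^sub>0 \<in> charts_at M y0" "d\<^sub>1 \<in> charts_at M y1"
      using V(3) xv(1) y d by (auto simp: charts_at_iff)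
    define \<gamma> where "\<gamma> = snd (cotangent_lift (tangent_bundle M) (prod_mfd M M) R ((x, v), \<beta>))"
    note lift = cotangent_lift_coord[OF TM.fd_atlas_axioms PM.fd_atlas_axioms R V Tc Pd r[unfolded r_def] s inv xv(1) \<beta>(1),
        folded \<gamma>_def r_def, unfolded y \<beta>(2)]
    let ?P = "covec_coord (prod_mfd M M) (prod_chart d\<^sub>0 d\<^sub>1) (y0, y1) \<gamma>"
    have base: "base_coords t = snd (tangent_chart M c) (x, v)" by (simp add: tq xv)
    have xvc: "chart_inv (tangent_chart M c) (snd (tangent_chart M c) (x, v)) = (x, v)"
      using V(2) xv(1) by (intro TM.chart_inv_snd[OF Tc]) blast
    have rb: "r (base_coords t) = (snd d\<^sub>0 y0, snd d\<^sub>1 y1)"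
      unfolding base r_def comp_apply xvc y by simp
    have "cotangent_lift (tangent_bundle M) (prod_mfd M M) R ((x, v), \<beta>) = ((y0, y1), \<gamma>)"
      unfolding \<gamma>_def by (simp add: cotangent_lift_def y)
    then have L: "lifted_map M R ((x, \<alpha>), \<zeta>) =
      ((y0, covec_of M d\<^sub>0 y0 (- fst ?P)), (y1, covec_of M d\<^sub>1 y1 (snd ?P)))"
      using Phi_inv_eq[OF dy lift(1)] by (simp add: lifted_map_def tul)
    have Yt: "Y t = ((snd d\<^sub>0 y0, - fst ?P), (snd d\<^sub>1 y1, snd ?P))"
      using dy by (simp add: Y_def Cinv L D_def)
    have inD: "lifted_map M R ((x, \<alpha>), \<zeta>) \<in> fst D"
      using dy by (simp add: L D_def charts_at_iff covec_of_in)
    have P1: "(- snd (fst (Y t)), snd (snd (Y t))) = ?P" by (simp add: Yt)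
    have "?P \<bullet> \<D> r (base_coords t) a = (p', p) \<bullet> a" for a unfolding base by (rule lift(3))
    moreover have "?P \<bullet> w = (p', p) \<bullet> \<D> s (r (base_coords t)) w" for w
      unfolding rb using lift(2)[of w] by simp
    moreover have "(snd (snd t), snd (fst t)) = (p', p)" by (simp add: tq)
    ultimately show ?thesis unfolding P1 Cinv using zC inD by (simp add: Yt rb)
  qed
  show "t \<in> N \<Longrightarrow> chart_inv C t \<in> fst C \<and> snd C (chart_inv C t) = t \<and>
    lifted_map M R (chart_inv C t) \<in> fst D"
    "t \<in> N \<Longrightarrow> fst (fst (Y t)) = fst (r (base_coords t))"
    "t \<in> N \<Longrightarrow> fst (snd (Y t)) = snd (r (base_coords t))"
    "t \<in> N \<Longrightarrow> (- snd (fst (Y t)), snd (snd (Y t))) \<bullet> \<D> r (base_coords t) a =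
      (snd (snd t), snd (fst t)) \<bullet> a"
    using main[of t] by blast+
  have oN: "open N" unfolding N_def by (rule open_base_coords[OF smooth_on_open[OF r]])
  have coord: "smooth_on N (\<lambda>t. fst (fst t))" "smooth_on N (\<lambda>t. snd (fst t))"
    "smooth_on N (\<lambda>t. fst (snd t))" "smooth_on N (\<lambda>t. snd (snd t))"
    using smooth_on_linear_comp[OF bounded_linear_fst smooth_on_fst[OF oN]]
      smooth_on_linear_comp[OF bounded_linear_snd smooth_on_fst[OF oN]]
      smooth_on_linear_comp[OF bounded_linear_fst smooth_on_snd[OF oN]]
      smooth_on_linear_comp[OF bounded_linear_snd smooth_on_snd[OF oN]] by simp_all
  have rN: "smooth_on N (\<lambda>t. r (base_coords t))"
    by (rule smooth_on_compose[OF TM.fdim smooth_on_Pair[OF coord(1,3)] r]) (auto simp: N_def)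
  have rs: "(\<lambda>t. r (base_coords t)) ` N \<subseteq> snd (prod_chart d\<^sub>0 d\<^sub>1) ` R ` V"
  proof
    fix u assume "u \<in> (\<lambda>t. r (base_coords t)) ` N"
    then obtain z where z: "z \<in> V" "u = r (snd (tangent_chart M c) z)" unfolding N_def by auto
    have "chart_inv (tangent_chart M c) (snd (tangent_chart M c) z) = z"
      using V(2) z by (intro TM.chart_inv_snd[OF Tc]) blast
    then show "u \<in> snd (prod_chart d\<^sub>0 d\<^sub>1) ` R ` V" using z by (simp add: r_def)
  qed
  have F: "smooth_on N (\<lambda>t. (snd (snd t), snd (fst t)) \<bullet> \<D> s (r (base_coords t)) w)" for w
    by (rule smooth_on_inner[OF smooth_on_Pair[OF coord(4,2)]
          smooth_on_fderiv_compose[OF PM.fdim s rN smooth_on_const[OF oN] rs]])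
  \<comment> \<open>\<open>\<D> r\<close> constrains the momenta only implicitly; the formula
    through \<open>s\<close> gives each pairing as a smooth function of \<open>t\<close>.\<close>
  have PN: "smooth_on N (\<lambda>t. (- snd (fst (Y t)), snd (snd (Y t))))"
    by (rule smooth_on_dual[OF PM.fdim F]) (use main in blast)
  have "smooth_on N (\<lambda>t. ((fst (r (base_coords t)), - fst (- snd (fst (Y t)), snd (snd (Y t)))),
      (snd (r (base_coords t)), snd (- snd (fst (Y t)), snd (snd (Y t))))))"
    by (rule smooth_on_Pair[OF
          smooth_on_Pair[OF smooth_on_linear_comp[OF bounded_linear_fst rN]
            smooth_on_minus[OF smooth_on_linear_comp[OF bounded_linear_fst PN]]]
          smooth_on_Pair[OF smooth_on_linear_comp[OF bounded_linear_snd rN]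
            smooth_on_linear_comp[OF bounded_linear_snd PN]]])
  then show "smooth_on N Y"
    by (rule iffD1[OF smooth_on_cong, rotated]) (use main in \<open>simp add: prod_eq_iff\<close>)
qed

text \<open>Both components of \<open>R (x, tzero)\<close> equal \<open>x\<close>, so one chart
  \<open>c\<close> reads both tangent maps, and the condition on them becomes one on the derivative
  of \<open>r\<close> at 0.\<close>

lemma discretization_map_fibre:
  assumes disc: "discretization_map M W R" and c: "c \<in> charts_at M x"
    and r: "\<And>w. r w = snd (prod_chart c c) (R (x, tvec_of M c x w))"
    and diff: "r differentiable (at 0)"
  shows "snd (\<D> r 0 h) - fst (\<D> r 0 h) = h"
proof -
  have x: "x \<in> carrier M" using c unfolding carrier_iff charts_at_iff by blast
  have R0: "R (x, tzero) = (x, x)" using disc x by (simp add: discretization_map_def)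
  define v where "v = tvec_of M c x h"
  have v: "v \<in> tangent_space M x" "v c = h" using tvec_of_in[OF c] c by (simp_all add: v_def)
  have r12: "(\<lambda>w. snd c (fst (R (x, tvec_of M c x w)))) = (\<lambda>w. fst (r w))"
    "(\<lambda>w. snd c (snd (R (x, tvec_of M c x w)))) = (\<lambda>w. snd (r w))"
    by (simp_all add: r prod_chart_def map_prod_def case_prod_unfold)
  note d = has_derivative_fst[OF fderiv_works[OF diff]] has_derivative_snd[OF fderiv_works[OF diff]]
  have d': "\<D> (\<lambda>w. fst (r w)) 0 = (\<lambda>h. fst (\<D> r 0 h))" "\<D> (\<lambda>w. snd (r w)) 0 = (\<lambda>h. snd (\<D> r 0 h))"
    "(\<lambda>w. fst (r w)) differentiable (at 0)" "(\<lambda>w. snd (r w)) differentiable (at 0)"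
    using d fderivI[OF d(1)] fderivI[OF d(2)] unfolding differentiable_def by blast+
  have "tangent_map (fibre_mfd M x) M (\<lambda>u. fst (R (x, u))) tzero (fibre_iso M x v) c = fst (\<D> r 0 h)"
    by (subst tangent_map_fibre[OF c _ _ v(1)])
      (simp_all only: r12 v(2) R0 fst_conv snd_conv d')
  moreover have "tangent_map (fibre_mfd M x) M (\<lambda>u. snd (R (x, u))) tzero (fibre_iso M x v) c =
    snd (\<D> r 0 h)"
    by (subst tangent_map_fibre[OF c _ _ v(1)])
      (simp_all only: r12 v(2) R0 fst_conv snd_conv d')
  moreover have "tangent_map (fibre_mfd M x) M (\<lambda>u. snd (R (x, u))) tzero (fibre_iso M x v) c -
     tangent_map (fibre_mfd M x) M (\<lambda>u. fst (R (x, u))) tzero (fibre_iso M x v) c = v c"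
  proof -
    have "\<forall>x\<in>carrier M. \<forall>v\<in>tangent_space M x.
        (\<lambda>c. tangent_map (fibre_mfd M x) M (\<lambda>u. snd (R (x, u))) tzero (fibre_iso M x v) c
           - tangent_map (fibre_mfd M x) M (\<lambda>u. fst (R (x, u))) tzero (fibre_iso M x v) c) = v"
      using disc unfolding discretization_map_def by (elim conjE)
    from fun_cong[OF bspec[OF bspec[OF this x] v(1)], of c] show ?thesis .
  qed
  ultimately show ?thesis by (simp add: v(2))
qed

lemma lifted_map_zero_section:
  assumes disc: "discretization_map M W R" and zero: "\<forall>x\<in>carrier M. (x, tzero) \<in> U"
    and diffeo: "local_diffeo_on (tangent_bundle M) (prod_mfd M M) U R"
    and c: "c \<in> charts_at M x" and \<alpha>: "\<alpha> \<in> cotangent_space M x"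
  defines "g \<equiv> \<lambda>w. snd (prod_chart (cotangent_chart M c) (cotangent_chart M c))
      (lifted_map M R ((x, \<alpha>), tvec_of (cotangent_bundle M) (cotangent_chart M c) (x, \<alpha>) w))"
  shows "lifted_map M R ((x, \<alpha>), tzero) = ((x, \<alpha>), (x, \<alpha>))"
    and "g differentiable (at 0)" and "snd (\<D> g 0 w) - fst (\<D> g 0 w) = w"
proof -
  let ?Tc = "tangent_chart M c" and ?Pc = "prod_chart c c" and ?Cc = "cotangent_chart M c"
  let ?C = "tangent_chart (cotangent_bundle M) ?Cc" and ?D = "prod_chart ?Cc ?Cc"
  have cM: "c \<in> M" "x \<in> fst c" using c by (auto simp: charts_at_iff)
  have R0: "R (x', tzero) = (x', x')" if "x' \<in> carrier M" for x'
    using disc that by (simp add: discretization_map_def)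
  have x: "x \<in> carrier M" using cM unfolding carrier_iff by blast
  have Tc: "?Tc \<in> charts_at (tangent_bundle M) (x, tzero)" using c by (auto simp: charts_at_tangent)
  have Pc: "?Pc \<in> charts_at (prod_mfd M M) (R (x, tzero))"
    using c by (auto simp: R0[OF x] charts_at_prod)
  have Cc: "?Cc \<in> charts_at (cotangent_bundle M) (x, \<alpha>)" using c \<alpha> by (auto simp: charts_at_cotangent)
  define r where "r = snd ?Pc \<circ> R \<circ> chart_inv ?Tc"
  obtain V\<^sub>0 V s where V: "smooth_map_on (tangent_bundle M) (prod_mfd M M) V\<^sub>0 R" "V \<subseteq> V\<^sub>0"
    "(x, tzero) \<in> V" "V \<subseteq> U \<inter> fst ?Tc" "R ` V \<subseteq> fst ?Pc"
    "smooth_on (snd ?Tc ` V) r" "smooth_on (snd ?Pc ` R ` V) s"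
    "\<forall>z\<in>V. s (snd ?Pc (R z)) = snd ?Tc z"
    unfolding r_def
    by (rule local_diffeo_chart[OF TM.fd_atlas_axioms PM.fd_atlas_axioms diffeo zero[rule_format,
      OF x] Tc Pc]) blast
  have VT: "V \<subseteq> fst ?Tc" using V(4) by blast
  define N where "N = {t. base_coords t \<in> snd ?Tc ` V}"
  define Y where "Y = snd ?D \<circ> lifted_map M R \<circ> chart_inv ?C"
  note L = lifted_map_chart[OF V(2) VT V(5) cM(1) cM(1) cM(1) V(1,6) r_def V(7,8), folded N_def Y_def]
  have oN: "open N" using smooth_on_open[OF L(5)] .
  define q where "q = snd c x"
  define p where "p = covec_coord M c x \<alpha>"
  have g: "g = (\<lambda>w. Y ((q, p), w))"
    unfolding g_def Y_def q_def p_def using CM.tangent_chart_inv[OF Cc] by simp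
  \<comment> \<open>Chart coordinates of base points whose zero vector lies in \<open>V\<close>: the
    neighbourhood of \<open>q\<close> on which the zero-section identities of \<open>r\<close>
    hold.\<close>
  define A where "A = snd c ` fst c \<inter> (\<lambda>y. (y, 0)) -` (snd ?Tc ` V)"
  have A: "open A" unfolding A_def
    using open_chart_image[OF cM(1)] smooth_on_open[OF V(6)]
    by (intro open_Int open_vimage) (auto intro!: continuous_intros)
  have qN: "((q, p), 0) \<in> N" using V(3) by (force simp: N_def q_def tzero_def)
  have A_pt: "\<exists>x'. c \<in> charts_at M x' \<and> y = snd c x' \<and> (x', tzero) \<in> V" if y: "y \<in> A" for y
  proof -
    obtain x' where x': "x' \<in> fst c" "y = snd c x'" "(snd c x', 0) \<in> snd ?Tc ` V"
      using y by (auto simp: A_def)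
    then have cx': "c \<in> charts_at M x'" using cM by (simp add: charts_at_iff)
    have "(x', tzero) \<in> V"
      using tangent_chart_image_iff[OF cx' VT, of 0] x'(3) tvec_of_zero[OF cx'] by simp
    then show ?thesis using x' cx' by blast
  qed
  have qA: "q \<in> A" using V(3) cM by (force simp: A_def q_def tzero_def)
  have A1: "(y, 0) \<in> snd ?Tc ` V" if "y \<in> A" for y using that by (simp add: A_def)
  have r_eq: "r (snd c x', w) = snd ?Pc (R (x', tvec_of M c x' w))" if "c \<in> charts_at M x'" for x' w
    using tangent_chart_inv[OF that] by (simp add: r_def)
  have A2: "r (y, 0) = (y, y)" if y: "y \<in> A" for y
  proof -
    obtain x' where x': "c \<in> charts_at M x'" "y = snd c x'" using A_pt[OF y] by blast
    then have "x' \<in> carrier M" unfolding carrier_iff charts_at_iff by blast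
    then show ?thesis using x' by (simp add: r_eq tvec_of_zero R0)
  qed
  have A3: "snd (\<D> r (y, 0) (0, h)) - fst (\<D> r (y, 0) (0, h)) = h" if y: "y \<in> A" for y h
  proof -
    obtain x' where x': "c \<in> charts_at M x'" "y = snd c x'" using A_pt[OF y] by blast
    have rd: "r differentiable (at (y, 0))" by (rule smooth_on_differentiable[OF V(6) A1[OF y]])
    have "((\<lambda>w. (y, w)) has_derivative (\<lambda>w. (0, w))) (at 0)" by (auto intro!: derivative_eq_intros)
    from has_derivative_compose[OF this fderiv_works[OF rd]]
    have "(\<lambda>w. r (y, w)) differentiable (at 0)" unfolding differentiable_def by blast
    from discretization_map_fibre[OF disc x'(1) _ this, of h] r_eq[OF x'(1)]
    have "snd (\<D> (\<lambda>w. r (y, w)) 0 h) - fst (\<D> (\<lambda>w. r (y, w)) 0 h) = h" by (simp add: x'(2))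
    then show ?thesis by (simp only: fderiv_partials(2)[OF rd])
  qed
  \<comment> \<open>The slice of \<open>N\<close> over the fixed point \<open>(q, p)\<close>, that
    is, a neighbourhood of 0 in one fibre.\<close>
  define N' where "N' = {w. ((q, p), w) \<in> N}"
  have N': "open N'" "0 \<in> N'"
    using open_vimage[OF oN, of "\<lambda>w. ((q, p), w)"] qN
    by (simp_all add: N'_def vimage_def continuous_intros)
  have "Y differentiable (at ((q, p), 0))" by (rule smooth_on_differentiable[OF L(5) qN])
  moreover have "((\<lambda>w. ((q, p), w)) has_derivative (\<lambda>w. (0, w))) (at 0)"
    by (auto intro!: derivative_eq_intros)
  ultimately have "((\<lambda>w. Y ((q, p), w)) has_derivative (\<lambda>w. \<D> Y ((q, p), 0) (0, w))) (at 0)"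
    using has_derivative_compose fderiv_works by blast
  then show gd: "g differentiable (at 0)" unfolding g differentiable_def by blast
  have G: "fst (fst (g w)) = fst (r (q, fst w))" "fst (snd (g w)) = snd (r (q, fst w))"
    "(- snd (fst (g w)), snd (snd (g w))) \<bullet> \<D> r (q, fst w) a = (snd w, p) \<bullet> a" if "w \<in> N'" for w a
    using L(2-4)[of "((q, p), w)"] that by (simp_all add: N'_def g)
  note coord = lifted_discretization_coordinates[OF fdim V(6) A qA A1 A2 A3 N' G gd]
  show "snd (\<D> g 0 w) - fst (\<D> g 0 w) = w" by (rule coord(2))
  have inv0: "chart_inv ?C ((q, p), 0) = ((x, \<alpha>), tzero)"
    using CM.tangent_chart_inv[OF Cc, of 0] CM.tvec_of_zero[OF Cc] by (simp add: q_def p_def)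
  have "lifted_map M R ((x, \<alpha>), tzero) \<in> fst ?D" using L(1)[OF qN] inv0 by simp
  moreover have "((x, \<alpha>), (x, \<alpha>)) \<in> fst ?D" using cM \<alpha> by simp
  \<comment> \<open>The coordinate lemma yields equal coordinates; both points lie in the domain of
    \<open>?D\<close>, whose injectivity then makes them equal.\<close>
  moreover have "snd ?D (lifted_map M R ((x, \<alpha>), tzero)) = snd ?D ((x, \<alpha>), (x, \<alpha>))"
    using coord(1) by (simp add: g Y_def inv0) (simp add: q_def p_def)
  moreover have "?D \<in> prod_mfd (cotangent_bundle M) (cotangent_bundle M)"
    using Cc unfolding prod_mfd_iff charts_at_iff by blast
  ultimately show "lifted_map M R ((x, \<alpha>), tzero) = ((x, \<alpha>), (x, \<alpha>))"
    using PCM.inj_chart inj_onD by metis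
qed

text \<open>At each point of the domain, a local inverse of \<open>R\<close> at the associated
  \<open>(x, v)\<close> feeds \<open>lifted_map_chart\<close>; what remains is to carry the
  coordinate neighbourhood \<open>N\<close> back to the manifold.\<close>

lemma smooth_lifted_map:
  assumes U: "openin (mtop (tangent_bundle M)) U"
    and diffeo: "local_diffeo_on (tangent_bundle M) (prod_mfd M M) U R"
  shows "smooth_map_on (tangent_bundle (cotangent_bundle M))
    (prod_mfd (cotangent_bundle M) (cotangent_bundle M)) (lifted_domain M U) (lifted_map M R)"
proof (rule smooth_map_onI[OF TCM.fd_atlas_axioms openin_lifted_domain[OF U]])
  fix z assume z: "z \<in> lifted_domain M U"
  then have "z \<in> carrier (tangent_bundle (cotangent_bundle M))" by (simp add: lifted_domain_def)
  then obtain x \<alpha> \<zeta> c where zx: "z = ((x, \<alpha>), \<zeta>)" "c \<in> charts_at M x" "\<alpha> \<in> cotangent_space M x"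
    "\<zeta> \<in> tangent_space (cotangent_bundle M) (x, \<alpha>)" by (rule carrier_TCM_E)
  define v where "v = tvec_of M c x (fst (\<zeta> (cotangent_chart M c)))"
  have cM: "c \<in> M" using zx by (simp add: charts_at_iff)
  have xv: "(x, v) \<in> U" using lifted_domain_iff[OF zx(2-4)] z zx(1) by (simp add: v_def)
  let ?Tc = "tangent_chart M c" and ?C = "tangent_chart (cotangent_bundle M) (cotangent_chart M c)"
  have Tc: "?Tc \<in> charts_at (tangent_bundle M) (x, v)"
    using zx(2) tvec_of_in[OF zx(2)] by (auto simp: charts_at_tangent v_def)
  obtain y0 y1 where y: "R (x, v) = (y0, y1)" by fastforce
  have "(y0, y1) \<in> carrier (prod_mfd M M)"
    using diffeo xv y unfolding local_diffeo_on_def smooth_map_on_def by (metis image_subset_iff)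
  then obtain D where "D \<in> prod_mfd M M" "(y0, y1) \<in> fst D" unfolding carrier_iff by blast
  then obtain d\<^sub>0 d\<^sub>1 where d: "d\<^sub>0 \<in> M" "d\<^sub>1 \<in> M" "(y0, y1) \<in> fst (prod_chart d\<^sub>0 d\<^sub>1)"
    unfolding prod_mfd_iff by blast
  let ?Pd = "prod_chart d\<^sub>0 d\<^sub>1" and ?D = "prod_chart (cotangent_chart M d\<^sub>0) (cotangent_chart M d\<^sub>1)"
  have Pd: "?Pd \<in> charts_at (prod_mfd M M) (R (x, v))"
    using d y unfolding charts_at_iff prod_mfd_iff by auto
  define r where "r = snd ?Pd \<circ> R \<circ> chart_inv ?Tc"
  obtain V\<^sub>0 V s where V: "smooth_map_on (tangent_bundle M) (prod_mfd M M) V\<^sub>0 R" "V \<subseteq> V\<^sub>0"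
    "(x, v) \<in> V" "V \<subseteq> U \<inter> fst ?Tc" "R ` V \<subseteq> fst ?Pd"
    "smooth_on (snd ?Tc ` V) r" "smooth_on (snd ?Pd ` R ` V) s"
    "\<forall>z\<in>V. s (snd ?Pd (R z)) = snd ?Tc z"
    unfolding r_def
    by (rule local_diffeo_chart[OF TM.fd_atlas_axioms PM.fd_atlas_axioms diffeo xv Tc Pd]) blast
  have VT: "V \<subseteq> fst ?Tc" using V(4) by blast
  define N where "N = {t. base_coords t \<in> snd ?Tc ` V}"
  note L = lifted_map_chart[OF V(2) VT V(5) cM d(1,2) V(1,6) r_def V(7,8), folded N_def]
  define V' where "V' = {z\<in>fst ?C. snd ?C z \<in> N}"
  \<comment> \<open>Points of \<open>N\<close> constrain only the base coordinates, and any momenta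
    complete them to a point of the chart domain, so nothing of \<open>N\<close> is lost.\<close>
  have "snd ?C ` V' = N"
  proof (intro equalityI subsetI)
    fix t assume "t \<in> N"
    from L(1)[OF this] this show "t \<in> snd ?C ` V'"
      by (intro image_eqI[of _ _ "chart_inv ?C t"]) (simp_all add: V'_def)
  qed (auto simp: V'_def)
  then have "smooth_on (snd ?C ` V') (snd ?D \<circ> lifted_map M R \<circ> chart_inv ?C)" using L(5) by simp
  moreover have "z \<in> V'"
  proof -
    have "(snd c x, fst (\<zeta> (cotangent_chart M c))) \<in> snd ?Tc ` V"
      using tangent_chart_image_iff[OF zx(2) VT] V(3) by (simp add: v_def)
    then show ?thesis using zx by (simp add: V'_def N_def charts_at_iff)
  qed
  moreover have "V' \<subseteq> lifted_domain M U \<inter> fst ?C"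
  proof
    fix z' assume "z' \<in> V'"
    then have z'C: "z' \<in> fst ?C" "snd ?C z' \<in> N" by (simp_all add: V'_def)
    obtain x' \<alpha>' \<zeta>' where z': "z' = ((x', \<alpha>'), \<zeta>')" "c \<in> charts_at M x'" "\<alpha>' \<in> cotangent_space M x'"
      "\<zeta>' \<in> tangent_space (cotangent_bundle M) (x', \<alpha>')" using z'C(1) cM by (rule chart_TCM_E)
    have "(x', tvec_of M c x' (fst (\<zeta>' (cotangent_chart M c)))) \<in> V"
      using tangent_chart_image_iff[OF z'(2) VT] z'C(2) by (simp add: N_def z'(1))
    then show "z' \<in> lifted_domain M U \<inter> fst ?C"
      using lifted_domain_iff[OF z'(2-4)] V(4) z'(1) z'C(1) by blast
  qed
  moreover have "lifted_map M R ` V' \<subseteq> fst ?D"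
  proof
    fix u assume "u \<in> lifted_map M R ` V'"
    then obtain z' where "z' \<in> fst ?C" "snd ?C z' \<in> N" "u = lifted_map M R z'" by (auto simp: V'_def)
    then show "u \<in> fst ?D" using L(1) TCM.chart_inv_snd[OF chart_TCM[OF cM]] by metis
  qed
  moreover have "?D \<in> prod_mfd (cotangent_bundle M) (cotangent_bundle M)"
    using d unfolding prod_mfd_iff cotangent_bundle_def by blast
  ultimately show "\<exists>C\<in>tangent_bundle (cotangent_bundle M).
     \<exists>D\<in>prod_mfd (cotangent_bundle M) (cotangent_bundle M). \<exists>V. z \<in> V \<and> V \<subseteq> lifted_domain M U \<inter> fst C \<and>
       lifted_map M R ` V \<subseteq> fst D \<and> smooth_on (snd C ` V) (snd D \<circ> lifted_map M R \<circ> chart_inv C)"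
    using chart_TCM[OF cM] by blast
qed

theorem discretization_map_lifted:
  assumes man: "smooth_manifold M" and disc: "discretization_map M W R"
    and U: "openin (mtop (tangent_bundle M)) U" and zero: "\<forall>x\<in>carrier M. (x, tzero) \<in> U"
    and diffeo: "local_diffeo_on (tangent_bundle M) (prod_mfd M M) U R"
  shows "discretization_map (cotangent_bundle M) (lifted_domain M U) (lifted_map M R)"
  unfolding discretization_map_def
proof (intro conjI ballI)
  show "smooth_manifold (cotangent_bundle M)" by (rule smooth_manifold_cotangent[OF man])
  show "openin (mtop (tangent_bundle (cotangent_bundle M))) (lifted_domain M U)"
    by (rule openin_lifted_domain[OF U])
  show "smooth_map_on (tangent_bundle (cotangent_bundle M))
      (prod_mfd (cotangent_bundle M) (cotangent_bundle M)) (lifted_domain M U) (lifted_map M R)"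
    by (rule smooth_lifted_map[OF U diffeo])
  fix z assume z: "z \<in> carrier (cotangent_bundle M)"
  obtain x \<alpha> where zx: "z = (x, \<alpha>)" by fastforce
  have x: "x \<in> carrier M" and \<alpha>: "\<alpha> \<in> cotangent_space M x" using z by (auto simp: zx carrier_cotangent)
  obtain c where c: "c \<in> charts_at M x" using x unfolding carrier_iff charts_at_iff by blast
  note Z = lifted_map_zero_section[OF disc zero diffeo _ \<alpha>]
  have "fst ((tzero :: ('a \<times> ('a, 'e) covec, 'e \<times> 'e) tvec) (cotangent_chart M c)) = 0"
    by (simp add: tzero_def)
  then show "(z, tzero) \<in> lifted_domain M U"
    using lifted_domain_iff[OF c \<alpha> CM.tzero_in] zero x tvec_of_zero[OF c] by (simp add: zx)
  show R0: "lifted_map M R (z, tzero) = (z, z)" unfolding zx by (rule Z(1)[OF c])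
  fix v assume v: "v \<in> tangent_space (cotangent_bundle M) z"
  let ?T = "\<lambda>f. tangent_map (fibre_mfd (cotangent_bundle M) z) (cotangent_bundle M) f tzero
      (fibre_iso (cotangent_bundle M) z v)"
  show "(\<lambda>C. ?T (\<lambda>u. snd (lifted_map M R (z, u))) C - ?T (\<lambda>u. fst (lifted_map M R (z, u))) C) = v"
  proof
    fix C
    show "?T (\<lambda>u. snd (lifted_map M R (z, u))) C - ?T (\<lambda>u. fst (lifted_map M R (z, u))) C = v C"
    \<comment> \<open>Tangent vectors are families over all charts, so the identity is checked for
      each component. In a chart that misses \<open>z\<close> both tangent maps and \<open>v\<close>
      are 0 by convention.\<close>
    proof (cases "C \<in> charts_at (cotangent_bundle M) z")
      case False
      then show ?thesis using CM.tangent_outside[OF v False] by (simp add: tangent_map_def Let_def R0)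
    next
      case C: True
      \<comment> \<open>The zero-section computation is available in every chart around
        \<open>x\<close>, so it is instantiated anew for the chart of each component.\<close>
      then obtain d where d: "d \<in> charts_at M x" "C = cotangent_chart M d"
        by (auto simp: zx charts_at_cotangent)
      define g where "g = (\<lambda>w. snd (prod_chart C C) (lifted_map M R (z,
        tvec_of (cotangent_bundle M) C z w)))"
      note G = Z(2,3)[OF d(1), folded d(2) zx, folded g_def]
      have g12: "(\<lambda>w. snd C (fst (lifted_map M R (z, tvec_of (cotangent_bundle M) C z w)))) =
        (\<lambda>w. fst (g w))"
        "(\<lambda>w. snd C (snd (lifted_map M R (z, tvec_of (cotangent_bundle M) C z w)))) = (\<lambda>w. snd (g w))"
        by (simp_all add: g_def prod_chart_def map_prod_def case_prod_unfold)
      note D = has_derivative_fst[OF fderiv_works[OF G(1)]] has_derivative_snd[OF fderiv_works[OF G(1)]]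
      have D': "\<D> (\<lambda>w. fst (g w)) 0 = (\<lambda>h. fst (\<D> g 0 h))" "\<D> (\<lambda>w. snd (g w)) 0 = (\<lambda>h. snd (\<D> g 0 h))"
        "(\<lambda>w. fst (g w)) differentiable (at 0)" "(\<lambda>w. snd (g w)) differentiable (at 0)"
        using D fderivI[OF D(1)] fderivI[OF D(2)] unfolding differentiable_def by blast+
      have "?T (\<lambda>u. fst (lifted_map M R (z, u))) C = fst (\<D> g 0 (v C))"
        by (subst CM.tangent_map_fibre[OF C _ _ v])
          (simp_all only: R0 g12 fst_conv snd_conv D')
      moreover have "?T (\<lambda>u. snd (lifted_map M R (z, u))) C = snd (\<D> g 0 (v C))"
        by (subst CM.tangent_map_fibre[OF C _ _ v])
          (simp_all only: R0 g12 fst_conv snd_conv D')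
      ultimately show ?thesis using G(2) by simp
    qed
  qed
qed

end

text \<open>\<open>W\<close> is the full domain of the discretization map and \<open>U\<close> a
  neighbourhood of the zero section inside it where the map is a local diffeomorphism. The
  comprehension is the preimage under \<open>tulczyjew\<close> of the part of the cotangent bundle
  lying over \<open>U\<close>.\<close>

theorem proposition3p6:
  fixes Q :: "('a, 'e::real_inner) atlas"
    and R\<^sub>d :: "'a \<times> ('a, 'e) tvec \<Rightarrow> 'a \<times> 'a"
    and W U :: "('a \<times> ('a, 'e) tvec) set"
  assumes "smooth_manifold Q"
    and "discretization_map Q W R\<^sub>d"
    and "U \<subseteq> W"
    and "openin (mtop (tangent_bundle Q)) U"
    and "\<forall>x\<in>carrier Q. (x, tzero) \<in> U"
    and "local_diffeo_on (tangent_bundle Q) (prod_mfd Q Q) U R\<^sub>d"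
  shows "discretization_map (cotangent_bundle Q)
           {z \<in> carrier (tangent_bundle (cotangent_bundle Q)).
              tulczyjew Q z \<in> cotangent_over (tangent_bundle Q) U}
           (Phi_inv Q \<circ> cotangent_lift (tangent_bundle Q) (prod_mfd Q Q) R\<^sub>d \<circ> tulczyjew Q)"
  using fd_atlas.discretization_map_lifted[OF smooth_manifold_fd_atlas[OF assms(1)] assms(1,2,4-6)]
  unfolding lifted_domain_def lifted_map_def .

end
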